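(* Let $(J,W)$ be a graphon. The following are equivalent: (i) $(J,W)$ is node-transitive; (ii) for every 1-labeled simple graph $F$, the function $x\mapsto t_x(F,W)$ is essentially constant on $J$; (iii) $\dim(\mathcal{A}_1)=1$; (iv) the first connection matrix $M_1$ of $W$ has rank $1$; (v) $t(\underline{F^2},W)\,t(\underline{H^2},W)=t(\underline{FH},W)^2$ for all 1-labeled simple graphs $F,H$.
   Context: A graphon is a pair $(J,W)$ where $J$ is a standard probability space with probability measure $\pi$ and $W:J\times J\to[0,1]$ is a symmetric measurable function. For a simple graph $F=(V,E)$, $t(F,W)=\int_{J^V}\prod_{ij\in E}W(x_i,x_j)\prod_{i\in V}d\pi(x_i)$; two graphons are weakly isomorphic if $t(F,\cdot)$ agree for all simple graphs $F$. A graphon is pure if (with every section $W(x,\cdot)$ measurable) $r_W(x,y)=\int|W(x,z)-W(y,z)|\,d\pi(z)$ is a metric, $(J,r_W)$ is complete and $\pi$ has full support; every graphon is weakly isomorphic to a pure graphon (its pure representation). An automorphism of a pure graphon $(J,W)$ is a measure preserving bijection $\sigma:J\to J$ such that for every $x$, $W(x^\sigma,y^\sigma)=W(x,y)$ for almost all $y$. A graphon is node-transitive if the automorphism group of its pure representation acts transitively on the underlying set. A 1-labeled simple graph has one node labeled $1$; $t_x(F,W)$ is defined like $t(F,W)$ but without integrating the variable of the labeled node, which is set to $x$. For 1-labeled graphs $F,H$, $FH$ is obtained by identifying the labeled nodes of disjoint copies of $F$ and $H$ and reducing multiple edges; $\underline{G}$ denotes $G$ with its label removed. $\mathcal A_1$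 is the linear span (a subalgebra of $L^\infty(J)$) of the functions $x\mapsto t_x(F,W)$ over all 1-labeled simple graphs $F$. The first connection matrix is the infinite matrix $M_1(F,H)=t(\underline{FH},W)$ indexed by 1-labeled simple graphs. *)

theory Defs
  imports "HOL-Probability.Probability" "HOL-Library.Function_Algebras"
begin

text \<open>Up to isomorphism the nodes of a finite graph may be taken to be natural numbers. A graph is
  a pair of a node set and an edge set, the edges being two-element sets of nodes; a 1-labeled graph
  carries its labeled node as a third component.\<close>

type_synonym graph = "nat set \<times> nat set set"
type_synonym labeled_graph = "nat set \<times> nat set set \<times> nat"

definition simple_graph :: "graph \<Rightarrow> bool" where
  "simple_graph = (\<lambda>(V, E). finite V \<and> (\<forall>e\<in>E. e \<subseteq> V \<and> card e = 2))"

definition unlabel :: "labeled_graph \<Rightarrow> graph" where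
  "unlabel = (\<lambda>(V, E, l). (V, E))"

definition labeled_simple_graphs :: "labeled_graph set" where
  "labeled_simple_graphs = {(V, E, l). simple_graph (V, E) \<and> l \<in> V}"

text \<open>In \<open>glue F H\<close> the nodes of \<open>F\<close> become odd and those of \<open>H\<close> become even and positive, except for
  the two labeled nodes, which both become \<open>0\<close>. Edges form a set, so multiple edges are reduced.\<close>

definition glue_left :: "nat \<Rightarrow> nat \<Rightarrow> nat" where
  "glue_left l v = (if v = l then 0 else 2 * v + 1)"

definition glue_right :: "nat \<Rightarrow> nat \<Rightarrow> nat" where
  "glue_right l v = (if v = l then 0 else 2 * v + 2)"

definition glue :: "labeled_graph \<Rightarrow> labeled_graph \<Rightarrow> labeled_graph" where
  "glue = (\<lambda>(V, E, l) (V', E', l').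
     (glue_left l ` V \<union> glue_right l' ` V',
      (\<lambda>e. glue_left l ` e) ` E \<union> (\<lambda>e. glue_right l' ` e) ` E',
      0))"

text \<open>A standard probability space is a probability measure on a standard Borel space, i.e. on the
  Borel sigma-algebra of a Polish topology on the underlying set.\<close>

definition standard_prob_space :: "'a measure \<Rightarrow> bool" where
  "standard_prob_space M \<longleftrightarrow> prob_space M \<and>
     (\<exists>X :: 'a topology. completely_metrizable_space X \<and> second_countable X \<and>
        topspace X = space M \<and> sets M = sigma_sets (space M) {U. openin X U})"

definition graphon :: "'a measure \<Rightarrow> ('a \<Rightarrow> 'a \<Rightarrow> real) \<Rightarrow> bool" where
  "graphon M W \<longleftrightarrow> standard_prob_space M \<and>
     case_prod W \<in> borel_measurable (M \<Otimes>\<^sub>M M) \<and>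
     (\<forall>x\<in>space M. \<forall>y\<in>space M. W x y = W y x \<and> 0 \<le> W x y \<and> W x y \<le> 1)"

text \<open>By symmetry of \<open>W\<close>, each edge contributes one factor, read off from its increasingly ordered
  pair of endpoints.\<close>

definition edge_prod :: "('a \<Rightarrow> 'a \<Rightarrow> real) \<Rightarrow> graph \<Rightarrow> (nat \<Rightarrow> 'a) \<Rightarrow> real" where
  "edge_prod W = (\<lambda>(V, E) x. \<Prod>(i, j)\<in>{(i, j). i \<in> V \<and> j \<in> V \<and> i < j \<and> {i, j} \<in> E}. W (x i) (x j))"

definition hom_density :: "'a measure \<Rightarrow> ('a \<Rightarrow> 'a \<Rightarrow> real) \<Rightarrow> graph \<Rightarrow> real" where
  "hom_density M W F = (\<integral>x. edge_prod W F x \<partial>(\<Pi>\<^sub>M i\<in>fst F. M))"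

definition labeled_density ::
  "'a measure \<Rightarrow> ('a \<Rightarrow> 'a \<Rightarrow> real) \<Rightarrow> labeled_graph \<Rightarrow> 'a \<Rightarrow> real" where
  "labeled_density M W = (\<lambda>(V, E, l) a.
     (\<integral>x. edge_prod W (V, E) (x(l := a)) \<partial>(\<Pi>\<^sub>M i\<in>V - {l}. M)))"

definition weakly_isomorphic ::
  "'a measure \<Rightarrow> ('a \<Rightarrow> 'a \<Rightarrow> real) \<Rightarrow> 'b measure \<Rightarrow> ('b \<Rightarrow> 'b \<Rightarrow> real) \<Rightarrow> bool" where
  "weakly_isomorphic M W N U \<longleftrightarrow>
     (\<forall>F. simple_graph F \<longrightarrow> hom_density M W F = hom_density N U F)"

definition graphon_dist :: "'a measure \<Rightarrow> ('a \<Rightarrow> 'a \<Rightarrow> real) \<Rightarrow> 'a \<Rightarrow> 'a \<Rightarrow> real" where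
  "graphon_dist M W x y = (\<integral>z. \<bar>W x z - W y z\<bar> \<partial>M)"

text \<open>All sections of a graphon are measurable here because \<open>W\<close> is measurable for the product
  sigma-algebra. By Fubini's theorem and separability, all open sets of the metric are measurable.\<close>

definition pure_graphon :: "'a measure \<Rightarrow> ('a \<Rightarrow> 'a \<Rightarrow> real) \<Rightarrow> bool" where
  "pure_graphon M W \<longleftrightarrow> graphon M W \<and>
     Metric_space (space M) (graphon_dist M W) \<and>
     Metric_space.mcomplete (space M) (graphon_dist M W) \<and>
     (\<forall>U. openin (Metric_space.mtopology (space M) (graphon_dist M W)) U \<and> U \<noteq> {} \<longrightarrow>
        0 < measure M U)"

definition graphon_automorphism ::
  "'a measure \<Rightarrow> ('a \<Rightarrow> 'a \<Rightarrow> real) \<Rightarrow> ('a \<Rightarrow> 'a) \<Rightarrow> bool" where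
  "graphon_automorphism M W \<sigma> \<longleftrightarrow>
     bij_betw \<sigma> (space M) (space M) \<and>
     \<sigma> \<in> M \<rightarrow>\<^sub>M M \<and> the_inv_into (space M) \<sigma> \<in> M \<rightarrow>\<^sub>M M \<and> distr M M \<sigma> = M \<and>
     (\<forall>x\<in>space M. AE y in M. W (\<sigma> x) (\<sigma> y) = W x y)"

text \<open>A pure representation is unique up to isomorphism. Its underlying set has at most the
  cardinality of the continuum and its topology comes from the metric of the graphon rather than
  from the ambient type, so it can always be realised on a set of real numbers.\<close>

definition pure_representation ::
  "'a measure \<Rightarrow> ('a \<Rightarrow> 'a \<Rightarrow> real) \<Rightarrow> real measure \<Rightarrow> (real \<Rightarrow> real \<Rightarrow> real) \<Rightarrow> bool" where
  "pure_representation M W N U \<longleftrightarrow> pure_graphon N U \<and> weakly_isomorphic M W N U"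

definition node_transitive :: "'a measure \<Rightarrow> ('a \<Rightarrow> 'a \<Rightarrow> real) \<Rightarrow> bool" where
  "node_transitive M W \<longleftrightarrow> (\<exists>N U. pure_representation M W N U \<and>
     (\<forall>x\<in>space N. \<forall>y\<in>space N. \<exists>\<sigma>. graphon_automorphism N U \<sigma> \<and> \<sigma> x = y))"

definition fun_scale :: "real \<Rightarrow> ('i \<Rightarrow> real) \<Rightarrow> 'i \<Rightarrow> real" where
  "fun_scale c f = (\<lambda>x. c * f x)"

interpretation fun_space: vector_space "fun_scale :: real \<Rightarrow> ('i \<Rightarrow> real) \<Rightarrow> 'i \<Rightarrow> real"
  by unfold_locales (auto simp: fun_scale_def fun_eq_iff algebra_simps)

definition algebra_A1 :: "'a measure \<Rightarrow> ('a \<Rightarrow> 'a \<Rightarrow> real) \<Rightarrow> ('a \<Rightarrow> real) set" where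
  "algebra_A1 M W = fun_space.span (labeled_density M W ` labeled_simple_graphs)"

text \<open>Elements of \<open>L\<^sup>\<infinity>\<close> are classes of functions modulo equality almost everywhere. The following
  says that the subspace of \<open>L\<^sup>\<infinity>(M)\<close> formed by the classes of the functions in \<open>A\<close> has a basis
  with \<open>n\<close> elements.\<close>

definition has_Linf_dim :: "'a measure \<Rightarrow> ('a \<Rightarrow> real) set \<Rightarrow> nat \<Rightarrow> bool" where
  "has_Linf_dim M A n \<longleftrightarrow> (\<exists>b :: nat \<Rightarrow> 'a \<Rightarrow> real.
     (\<forall>i<n. b i \<in> A) \<and>
     (\<forall>c :: nat \<Rightarrow> real. (AE x in M. (\<Sum>i<n. c i * b i x) = 0) \<longrightarrow> (\<forall>i<n. c i = 0)) \<and>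
     (\<forall>f\<in>A. \<exists>c :: nat \<Rightarrow> real. AE x in M. f x = (\<Sum>i<n. c i * b i x)))"

text \<open>The row rank of a real matrix with rows and columns indexed by \<open>I\<close>. The library sets the
  dimension of an infinite-dimensional space to \<open>0\<close>, so a positive value is a genuine finite rank.\<close>

definition matrix_rank :: "'i set \<Rightarrow> ('i \<Rightarrow> 'i \<Rightarrow> real) \<Rightarrow> nat" where
  "matrix_rank I A = fun_space.dim ((\<lambda>i j. if j \<in> I then A i j else 0) ` I)"

definition connection_matrix ::
  "'a measure \<Rightarrow> ('a \<Rightarrow> 'a \<Rightarrow> real) \<Rightarrow> labeled_graph \<Rightarrow> labeled_graph \<Rightarrow> real" where
  "connection_matrix M W F H = hom_density M W (unlabel (glue F H))"

end

theory Submission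
  imports Defs
begin

text \<open>Integrating the squares of the densities shows that (ii)--(v) all say that the variance of every
  \<open>t\<^sub>x(F, W)\<close> vanishes, and automorphisms preserve these functions, so (i) implies (ii).

  Conversely, let \<open>W\<close> be pure with every \<open>t\<^sub>x(F, W)\<close> constant and let \<open>x\<close>, \<open>y\<close> be two nodes. Call two
  tuples of nodes equivalent if all densities of labeled graphs without edges between labels agree on
  them. If \<open>a\<close> and \<open>b\<close> are equivalent, the sequences of densities of \<open>(a, z)\<close> and \<open>(b, z)\<close> have, for
  random \<open>z\<close>, the same moments and hence the same law. By tightness their images of large compact sets
  meet, so for some \<open>z\<close> in any given ball there is \<open>z'\<close> with \<open>(a, z)\<close> and \<open>(b, z')\<close> equivalent. Going back
  and forth from \<open>x\<close>, \<open>y\<close> yields two dense sequences for which the inner products of distinct sections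
  agree. Density then gives equality of the norms as well, so the correspondence of the sequences
  extends to an isometry. It preserves the measure and \<open>W\<close> because both are determined by the moments
  of the codegree functions.\<close>

subsection \<open>Densities of partially labeled graphs\<close>

text \<open>Only simple graphs are available, so no density contains a double edge. The square norm
  \<open>codeg x x\<close> of a section would need one; this is why norms have to be recovered as
  limits of off-diagonal values, and why every neighbourhood must be visited infinitely often. Edges
  between labels are avoided for a further reason: the metric sees each row only up to null sets, so
  the value of the kernel at a single pair of nodes carries no information and need not depend
  continuously on either node. Images of Borel sets under Borel maps would lead to analytic sets;
  mapping compact sets only keeps all images closed. Finally, node-transitivity asserts that a pure
  representation exists, so one has to be built: nodes are embedded isometrically in a Banach space
  of bounded sequences, whose topology serves the analysis, and the support is afterwards copied to
  a set of reals, the type fixed in \<open>pure_representation\<close>.\<close>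

text \<open>Edges are ordered pairs here, each edge occurring in exactly one of its two orientations; unlike
  the increasing orientation of \<open>edge_prod\<close>, this is stable under renaming nodes.\<close>

definition oriented :: "(nat \<times> nat) set \<Rightarrow> bool" where
  "oriented E \<longleftrightarrow> finite E \<and> E \<inter> E\<inverse> = {}"

definition edge_weight :: "('a \<Rightarrow> 'a \<Rightarrow> real) \<Rightarrow> (nat \<times> nat) set \<Rightarrow> (nat \<Rightarrow> 'a) \<Rightarrow> real" where
  "edge_weight W E x = (\<Prod>(i, j)\<in>E. W (x i) (x j))"

text \<open>The nodes outside \<open>V\<close> are the labels and take their values from
  \<open>a\<close>, so one integral covers homomorphism densities (no label), the functions t_x (one
  label) and densities of tuples.\<close>

definition dens :: "'a measure \<Rightarrow> ('a \<Rightarrow> 'a \<Rightarrow> real) \<Rightarrow> nat set \<Rightarrow> (nat \<times> nat) set \<Rightarrow> (nat \<Rightarrow> 'a) \<Rightarrow> real"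
  where "dens M W V E a = (\<integral>x. edge_weight W E (\<lambda>i. if i \<in> V then x i else a i) \<partial>(\<Pi>\<^sub>M i\<in>V. M))"

lemma edge_weight_cong:
  assumes "\<And>i. i \<in> Field E \<Longrightarrow> x i = y i"
  shows "edge_weight W E x = edge_weight W E y"
  unfolding edge_weight_def
proof (rule prod.cong[OF refl])
  fix e assume "e \<in> E"
  then show "(case e of (i, j) \<Rightarrow> W (x i) (x j)) = (case e of (i, j) \<Rightarrow> W (y i) (y j))"
    by (cases e) (metis FieldI1 FieldI2 assms case_prod_conv)
qed

lemma dens_cong:
  assumes "\<And>i. i \<in> Field E \<Longrightarrow> i \<notin> V \<Longrightarrow> a i = b i"
  shows "dens M W V E a = dens M W V E b"
  unfolding dens_def
  by (intro Bochner_Integration.integral_cong refl edge_weight_cong) (auto simp: assms)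

text \<open>Interpreted for the given graphon, for its image in a sequence space and for the copy of
  that image on the reals.\<close>

locale kernel = prob_space M for M :: "'a measure" +
  fixes W :: "'a \<Rightarrow> 'a \<Rightarrow> real"
  assumes W_measurable: "case_prod W \<in> borel_measurable (M \<Otimes>\<^sub>M M)"
    and W_sym: "x \<in> space M \<Longrightarrow> y \<in> space M \<Longrightarrow> W x y = W y x"
    and W_nonneg: "x \<in> space M \<Longrightarrow> y \<in> space M \<Longrightarrow> 0 \<le> W x y"
    and W_le_1: "x \<in> space M \<Longrightarrow> y \<in> space M \<Longrightarrow> W x y \<le> 1"
begin

lemma W_comp_measurable [measurable (raw)]:
  "f \<in> N \<rightarrow>\<^sub>M M \<Longrightarrow> g \<in> N \<rightarrow>\<^sub>M M \<Longrightarrow> (\<lambda>x. W (f x) (g x)) \<in> borel_measurable N"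
  using measurable_compose[OF measurable_Pair W_measurable] by simp

lemma prob_space_PiM': "prob_space (\<Pi>\<^sub>M i\<in>V. M)"
  by (intro prob_space_PiM prob_space_axioms)

lemma edge_weight_bounds:
  assumes "\<And>i. i \<in> Field E \<Longrightarrow> x i \<in> space M"
  shows "0 \<le> edge_weight W E x" "edge_weight W E x \<le> 1"
  unfolding edge_weight_def
  by (auto intro!: prod_nonneg prod_le_1 W_nonneg W_le_1 assms simp: Field_def split: prod.splits)

lemma edge_weight_measurable [measurable (raw)]:
  assumes [measurable]: "\<And>i. i \<in> Field E \<Longrightarrow> (\<lambda>x. f x i) \<in> N \<rightarrow>\<^sub>M M"
  shows "(\<lambda>x. edge_weight W E (f x)) \<in> borel_measurable N"
  unfolding edge_weight_def case_prod_beta'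
  by (rule borel_measurable_prod) (auto intro!: W_comp_measurable assms simp: Field_def)

lemma merged_measurable:
  assumes "\<And>i. a i \<in> space M"
  shows "(\<lambda>x. if i \<in> V then x i else a i) \<in> (\<Pi>\<^sub>M i\<in>V. M) \<rightarrow>\<^sub>M M"
  using assms by (cases "i \<in> V") auto

lemma dens_integrable:
  assumes "\<And>i. a i \<in> space M"
  shows "integrable (\<Pi>\<^sub>M i\<in>V. M) (\<lambda>x. edge_weight W E (\<lambda>i. if i \<in> V then x i else a i))"
proof -
  interpret P: prob_space "\<Pi>\<^sub>M i\<in>V. M" by (rule prob_space_PiM')
  have "(\<lambda>x. edge_weight W E (\<lambda>i. if i \<in> V then x i else a i)) \<in> borel_measurable (\<Pi>\<^sub>M i\<in>V. M)"
    by (intro edge_weight_measurable merged_measurable assms)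
  then show ?thesis
    using edge_weight_bounds[of E]
    by (intro P.integrable_const_bound[where B=1] AE_I2)
       (auto simp: abs_le_iff space_PiM PiE_iff assms intro!: edge_weight_bounds
         order_trans[OF _ zero_le_one, of "- _"])
qed

lemma dens_bounds:
  assumes "\<And>i. a i \<in> space M"
  shows "0 \<le> dens M W V E a" "dens M W V E a \<le> 1"
proof -
  interpret P: prob_space "\<Pi>\<^sub>M i\<in>V. M" by (rule prob_space_PiM')
  have b: "0 \<le> edge_weight W E (\<lambda>i. if i \<in> V then x i else a i)"
    "edge_weight W E (\<lambda>i. if i \<in> V then x i else a i) \<le> 1" if "x \<in> space (\<Pi>\<^sub>M i\<in>V. M)" for x
    using that assms by (auto intro!: edge_weight_bounds simp: space_PiM PiE_iff)
  show "0 \<le> dens M W V E a"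
    unfolding dens_def by (intro integral_nonneg_AE AE_I2 b)
  show "dens M W V E a \<le> 1"
    unfolding dens_def by (rule P.integral_le_const[OF dens_integrable]) (auto intro: AE_I2 b assms)
qed

lemma dens_empty: "dens M W {} E a = edge_weight W E a"
  unfolding dens_def by (simp add: PiM_empty lebesgue_integral_count_space_finite integral_return)

lemma dens_measurable [measurable (raw)]:
  assumes "finite V" and [measurable]: "\<And>i. (\<lambda>x. f x i) \<in> N \<rightarrow>\<^sub>M M"
  shows "(\<lambda>x. dens M W V E (f x)) \<in> borel_measurable N"
proof -
  interpret P: prob_space "\<Pi>\<^sub>M i\<in>V. M" by (rule prob_space_PiM')
  have [measurable]: "(\<lambda>x. if i \<in> V then snd x i else f (fst x) i) \<in> N \<Otimes>\<^sub>M (\<Pi>\<^sub>M i\<in>V. M) \<rightarrow>\<^sub>M M" for i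
    by (cases "i \<in> V") auto
  have "(\<lambda>x. edge_weight W E (\<lambda>i. if i \<in> V then snd x i else f (fst x) i)) \<in> borel_measurable (N \<Otimes>\<^sub>M (\<Pi>\<^sub>M i\<in>V. M))"
    by measurable
  then show ?thesis
    unfolding dens_def by (intro P.borel_measurable_lebesgue_integral) (simp add: case_prod_beta')
qed

text \<open>Fubini for one node: integrating \<open>v\<close> last means treating it as a label
  first. The inductions over node sets below peel off one node in this way.\<close>

lemma dens_insert:
  assumes V: "finite V" "v \<notin> V" and a: "\<And>i. a i \<in> space M"
  shows "dens M W (insert v V) E a = (\<integral>z. dens M W V E (a(v := z)) \<partial>M)"
proof -
  interpret P: prob_space "\<Pi>\<^sub>M i\<in>V. M" by (rule prob_space_PiM')
  interpret product_sigma_finite "\<lambda>_::nat. M" by standard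
  interpret PP: pair_sigma_finite M "\<Pi>\<^sub>M i\<in>V. M" by standard
  interpret Q: pair_prob_space M "\<Pi>\<^sub>M i\<in>V. M" by standard
  define g where "g = (\<lambda>z x. edge_weight W E (\<lambda>i. if i \<in> V then x i else (a(v := z)) i))"
  have eq: "(\<lambda>i. if i \<in> insert v V then (x(v := z)) i else a i) = (\<lambda>i. if i \<in> V then x i else (a(v := z)) i)" for x z
    using V by auto
  have [measurable]: "(\<lambda>x. if i \<in> V then snd x i else (a(v := fst x)) i) \<in> M \<Otimes>\<^sub>M (\<Pi>\<^sub>M i\<in>V. M) \<rightarrow>\<^sub>M M" for i
    using a by (cases "i \<in> V"; cases "i = v") auto
  have "(\<lambda>p. g (fst p) (snd p)) \<in> borel_measurable (M \<Otimes>\<^sub>M (\<Pi>\<^sub>M i\<in>V. M))"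
    unfolding g_def by measurable
  moreover have "\<bar>g (fst p) (snd p)\<bar> \<le> 1" if "p \<in> space (M \<Otimes>\<^sub>M (\<Pi>\<^sub>M i\<in>V. M))" for p
  proof -
    have "0 \<le> g (fst p) (snd p) \<and> g (fst p) (snd p) \<le> 1"
      unfolding g_def using that a
      by (intro conjI edge_weight_bounds) (auto simp: space_pair_measure space_PiM PiE_iff)
    then show ?thesis by simp
  qed
  ultimately have int: "integrable (M \<Otimes>\<^sub>M (\<Pi>\<^sub>M i\<in>V. M)) (case_prod g)"
    by (intro Q.integrable_const_bound[where B=1] AE_I2) (auto simp: case_prod_beta')
  have "dens M W (insert v V) E a = (\<integral>x. (\<integral>z. g z x \<partial>M) \<partial>(\<Pi>\<^sub>M i\<in>V. M))"
    unfolding dens_def by (subst product_integral_insert[OF V dens_integrable[OF a]]) (simp only: eq g_def)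
  also have "\<dots> = (\<integral>z. (\<integral>x. g z x \<partial>(\<Pi>\<^sub>M i\<in>V. M)) \<partial>M)"
    by (rule PP.Fubini_integral[OF int])
  finally show ?thesis by (simp add: g_def dens_def)
qed

lemma edge_weight_Un:
  assumes "finite E" "finite E'" "E \<inter> E' = {}"
  shows "edge_weight W (E \<union> E') x = edge_weight W E x * edge_weight W E' x"
  unfolding edge_weight_def by (rule prod.union_disjoint[OF assms])

text \<open>Graphs that meet only in labels have independent integrands: the nodes of the second
  graph are integrated out one at a time, and the first factor does not depend on them.\<close>

lemma dens_mult:
  assumes "finite V'" "finite V" "finite E" "finite E'" "V \<inter> V' = {}" "E \<inter> E' = {}"
    "Field E \<inter> V' = {}" "Field E' \<inter> V = {}" "\<And>i. a i \<in> space M"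
  shows "dens M W (V \<union> V') (E \<union> E') a = dens M W V E a * dens M W V' E' a"
  using assms
proof (induction V' arbitrary: a rule: finite_induct)
  case empty
  have *: "edge_weight W (E \<union> E') (\<lambda>i. if i \<in> V then x i else a i)
      = edge_weight W E (\<lambda>i. if i \<in> V then x i else a i) * edge_weight W E' a" for x
  proof -
    have "edge_weight W E' (\<lambda>i. if i \<in> V then x i else a i) = edge_weight W E' a"
      using empty by (intro edge_weight_cong) auto
    then show ?thesis using empty by (simp add: edge_weight_Un)
  qed
  show ?case unfolding dens_empty
    by (simp add: dens_def *)
next
  case (insert v V')
  have sp: "(a(v := z)) i \<in> space M" if "z \<in> space M" for i z using insert.prems that by auto
  have c: "dens M W V E (a(v := z)) = dens M W V E a" for z
    using insert.prems by (intro dens_cong) auto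
  have "dens M W (V \<union> insert v V') (E \<union> E') a = dens M W (insert v (V \<union> V')) (E \<union> E') a" by simp
  also have "\<dots> = (\<integral>z. dens M W (V \<union> V') (E \<union> E') (a(v := z)) \<partial>M)"
    using insert by (intro dens_insert) auto
  also have "\<dots> = (\<integral>z. dens M W V E a * dens M W V' E' (a(v := z)) \<partial>M)"
    using insert.prems sp by (intro Bochner_Integration.integral_cong refl)
      (subst insert.IH, auto simp: c)
  also have "\<dots> = dens M W V E a * dens M W (insert v V') E' a"
    using insert by (subst dens_insert) auto
  finally show ?case .
qed

text \<open>The renaming is injective on all numbers, not only on the nodes, so that updating
  \<open>a\<close> at \<open>\<rho> v\<close> amounts to updating \<open>a \<circ> \<rho>\<close> at
  \<open>v\<close> alone.\<close>

lemma dens_rename: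
  assumes "finite V" "inj \<rho>" "\<And>i. a i \<in> space M"
  shows "dens M W (\<rho> ` V) (map_prod \<rho> \<rho> ` E) a = dens M W V E (a \<circ> \<rho>)"
  using assms
proof (induction V arbitrary: a rule: finite_induct)
  case empty
  have "inj_on (map_prod \<rho> \<rho>) E" using empty(1) by (auto simp: inj_on_def)
  then show ?case
    unfolding image_empty dens_empty edge_weight_def
    by (subst prod.reindex) (auto simp: case_prod_beta')
next
  case (insert v V)
  have sp: "(a(\<rho> v := z)) i \<in> space M" if "z \<in> space M" for i z using insert.prems that by auto
  have "dens M W (\<rho> ` insert v V) (map_prod \<rho> \<rho> ` E) a = (\<integral>z. dens M W (\<rho> ` V) (map_prod \<rho> \<rho> ` E) (a(\<rho> v := z)) \<partial>M)"
    using insert by (simp add: dens_insert inj_image_mem_iff)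
  also have "\<dots> = (\<integral>z. dens M W V E ((a \<circ> \<rho>)(v := z)) \<partial>M)"
  proof (intro Bochner_Integration.integral_cong refl)
    fix z assume "z \<in> space M"
    moreover have "a(\<rho> v := z) \<circ> \<rho> = (a \<circ> \<rho>)(v := z)"
      using insert.prems(1) by (auto simp: fun_eq_iff inj_eq)
    ultimately show "dens M W (\<rho> ` V) (map_prod \<rho> \<rho> ` E) (a(\<rho> v := z)) = dens M W V E ((a \<circ> \<rho>)(v := z))"
      using insert.IH[OF insert.prems(1), of "a(\<rho> v := z)"] sp by metis
  qed
  also have "\<dots> = dens M W (insert v V) E (a \<circ> \<rho>)"
    using insert by (subst dens_insert) auto
  finally show ?case .
qed

text \<open>Flipping the edges on which the two orientations disagree is a bijection between them,
  and symmetry of \<open>W\<close> keeps each factor.\<close>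

lemma edge_weight_orientation:
  assumes "oriented E" "oriented E'" "E \<union> E\<inverse> = E' \<union> E'\<inverse>" "\<And>i. i \<in> Field E \<Longrightarrow> x i \<in> space M"
  shows "edge_weight W E x = edge_weight W E' x"
  unfolding edge_weight_def
proof (rule prod.reindex_bij_witness[where i="\<lambda>e. if e \<in> E then e else prod.swap e"
      and j="\<lambda>e. if e \<in> E' then e else prod.swap e"])
  fix e assume e: "e \<in> E"
  then have e': "e \<in> E' \<or> prod.swap e \<in> E'" "prod.swap e \<notin> E"
    using assms(1-3) by (cases e, auto simp: oriented_def)+
  show "(if (if e \<in> E' then e else prod.swap e) \<in> E then (if e \<in> E' then e else prod.swap e)
      else prod.swap (if e \<in> E' then e else prod.swap e)) = e"
    using e e' by auto
  show "(if e \<in> E' then e else prod.swap e) \<in> E'" using e' by auto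
  show "(case if e \<in> E' then e else prod.swap e of (i, j) \<Rightarrow> W (x i) (x j)) = (case e of (i, j) \<Rightarrow> W (x i) (x j))"
    using e assms(4) by (cases e) (auto intro!: W_sym simp: Field_def)
next
  fix e assume e: "e \<in> E'"
  then have e': "e \<in> E \<or> prod.swap e \<in> E" "prod.swap e \<notin> E'"
    using assms(1-3) by (cases e, auto simp: oriented_def)+
  show "(if (if e \<in> E then e else prod.swap e) \<in> E' then (if e \<in> E then e else prod.swap e)
      else prod.swap (if e \<in> E then e else prod.swap e)) = e"
    using e e' by auto
  show "(if e \<in> E then e else prod.swap e) \<in> E" using e' by auto
qed

lemma dens_orientation:
  assumes "oriented E" "oriented E'" "E \<union> E\<inverse> = E' \<union> E'\<inverse>" "\<And>i. a i \<in> space M"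
  shows "dens M W V E a = dens M W V E' a"
  unfolding dens_def using assms
  by (intro Bochner_Integration.integral_cong refl edge_weight_orientation) (auto simp: space_PiM PiE_iff)

end

section \<open>Orientations of simple graphs\<close>

definition orientation :: "nat set set \<Rightarrow> (nat \<times> nat) set" where
  "orientation E = {(i, j). i < j \<and> {i, j} \<in> E}"

lemma oriented_orientation:
  assumes "simple_graph (V, E)" shows "oriented (orientation E)" "Field (orientation E) \<subseteq> V"
proof -
  have "orientation E \<subseteq> V \<times> V" using assms by (auto simp: orientation_def simple_graph_def)
  moreover have "finite V" using assms by (auto simp: simple_graph_def)
  ultimately have "finite (orientation E)" using finite_subset by blast
  then show "oriented (orientation E)" by (auto simp: oriented_def orientation_def)
  show "Field (orientation E) \<subseteq> V" using \<open>orientation E \<subseteq> V \<times> V\<close> by (auto simp: Field_def)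
qed

lemma edge_prod_eq_edge_weight:
  assumes "simple_graph (V, E)"
  shows "edge_prod W (V, E) x = edge_weight W (orientation E) x"
  using assms unfolding edge_prod_def edge_weight_def orientation_def
  by (auto intro!: prod.cong simp: simple_graph_def)

lemma hom_density_eq_dens:
  assumes "simple_graph (V, E)"
  shows "hom_density M W (V, E) = dens M W V (orientation E) a"
  unfolding hom_density_def dens_def edge_prod_eq_edge_weight[OF assms] fst_conv
  using oriented_orientation(2)[OF assms]
  by (intro Bochner_Integration.integral_cong refl edge_weight_cong) auto

lemma labeled_density_eq_dens:
  assumes "simple_graph (V, E)"
  shows "labeled_density M W (V, E, l) z = dens M W (V - {l}) (orientation E) (\<lambda>_. z)"
  unfolding labeled_density_def dens_def prod.case edge_prod_eq_edge_weight[OF assms]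
  using oriented_orientation(2)[OF assms]
  by (intro Bochner_Integration.integral_cong refl edge_weight_cong) auto

lemma graphon_kernel: "graphon M W \<Longrightarrow> kernel M W"
  unfolding graphon_def standard_prob_space_def kernel_def kernel_axioms_def by auto

subsection \<open>The first connection matrix\<close>

text \<open>Orientations are compared through their symmetric closures; for the increasing one this
  closure is the original edge set.\<close>

lemma orientation_sym:
  assumes "simple_graph (V, E)"
  shows "orientation E \<union> (orientation E)\<inverse> = {(i, j). {i, j} \<in> E}"
proof -
  have "i \<noteq> j" if "{i, j} \<in> E" for i j using assms that by (auto simp: simple_graph_def)
  then show ?thesis by (auto simp: orientation_def insert_commute) (metis linorder_neqE_nat)
qed

lemma inj_glue_left: "inj (glue_left l)" and inj_glue_right: "inj (glue_right l)"
  by (auto simp: inj_def glue_left_def glue_right_def split: if_splits)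

text \<open>Parity separates the two copies, so they meet only in the common value \<open>0\<close>
  of the labels.\<close>

lemma glue_left_eq_right: "glue_left l v = glue_right l' v' \<longleftrightarrow> v = l \<and> v' = l'"
  by (auto simp: glue_left_def glue_right_def split: if_splits) presburger+

lemma glue_labeled_simple_graph:
  assumes "F \<in> labeled_simple_graphs" "H \<in> labeled_simple_graphs"
  shows "glue F H \<in> labeled_simple_graphs"
proof -
  have card: "card (glue_left l ` e) = card e" "card (glue_right l ` e) = card e" for l e
    by (auto intro!: card_image inj_on_subset[OF inj_glue_left] inj_on_subset[OF inj_glue_right])
  then have "glue (V, E, l) (V', E', l') \<in> labeled_simple_graphs"
    if "(V, E, l) \<in> labeled_simple_graphs" "(V', E', l') \<in> labeled_simple_graphs" for V E l V' E' l'
  proof -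
    have "e \<subseteq> V \<and> card e = 2" if "e \<in> E" for e
      using that \<open>(V, E, l) \<in> _\<close> by (auto simp: labeled_simple_graphs_def simple_graph_def)
    moreover have "e \<subseteq> V' \<and> card e = 2" if "e \<in> E'" for e
      using that \<open>(V', E', l') \<in> _\<close> by (auto simp: labeled_simple_graphs_def simple_graph_def)
    moreover have "finite V" "finite V'" "l \<in> V"
      using that by (auto simp: labeled_simple_graphs_def simple_graph_def)
    moreover have "0 = glue_left l l" by (simp add: glue_left_def)
    ultimately show ?thesis
      using card by (fastforce simp del: image_insert simp: labeled_simple_graphs_def glue_def simple_graph_def)
  qed
  then show ?thesis using assms by (metis prod_cases3)
qed

lemma map_prod_orientation_sym:
  assumes "simple_graph (V, E)" "inj \<rho>"
  shows "map_prod \<rho> \<rho> ` orientation E \<union> (map_prod \<rho> \<rho> ` orientation E)\<inverse> = {(i, j). {i, j} \<in> (`) \<rho> ` E}"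
proof -
  have "map_prod \<rho> \<rho> ` orientation E \<union> (map_prod \<rho> \<rho> ` orientation E)\<inverse>
      = map_prod \<rho> \<rho> ` {(i, j). {i, j} \<in> E}"
    unfolding orientation_sym[OF assms(1), symmetric] by auto
  also have "\<dots> = {(i, j). {i, j} \<in> (`) \<rho> ` E}"
  proof (intro equalityI subsetI)
    fix p assume "p \<in> map_prod \<rho> \<rho> ` {(i, j). {i, j} \<in> E}"
    then obtain x y where p: "p = (\<rho> x, \<rho> y)" and "{x, y} \<in> E" by auto
    then have "\<rho> ` {x, y} \<in> (`) \<rho> ` E" by (intro imageI)
    then show "p \<in> {(i, j). {i, j} \<in> (`) \<rho> ` E}" by (simp add: p)
  next
    fix p assume "p \<in> {(i, j). {i, j} \<in> (`) \<rho> ` E}"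
    then obtain i j e where p: "p = (i, j)" and e: "{i, j} = \<rho> ` e" "e \<in> E" by auto
    then obtain i' j' where ij: "i = \<rho> i'" "j = \<rho> j'" by (metis imageE insertCI)
    then have "\<rho> ` e = \<rho> ` {i', j'}" using e by simp
    then have "e = {i', j'}" using assms(2) by (simp only: inj_image_eq_iff)
    then show "p \<in> map_prod \<rho> \<rho> ` {(i, j). {i, j} \<in> E}" using e ij p by (auto simp: image_iff)
  qed
  finally show ?thesis .
qed

lemma oriented_map_prod:
  assumes "oriented E" "inj \<rho>" shows "oriented (map_prod \<rho> \<rho> ` E)"
  using assms unfolding oriented_def by (auto simp: inj_eq)

lemma Field_map_prod: "Field (map_prod \<rho> \<rho> ` E) = \<rho> ` Field E"
  unfolding Field_def by force

context kernel begin

lemma labeled_density_measurable: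
  assumes "F \<in> labeled_simple_graphs"
  shows "labeled_density M W F \<in> borel_measurable M"
proof -
  obtain V E l where F: "F = (V, E, l)" by (cases F) auto
  have s: "simple_graph (V, E)" "finite (V - {l})" using assms unfolding F labeled_simple_graphs_def simple_graph_def by auto
  have "(\<lambda>z. dens M W (V - {l}) (orientation E) (\<lambda>_. z)) \<in> borel_measurable M"
    using s(2) by (intro dens_measurable) auto
  then show ?thesis unfolding F by (subst measurable_cong[OF labeled_density_eq_dens[OF s(1)]])
qed

lemma labeled_density_bounds:
  assumes "F \<in> labeled_simple_graphs" "z \<in> space M"
  shows "0 \<le> labeled_density M W F z" "labeled_density M W F z \<le> 1"
proof -
  obtain V E l where F: "F = (V, E, l)" by (cases F) auto
  have s: "simple_graph (V, E)" using assms unfolding F labeled_simple_graphs_def by auto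
  show "0 \<le> labeled_density M W F z" "labeled_density M W F z \<le> 1"
    unfolding F labeled_density_eq_dens[OF s] using assms(2) by (auto intro!: dens_bounds)
qed

lemma labeled_density_integrable:
  assumes "F \<in> labeled_simple_graphs"
  shows "integrable M (labeled_density M W F)"
  using labeled_density_bounds[OF assms] labeled_density_measurable[OF assms]
  by (intro integrable_const_bound[where B=1] AE_I2) auto

lemma labeled_density_mult_integrable:
  assumes "F \<in> labeled_simple_graphs" "H \<in> labeled_simple_graphs"
  shows "integrable M (\<lambda>x. labeled_density M W F x * labeled_density M W H x)"
  using labeled_density_bounds[OF assms(1)] labeled_density_bounds[OF assms(2)]
     labeled_density_measurable[OF assms(1)] labeled_density_measurable[OF assms(2)]
  by (intro integrable_const_bound[where B=1] AE_I2) (auto simp: abs_mult mult_le_one)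

section \<open>Labeled densities under unlabeling and gluing\<close>

lemma hom_density_unlabel:
  assumes "F \<in> labeled_simple_graphs"
  shows "hom_density M W (unlabel F) = (\<integral>z. labeled_density M W F z \<partial>M)"
proof -
  obtain V E l where F: "F = (V, E, l)" by (cases F) auto
  have s: "simple_graph (V, E)" "l \<in> V" "finite V" using assms unfolding F labeled_simple_graphs_def simple_graph_def by auto
  obtain a where a: "a \<in> space M" using not_empty by auto
  have "hom_density M W (V, E) = dens M W (insert l (V - {l})) (orientation E) (\<lambda>_. a)"
    using s by (simp add: hom_density_eq_dens insert_absorb)
  also have "\<dots> = (\<integral>z. dens M W (V - {l}) (orientation E) ((\<lambda>_. a)(l := z)) \<partial>M)"
    using s a by (intro dens_insert) auto
  also have "\<dots> = (\<integral>z. dens M W (V - {l}) (orientation E) (\<lambda>_. z) \<partial>M)"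
    using oriented_orientation(2)[OF s(1)] by (intro Bochner_Integration.integral_cong refl dens_cong) auto
  finally show ?thesis unfolding F unlabel_def labeled_density_eq_dens[OF s(1)] by simp
qed

lemma labeled_density_glue:
  assumes "F \<in> labeled_simple_graphs" "H \<in> labeled_simple_graphs" "z \<in> space M"
  shows "labeled_density M W (glue F H) z = labeled_density M W F z * labeled_density M W H z"
proof -
  obtain V E l where F: "F = (V, E, l)" by (cases F) auto
  obtain V' E' l' where H: "H = (V', E', l')" by (cases H) auto
  have F': "simple_graph (V, E)" "l \<in> V" "finite V" using assms(1) unfolding F labeled_simple_graphs_def simple_graph_def by auto
  have H': "simple_graph (V', E')" "l' \<in> V'" "finite V'" using assms(2) unfolding H labeled_simple_graphs_def simple_graph_def by auto
  define U where "U = glue_left l ` V \<union> glue_right l' ` V'"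
  define D where "D = (`) (glue_left l) ` E \<union> (`) (glue_right l') ` E'"
  define V1 where "V1 = glue_left l ` (V - {l})"
  define V2 where "V2 = glue_right l' ` (V' - {l'})"
  define E1 where "E1 = map_prod (glue_left l) (glue_left l) ` orientation E"
  define E2 where "E2 = map_prod (glue_right l') (glue_right l') ` orientation E'"
  have G: "glue F H = (U, D, 0)" by (simp add: glue_def F H U_def D_def)
  then have UD: "simple_graph (U, D)"
    using glue_labeled_simple_graph[OF assms(1,2)] by (simp add: labeled_simple_graphs_def)
  have or: "oriented E1" "oriented E2"
    unfolding E1_def E2_def using oriented_orientation(1)[OF F'(1)] oriented_orientation(1)[OF H'(1)]
    by (auto intro!: oriented_map_prod inj_glue_left inj_glue_right)
  have fields: "Field E1 \<subseteq> glue_left l ` V" "Field E2 \<subseteq> glue_right l' ` V'"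
    unfolding E1_def E2_def Field_map_prod using oriented_orientation(2) F' H' by (metis image_mono)+
  have disj: "glue_left l ` V \<inter> V2 = {}" "glue_right l' ` V' \<inter> V1 = {}" "V1 \<inter> V2 = {}"
    unfolding V1_def V2_def by (auto simp: glue_left_eq_right dest: sym[THEN glue_left_eq_right[THEN iffD1]])
  have com: "x = 0" if "x \<in> Field E1" "x \<in> Field E2" for x
  proof -
    from that fields obtain v v' where "x = glue_left l v" "x = glue_right l' v'" by blast
    then have "v = l" by (metis glue_left_eq_right)
    with \<open>x = glue_left l v\<close> show ?thesis by (simp add: glue_left_def)
  qed
  \<comment> \<open>Both endpoints of a common edge would be the shared node \<open>0\<close>, and
    an oriented set contains no loop. With a single label, gluing thus never creates a multiple
    edge.\<close>
  have ee: "e \<notin> E2" if "e \<in> E1" for e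
  proof
    assume "e \<in> E2"
    with that com have "e = (0, 0)" by (metis FieldI1 FieldI2 surj_pair)
    with that or(1) show False by (auto simp: oriented_def)
  qed
  have E12: "E1 \<inter> E2 = {}" using ee by auto
  have or12: "oriented (E1 \<union> E2)"
  proof -
    \<comment> \<open>The same argument excludes an edge of one copy that reverses an edge of the
      other.\<close>
    have "e \<notin> E2" if "prod.swap e \<in> E1" for e
    proof
      assume "e \<in> E2"
      with that com have "e = (0, 0)" by (metis FieldI1 FieldI2 surj_pair swap_simp)
      with that or(1) show False by (auto simp: oriented_def)
    qed
    then show ?thesis using or by (fastforce simp: oriented_def)
  qed
  have sym: "orientation D \<union> (orientation D)\<inverse> = (E1 \<union> E2) \<union> (E1 \<union> E2)\<inverse>"
  proof -
    have "(E1 \<union> E2) \<union> (E1 \<union> E2)\<inverse> = (E1 \<union> E1\<inverse>) \<union> (E2 \<union> E2\<inverse>)" by auto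
    also have "\<dots> = {(i, j). {i, j} \<in> D}"
      unfolding E1_def E2_def map_prod_orientation_sym[OF F'(1) inj_glue_left]
        map_prod_orientation_sym[OF H'(1) inj_glue_right] D_def by auto
    finally show ?thesis unfolding orientation_sym[OF UD] ..
  qed
  have U0: "U - {0} = V1 \<union> V2"
    unfolding U_def V1_def V2_def using F' H'
    by (auto simp: glue_left_def glue_right_def split: if_splits)
  have "labeled_density M W (glue F H) z = dens M W (V1 \<union> V2) (E1 \<union> E2) (\<lambda>_. z)"
    unfolding G labeled_density_eq_dens[OF UD] U0 using assms(3)
    by (intro dens_orientation sym or12 oriented_orientation(1)[OF UD])
  also have "\<dots> = dens M W V1 E1 (\<lambda>_. z) * dens M W V2 E2 (\<lambda>_. z)"
    using F' H' or fields disj E12 assms(3) by (intro dens_mult) (auto simp: V1_def V2_def oriented_def)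
  also have "dens M W V1 E1 (\<lambda>_. z) = labeled_density M W F z"
    unfolding V1_def E1_def F labeled_density_eq_dens[OF F'(1)] using assms(3) F'
    by (subst dens_rename) (auto simp: inj_glue_left comp_def)
  also have "dens M W V2 E2 (\<lambda>_. z) = labeled_density M W H z"
    unfolding V2_def E2_def H labeled_density_eq_dens[OF H'(1)] using assms(3) H'
    by (subst dens_rename) (auto simp: inj_glue_right comp_def)
  finally show ?thesis .
qed

text \<open>The first connection matrix is the Gram matrix in L^2 of the functions t_x, which turns
  (iv) and (v) into statements about these functions.\<close>

lemma connection_matrix_eq_integral:
  assumes "F \<in> labeled_simple_graphs" "H \<in> labeled_simple_graphs"
  shows "connection_matrix M W F H = (\<integral>z. labeled_density M W F z * labeled_density M W H z \<partial>M)"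
  unfolding connection_matrix_def hom_density_unlabel[OF glue_labeled_simple_graph[OF assms]]
  by (intro Bochner_Integration.integral_cong refl labeled_density_glue assms)

text \<open>The unit for gluing: its density is constantly 1, so pairing with it yields plain
  integrals.\<close>

abbreviation "K1 \<equiv> ({0}, {}, 0) :: labeled_graph"

lemma K1: "K1 \<in> labeled_simple_graphs"
  by (simp add: labeled_simple_graphs_def simple_graph_def)

lemma labeled_density_K1: "labeled_density M W K1 z = 1"
proof -
  have "simple_graph ({0}, {})" by (simp add: simple_graph_def)
  then show ?thesis
    by (simp add: labeled_density_eq_dens dens_empty orientation_def edge_weight_def)
qed

lemma connection_matrix_K1:
  assumes "F \<in> labeled_simple_graphs"
  shows "connection_matrix M W F K1 = (\<integral>z. labeled_density M W F z \<partial>M)"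
    "connection_matrix M W K1 F = (\<integral>z. labeled_density M W F z \<partial>M)"
  using assms by (simp_all add: connection_matrix_eq_integral K1 labeled_density_K1)

text \<open>The two sides of the matrix identity differ by the variance of t_x(F, W), and zero
  variance means almost everywhere constant.\<close>

lemma AE_const_iff:
  assumes "F \<in> labeled_simple_graphs"
  shows "(\<exists>c. AE x in M. labeled_density M W F x = c) \<longleftrightarrow>
    connection_matrix M W F F = (connection_matrix M W F K1)\<^sup>2"
proof -
  let ?f = "labeled_density M W F"
  have int: "integrable M ?f" "integrable M (\<lambda>x. (?f x)\<^sup>2)"
    using labeled_density_integrable[OF assms] labeled_density_mult_integrable[OF assms assms]
    by (simp_all add: power2_eq_square)
  have var: "connection_matrix M W F F - (connection_matrix M W F K1)\<^sup>2 = variance ?f"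
    unfolding variance_eq[OF int] connection_matrix_K1[OF assms] connection_matrix_eq_integral[OF assms assms]
    by (simp add: power2_eq_square)
  show ?thesis
  proof
    assume "\<exists>c. AE x in M. ?f x = c"
    then obtain c where c: "AE x in M. ?f x = c" by blast
    have "expectation ?f = c"
      using integral_cong_AE[OF labeled_density_measurable[OF assms] _ c] by (simp add: prob_space)
    then have "variance ?f = 0"
      using c by (subst integral_eq_zero_AE) (auto elim: eventually_mono)
    then show "connection_matrix M W F F = (connection_matrix M W F K1)\<^sup>2" using var by simp
  next
    assume "connection_matrix M W F F = (connection_matrix M W F K1)\<^sup>2"
    then have "variance ?f = 0" using var by simp
    moreover have "integrable M (\<lambda>x. (?f x - expectation ?f)\<^sup>2)"
      using int by (simp add: power2_diff)
    ultimately have "AE x in M. (?f x - expectation ?f)\<^sup>2 = 0"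
      by (subst (asm) integral_nonneg_eq_0_iff_AE) auto
    then show "\<exists>c. AE x in M. ?f x = c" by (auto elim!: eventually_mono)
  qed
qed

lemma AE_const_connection_matrix:
  assumes "\<forall>F\<in>labeled_simple_graphs. \<exists>c. AE x in M. labeled_density M W F x = c"
    and "F \<in> labeled_simple_graphs" "H \<in> labeled_simple_graphs"
  shows "connection_matrix M W F H = connection_matrix M W F K1 * connection_matrix M W H K1"
proof -
  obtain c d where c: "AE x in M. labeled_density M W F x = c" and d: "AE x in M. labeled_density M W H x = d"
    using assms by blast
  note [measurable] = labeled_density_measurable[OF assms(2)] labeled_density_measurable[OF assms(3)]
  have "(\<integral>x. labeled_density M W F x \<partial>M) = (\<integral>x. c \<partial>M)"
    using c by (intro integral_cong_AE) auto
  moreover have "(\<integral>x. labeled_density M W H x \<partial>M) = (\<integral>x. d \<partial>M)"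
    using d by (intro integral_cong_AE) auto
  moreover have "(\<integral>x. labeled_density M W F x * labeled_density M W H x \<partial>M) = (\<integral>x. c * d \<partial>M)"
  proof (rule integral_cong_AE)
    show "AE x in M. labeled_density M W F x * labeled_density M W H x = c * d"
      using c d by eventually_elim simp
  qed measurable
  ultimately show ?thesis
    by (simp add: connection_matrix_K1 connection_matrix_eq_integral assms prob_space)
qed

section \<open>Dimension, rank and minors\<close>

lemma ess_constant_iff_Linf_dim:
  "(\<forall>F\<in>labeled_simple_graphs. \<exists>c. AE x in M. labeled_density M W F x = c) \<longleftrightarrow>
    has_Linf_dim M (algebra_A1 M W) 1"
proof
  assume const: "\<forall>F\<in>labeled_simple_graphs. \<exists>c. AE x in M. labeled_density M W F x = c"
  have "\<exists>c. AE x in M. f x = c" if "f \<in> algebra_A1 M W" for f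
    using that unfolding algebra_A1_def
  proof (induction rule: fun_space.span_induct_alt)
    case base
    show ?case by (auto simp: zero_fun_def)
  next
    case (step c g h)
    then obtain d e where "AE x in M. g x = d" "AE x in M. h x = e" using const by auto
    then have "AE x in M. (fun_scale c g + h) x = c * d + e"
      by eventually_elim (simp add: fun_scale_def)
    then show ?case ..
  qed
  moreover have "(\<lambda>_. 1) \<in> algebra_A1 M W"
  proof -
    have "labeled_density M W K1 \<in> algebra_A1 M W"
      unfolding algebra_A1_def by (intro fun_space.span_base imageI K1)
    moreover have "labeled_density M W K1 = (\<lambda>_. 1)" using labeled_density_K1 by blast
    ultimately show ?thesis by simp
  qed
  \<comment> \<open>The constant \<open>1\<close> is the basis: it is the density of
    \<open>K1\<close>, and it is nonzero in L^\<infinity> of a probability measure.\<close>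
  ultimately show "has_Linf_dim M (algebra_A1 M W) 1"
    unfolding has_Linf_dim_def by (intro exI[of _ "\<lambda>_ _. 1"]) (auto, metis)
next
  assume "has_Linf_dim M (algebra_A1 M W) 1"
  then obtain b where b: "\<And>f. f \<in> algebra_A1 M W \<Longrightarrow> \<exists>c. AE x in M. f x = c * b x"
    unfolding has_Linf_dim_def by simp metis
  have A: "labeled_density M W F \<in> algebra_A1 M W" if "F \<in> labeled_simple_graphs" for F
    unfolding algebra_A1_def using that by (intro fun_space.span_base imageI)
  \<comment> \<open>The density of \<open>K1\<close> forces the single basis function to be almost
    everywhere a nonzero constant.\<close>
  obtain c where c: "AE x in M. 1 = c * b x" using b[OF A[OF K1]] labeled_density_K1 by auto
  show "\<forall>F\<in>labeled_simple_graphs. \<exists>c. AE x in M. labeled_density M W F x = c"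
  proof
    fix F assume "F \<in> labeled_simple_graphs"
    then obtain d where d: "AE x in M. labeled_density M W F x = d * b x" using b[OF A] by blast
    have "AE x in M. labeled_density M W F x = d / c"
      using c d
    proof eventually_elim
      case (elim x)
      then have "c \<noteq> 0" "b x = 1 / c" by (auto simp: eq_divide_eq mult.commute)
      with elim show ?case by simp
    qed
    then show "\<exists>c. AE x in M. labeled_density M W F x = c" ..
  qed
qed

text \<open>The entry at (\<open>K1\<close>, \<open>K1\<close>) is 1, so the row of
  \<open>K1\<close> is nonzero and rank one means that it spans all rows. Symmetry of the entries
  with \<open>K1\<close> turns this proportionality into the variance identity.\<close>

lemma matrix_rank_iff_ess_constant:
  "matrix_rank labeled_simple_graphs (connection_matrix M W) = 1 \<longleftrightarrow>
   (\<forall>F\<in>labeled_simple_graphs. \<exists>c. AE x in M. labeled_density M W F x = c)"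
proof -
  let ?row = "\<lambda>F H. if H \<in> labeled_simple_graphs then connection_matrix M W F H else 0"
  have K11: "?row K1 K1 = 1" by (simp add: K1 connection_matrix_K1 labeled_density_K1 prob_space)
  then have nz: "?row K1 \<noteq> 0" by (auto dest!: fun_cong[where x=K1])
  show ?thesis
  proof
    assume "matrix_rank labeled_simple_graphs (connection_matrix M W) = 1"
    then have dim: "fun_space.dim (?row ` labeled_simple_graphs) = 1" by (simp add: matrix_rank_def)
    obtain B where B: "B \<subseteq> ?row ` labeled_simple_graphs" "\<not> fun_space.dependent B"
       "?row ` labeled_simple_graphs \<subseteq> fun_space.span B" "card B = 1"
      by (rule fun_space.basis_exists[of "?row ` labeled_simple_graphs"]) (auto simp: dim)
    then obtain b where b: "B = {b}" by (meson card_1_singletonE)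
    have row: "\<exists>k. ?row F = fun_scale k b" if "F \<in> labeled_simple_graphs" for F
      using B(3) that unfolding b fun_space.span_singleton by blast
    obtain k where k: "?row K1 = fun_scale k b" using row[OF K1] by blast
    have k1: "k * b K1 = 1" using K11 fun_cong[OF k, of K1] by (simp add: fun_scale_def)
    show "\<forall>F\<in>labeled_simple_graphs. \<exists>c. AE x in M. labeled_density M W F x = c"
    proof
      fix F assume F: "F \<in> labeled_simple_graphs"
      then obtain m where m: "?row F = fun_scale m b" using row by blast
      have *: "?row F H = m * b H" "?row K1 H = k * b H" for H
        using fun_cong[OF m, of H] fun_cong[OF k, of H] by (simp_all add: fun_scale_def)
      have FF: "connection_matrix M W F F = m * b F" and FK: "connection_matrix M W F K1 = m * b K1"
        and KF: "connection_matrix M W K1 F = k * b F"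
        using *[of F] *[of K1] F K1 by auto
      \<comment> \<open>Inserting the factor \<open>k * b K1 = 1\<close> writes the diagonal entry
        as the product of the entries at (\<open>F\<close>, \<open>K1\<close>) and
        (\<open>K1\<close>, \<open>F\<close>).\<close>
      have "connection_matrix M W F F = m * b K1 * (k * b F)"
        using k1 FF by algebra
      also have "\<dots> = (connection_matrix M W F K1)\<^sup>2"
        using FK KF connection_matrix_K1[OF F] by (simp add: power2_eq_square)
      finally show "\<exists>c. AE x in M. labeled_density M W F x = c"
        unfolding AE_const_iff[OF F] .
    qed
  next
    assume const: "\<forall>F\<in>labeled_simple_graphs. \<exists>c. AE x in M. labeled_density M W F x = c"
    have "?row F = fun_scale (connection_matrix M W F K1) (?row K1)" if "F \<in> labeled_simple_graphs" for F
    proof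
      fix H
      show "?row F H = fun_scale (connection_matrix M W F K1) (?row K1) H"
        using AE_const_connection_matrix[OF const that, of H] connection_matrix_K1[of H]
        by (auto simp: fun_scale_def)
    qed
    then have "?row ` labeled_simple_graphs \<subseteq> fun_space.span {?row K1}"
      unfolding fun_space.span_singleton by blast
    then have "fun_space.dim (?row ` labeled_simple_graphs) = card {?row K1}"
      using nz K1 by (intro fun_space.dim_unique) auto
    then show "matrix_rank labeled_simple_graphs (connection_matrix M W) = 1"
      by (simp add: matrix_rank_def)
  qed
qed

text \<open>For the converse, the minors with \<open>H = K1\<close> already are the variance
  identities.\<close>

lemma ess_constant_iff_determinants:
  "(\<forall>F\<in>labeled_simple_graphs. \<exists>c. AE x in M. labeled_density M W F x = c) \<longleftrightarrow>
   (\<forall>F\<in>labeled_simple_graphs. \<forall>H\<in>labeled_simple_graphs.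
      connection_matrix M W F F * connection_matrix M W H H = (connection_matrix M W F H)\<^sup>2)"
proof
  assume "\<forall>F\<in>labeled_simple_graphs. \<exists>c. AE x in M. labeled_density M W F x = c"
  then show "\<forall>F\<in>labeled_simple_graphs. \<forall>H\<in>labeled_simple_graphs.
      connection_matrix M W F F * connection_matrix M W H H = (connection_matrix M W F H)\<^sup>2"
    using AE_const_connection_matrix by (simp add: power2_eq_square)
next
  assume *: "\<forall>F\<in>labeled_simple_graphs. \<forall>H\<in>labeled_simple_graphs.
      connection_matrix M W F F * connection_matrix M W H H = (connection_matrix M W F H)\<^sup>2"
  have "connection_matrix M W K1 K1 = 1" by (simp add: K1 connection_matrix_K1 labeled_density_K1 prob_space)
  then have "connection_matrix M W F F = (connection_matrix M W F K1)\<^sup>2" if "F \<in> labeled_simple_graphs" for F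
    using *[rule_format, OF that K1] by simp
  then show "\<forall>F\<in>labeled_simple_graphs. \<exists>c. AE x in M. labeled_density M W F x = c"
    using AE_const_iff by simp
qed

end

subsection \<open>Invariance under measure preserving maps\<close>

text \<open>Independence of two coordinates. It carries an almost everywhere statement about pairs
  of nodes over to an edge inside a product over all nodes.\<close>

lemma (in prob_space) distr_PiM_pair:
  assumes "finite V" "i \<in> V" "j \<in> V" "i \<noteq> j"
  shows "distr (\<Pi>\<^sub>M k\<in>V. M) (M \<Otimes>\<^sub>M M) (\<lambda>x. (x i, x j)) = M \<Otimes>\<^sub>M M"
proof (rule pair_measure_eqI[symmetric])
  interpret P: product_prob_space "\<lambda>_. M" by standard
  show "sigma_finite_measure M" by standard
  show "sigma_finite_measure M" by standard
  show "sets (M \<Otimes>\<^sub>M M) = sets (distr (\<Pi>\<^sub>M k\<in>V. M) (M \<Otimes>\<^sub>M M) (\<lambda>x. (x i, x j)))" by simp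
  fix A B assume AB: "A \<in> sets M" "B \<in> sets M"
  \<comment> \<open>A rectangle pulls back to the box with full factors, each of measure 1, at all
    other coordinates.\<close>
  let ?S = "\<lambda>k. if k = i then A else if k = j then B else space M"
  have "(\<lambda>x. (x i, x j)) -` (A \<times> B) \<inter> space (\<Pi>\<^sub>M k\<in>V. M) = (\<Pi>\<^sub>E k\<in>V. ?S k)"
  proof (intro set_eqI iffI)
    fix x assume x: "x \<in> (\<Pi>\<^sub>E k\<in>V. ?S k)"
    from PiE_mem[OF this assms(2)] PiE_mem[OF this assms(3)] assms(4) have "x i \<in> A" "x j \<in> B" by auto
    moreover have "x \<in> (\<Pi>\<^sub>E k\<in>V. space M)"
      using AB[THEN sets.sets_into_space] by (intro subsetD[OF PiE_mono x]) auto
    ultimately show "x \<in> (\<lambda>x. (x i, x j)) -` (A \<times> B) \<inter> space (\<Pi>\<^sub>M k\<in>V. M)"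
      by (simp add: space_PiM)
  next
    fix x assume "x \<in> (\<lambda>x. (x i, x j)) -` (A \<times> B) \<inter> space (\<Pi>\<^sub>M k\<in>V. M)"
    then have x: "x \<in> (\<Pi>\<^sub>E k\<in>V. space M)" "x i \<in> A" "x j \<in> B" by (simp_all add: space_PiM)
    show "x \<in> (\<Pi>\<^sub>E k\<in>V. ?S k)"
    proof (rule PiE_I)
      show "x k \<in> ?S k" if "k \<in> V" for k using PiE_mem[OF x(1) that] x(2,3) by simp
      show "x k = undefined" if "k \<notin> V" for k using PiE_arb[OF x(1) that] .
    qed
  qed
  moreover have "(\<lambda>x. (x i, x j)) \<in> (\<Pi>\<^sub>M k\<in>V. M) \<rightarrow>\<^sub>M (M \<Otimes>\<^sub>M M)"
    using assms(2,3) by measurable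
  ultimately have "emeasure (distr (\<Pi>\<^sub>M k\<in>V. M) (M \<Otimes>\<^sub>M M) (\<lambda>x. (x i, x j))) (A \<times> B) = emeasure (\<Pi>\<^sub>M k\<in>V. M) (\<Pi>\<^sub>E k\<in>V. ?S k)"
    using AB by (simp only: emeasure_distr[OF _ pair_measureI])
  also have "\<dots> = (\<Prod>k\<in>V. emeasure M (?S k))"
    using assms(1) AB by (intro P.emeasure_PiM) auto
  also have "\<dots> = (\<Prod>k\<in>{i, j}. emeasure M (?S k))"
    using assms by (intro prod.mono_neutral_right) (auto simp: emeasure_space_1)
  also have "\<dots> = emeasure M A * emeasure M B"
    using assms(4) by simp
  finally show "emeasure M A * emeasure M B = emeasure (distr (\<Pi>\<^sub>M k\<in>V. M) (M \<Otimes>\<^sub>M M) (\<lambda>x. (x i, x j))) (A \<times> B)" ..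
qed

text \<open>An edge between two integrated nodes is covered by \<open>pairs\<close>, an edge at a
  label by the row condition \<open>lab\<close>. An edge between two labels would be evaluated at
  one point, about which almost everywhere statements say nothing.\<close>

lemma dens_transfer:
  assumes M: "kernel M W" and N: "kernel N U"
    and \<phi>: "\<phi> \<in> M \<rightarrow>\<^sub>M N" "distr M N \<phi> = N"
    and V: "finite V" and E: "oriented E"
    and a: "\<And>i. a i \<in> space M" and b: "\<And>i. b i \<in> space N"
    and labels: "\<And>i j. (i, j) \<in> E \<Longrightarrow> i \<in> V \<or> j \<in> V"
    and pairs: "AE p in M \<Otimes>\<^sub>M M. U (\<phi> (fst p)) (\<phi> (snd p)) = W (fst p) (snd p)"
    and lab: "\<And>l. l \<in> Field E \<Longrightarrow> l \<notin> V \<Longrightarrow> AE y in M. U (b l) (\<phi> y) = W (a l) y"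
  shows "dens N U V E b = dens M W V E a"
proof -
  interpret M: kernel M W by fact
  interpret N: kernel N U by fact
  note [measurable] = \<phi>(1)
  have D: "distr (\<Pi>\<^sub>M i\<in>V. M) (\<Pi>\<^sub>M i\<in>V. N) (compose V \<phi>) = (\<Pi>\<^sub>M i\<in>V. N)"
    using distr_PiM_finite_prob_space'[OF V, of "\<lambda>_. M" "\<lambda>_. N" \<phi>] M.prob_space_axioms N.prob_space_axioms \<phi> by simp
  have [measurable]: "compose V \<phi> \<in> (\<Pi>\<^sub>M i\<in>V. M) \<rightarrow>\<^sub>M (\<Pi>\<^sub>M i\<in>V. N)"
    unfolding compose_def by measurable
  let ?b = "\<lambda>x i. if i \<in> V then \<phi> (x i) else b i" and ?a = "\<lambda>x i. if i \<in> V then x i else a i"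
  have [measurable]: "(\<lambda>x. ?b x i) \<in> (\<Pi>\<^sub>M i\<in>V. M) \<rightarrow>\<^sub>M N" "(\<lambda>x. ?a x i) \<in> (\<Pi>\<^sub>M i\<in>V. M) \<rightarrow>\<^sub>M M" for i
    using a b by (cases "i \<in> V"; simp)+
  have swap: "U x y = W x' y' \<longleftrightarrow> U y x = W y' x'" if "x \<in> space N" "y \<in> space N" "x' \<in> space M" "y' \<in> space M" for x y x' y'
    using that M.W_sym N.W_sym by metis
  have "AE x in (\<Pi>\<^sub>M i\<in>V. M). \<forall>e\<in>E. U (?b x (fst e)) (?b x (snd e)) = W (?a x (fst e)) (?a x (snd e))"
  proof (rule AE_finite_allI)
    show "finite E" using E by (simp add: oriented_def)
    fix e assume e: "e \<in> E"
    obtain i j where ij: "e = (i, j)" by fastforce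
    have "i \<noteq> j" using E e ij by (auto simp: oriented_def)
    note F = FieldI1[OF e[unfolded ij]] FieldI2[OF e[unfolded ij]]
    consider "i \<in> V" "j \<in> V" | "i \<in> V" "j \<notin> V" | "i \<notin> V" "j \<in> V" using labels e ij by blast
    then show "AE x in (\<Pi>\<^sub>M i\<in>V. M). U (?b x (fst e)) (?b x (snd e)) = W (?a x (fst e)) (?a x (snd e))"
    proof cases
      case 1
      have m: "(\<lambda>x. (x i, x j)) \<in> (\<Pi>\<^sub>M k\<in>V. M) \<rightarrow>\<^sub>M (M \<Otimes>\<^sub>M M)" using 1 by measurable
      have "AE p in distr (\<Pi>\<^sub>M k\<in>V. M) (M \<Otimes>\<^sub>M M) (\<lambda>x. (x i, x j)). U (\<phi> (fst p)) (\<phi> (snd p)) = W (fst p) (snd p)"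
        unfolding M.distr_PiM_pair[OF V 1 \<open>i \<noteq> j\<close>] by (rule pairs)
      from AE_distrD[OF m this] have "AE x in (\<Pi>\<^sub>M k\<in>V. M). U (\<phi> (x i)) (\<phi> (x j)) = W (x i) (x j)" by simp
      then show ?thesis using 1 by (simp add: ij)
    next
      case 2
      have AE: "AE x in (\<Pi>\<^sub>M k\<in>V. M). U (b j) (\<phi> (x i)) = W (a j) (x i)"
        using AE_PiM_component[of V "\<lambda>_. M" i "\<lambda>y. U (b j) (\<phi> y) = W (a j) y"] M.prob_space_axioms 2 lab F by auto
      have iff: "U (b j) (\<phi> (x i)) = W (a j) (x i) \<longleftrightarrow> U (\<phi> (x i)) (b j) = W (x i) (a j)"
        if "x \<in> space (\<Pi>\<^sub>M k\<in>V. M)" for x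
        using that 2 a b measurable_space[OF \<phi>(1)] by (intro swap) (auto simp: space_PiM)
      have "AE x in (\<Pi>\<^sub>M k\<in>V. M). U (\<phi> (x i)) (b j) = W (x i) (a j)"
        using AE AE_space by eventually_elim (use iff in blast)
      then show ?thesis using 2 by (simp add: ij)
    next
      case 3
      have "AE x in (\<Pi>\<^sub>M k\<in>V. M). U (b i) (\<phi> (x j)) = W (a i) (x j)"
        using AE_PiM_component[of V "\<lambda>_. M" j "\<lambda>y. U (b i) (\<phi> y) = W (a i) y"] M.prob_space_axioms 3 lab F by auto
      then show ?thesis using 3 by (simp add: ij)
    qed
  qed
  then have AE: "AE x in (\<Pi>\<^sub>M i\<in>V. M). edge_weight U E (?b x) = edge_weight W E (?a x)"
    by eventually_elim (simp add: edge_weight_def case_prod_beta')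
  have "dens N U V E b = (\<integral>x. edge_weight U E (\<lambda>i. if i \<in> V then compose V \<phi> x i else b i) \<partial>(\<Pi>\<^sub>M i\<in>V. M))"
    unfolding dens_def
    by (subst D[symmetric], subst integral_distr)
       (auto intro!: N.edge_weight_measurable N.merged_measurable b)
  also have "\<dots> = (\<integral>x. edge_weight U E (?b x) \<partial>(\<Pi>\<^sub>M i\<in>V. M))"
    by (intro Bochner_Integration.integral_cong refl edge_weight_cong) (auto simp: compose_def)
  also have "\<dots> = dens M W V E a"
    unfolding dens_def by (rule integral_cong_AE[OF _ _ AE]) measurable
  finally show ?thesis .
qed

lemma hom_density_transfer:
  assumes M: "kernel M W" and N: "kernel N U"
    and \<phi>: "\<phi> \<in> M \<rightarrow>\<^sub>M N" "distr M N \<phi> = N"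
    and pairs: "AE p in M \<Otimes>\<^sub>M M. U (\<phi> (fst p)) (\<phi> (snd p)) = W (fst p) (snd p)"
  shows "weakly_isomorphic M W N U"
  unfolding weakly_isomorphic_def
proof (intro allI impI)
  fix F :: graph assume F: "simple_graph F"
  obtain V E where VE: "F = (V, E)" by fastforce
  interpret M: kernel M W by fact
  interpret N: kernel N U by fact
  obtain a b where "a \<in> space M" "b \<in> space N" using M.not_empty N.not_empty by auto
  note O = oriented_orientation[OF F[unfolded VE]]
  have "dens N U V (orientation E) (\<lambda>_. b) = dens M W V (orientation E) (\<lambda>_. a)"
    using F VE O(2) \<open>a \<in> space M\<close> \<open>b \<in> space N\<close> unfolding simple_graph_def
    by (intro dens_transfer[OF M N \<phi> _ O(1) _ _ _ pairs]) (auto dest: FieldI1 FieldI2)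
  then show "hom_density M W F = hom_density N U F"
    using F hom_density_eq_dens unfolding VE by metis
qed

text \<open>An automorphism preserves every row almost everywhere, in particular the row of the
  label; integrating over the rows gives almost all pairs.\<close>

lemma labeled_density_automorphism:
  assumes "kernel N U" "graphon_automorphism N U \<sigma>" "F \<in> labeled_simple_graphs" "z \<in> space N"
  shows "labeled_density N U F (\<sigma> z) = labeled_density N U F z"
proof -
  interpret N: kernel N U by fact
  obtain V E l where F: "F = (V, E, l)" by (cases F) auto
  have s: "simple_graph (V, E)" "finite V" using assms(3) unfolding F labeled_simple_graphs_def simple_graph_def by auto
  note O = oriented_orientation[OF s(1)]
  from assms(2) have \<sigma>: "\<sigma> \<in> N \<rightarrow>\<^sub>M N" "distr N N \<sigma> = N" "\<And>x. x \<in> space N \<Longrightarrow> AE y in N. U (\<sigma> x) (\<sigma> y) = U x y"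
    by (auto simp: graphon_automorphism_def)
  note [measurable] = \<sigma>(1)
  interpret NN: pair_sigma_finite N N by standard
  have pairs: "AE p in N \<Otimes>\<^sub>M N. U (\<sigma> (fst p)) (\<sigma> (snd p)) = U (fst p) (snd p)"
    by (rule NN.AE_pair_measure) (auto simp: \<sigma>(3))
  have labels: "i \<in> V - {l} \<or> j \<in> V - {l}" if "(i, j) \<in> orientation E" for i j
    using that O(2) FieldI1[OF that] FieldI2[OF that] by (auto simp: orientation_def)
  have "dens N U (V - {l}) (orientation E) (\<lambda>_. \<sigma> z) = dens N U (V - {l}) (orientation E) (\<lambda>_. z)"
    using s assms(4) measurable_space[OF \<sigma>(1)] \<sigma>(3) labels
    by (intro dens_transfer[OF assms(1,1) \<sigma>(1,2) _ O(1) _ _ _ pairs]) auto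
  then show ?thesis by (simp add: F labeled_density_eq_dens[OF s(1)])
qed

text \<open>By the variance identity, essential constancy is a condition on densities of unlabeled
  simple graphs, so it passes between a graphon and its representations.\<close>

lemma weakly_isomorphic_ess_constant:
  assumes "kernel M W" "kernel N U" "weakly_isomorphic M W N U"
  shows "(\<forall>F\<in>labeled_simple_graphs. \<exists>c. AE x in M. labeled_density M W F x = c) \<longleftrightarrow>
    (\<forall>F\<in>labeled_simple_graphs. \<exists>c. AE x in N. labeled_density N U F x = c)"
proof -
  interpret M: kernel M W by fact
  interpret N: kernel N U by fact
  have "connection_matrix M W F H = connection_matrix N U F H"
    if "F \<in> labeled_simple_graphs" "H \<in> labeled_simple_graphs" for F H
    using assms(3) glue_labeled_simple_graph[OF that]
    unfolding connection_matrix_def weakly_isomorphic_def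
    by (cases "glue F H") (auto simp: labeled_simple_graphs_def unlabel_def)
  then show ?thesis
    by (auto simp: M.AE_const_iff N.AE_const_iff M.K1)
qed

lemma node_transitive_imp_ess_constant:
  assumes "graphon M W" "node_transitive M W"
  shows "\<forall>F\<in>labeled_simple_graphs. \<exists>c. AE x in M. labeled_density M W F x = c"
proof -
  obtain N U where *: "pure_representation M W N U \<and>
     (\<forall>x\<in>space N. \<forall>y\<in>space N. \<exists>\<sigma>. graphon_automorphism N U \<sigma> \<and> \<sigma> x = y)"
    using assms(2) unfolding node_transitive_def by (elim exE)
  then have NU: "pure_graphon N U" "weakly_isomorphic M W N U"
    unfolding pure_representation_def by blast+
  note trans = conjunct2[OF *, rule_format]
  have N: "kernel N U" using NU(1) by (auto simp: pure_graphon_def graphon_kernel)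
  interpret N: kernel N U by fact
  obtain z where z: "z \<in> space N" using N.not_empty by auto
  have "\<exists>c. AE x in N. labeled_density N U F x = c" if F: "F \<in> labeled_simple_graphs" for F
  proof (intro exI AE_I2)
    fix x assume "x \<in> space N"
    with trans z obtain \<sigma> where "graphon_automorphism N U \<sigma>" "\<sigma> z = x" by blast
    then show "labeled_density N U F x = labeled_density N U F z"
      using labeled_density_automorphism[OF N _ F z] by metis
  qed
  then show ?thesis
    using weakly_isomorphic_ess_constant[OF graphon_kernel[OF assms(1)] N NU(2)] by blast
qed

subsection \<open>Measures determined by moments\<close>

lemma borel_measure_eqI_closed:
  fixes P Q :: "'b::topological_space measure"
  assumes "finite_measure P" "finite_measure Q" "sets P = sets borel" "sets Q = sets borel"
    and eq: "\<And>F. closed F \<Longrightarrow> measure P F = measure Q F"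
  shows "P = Q"
proof (rule measure_eqI_generator_eq[where E="Collect closed" and \<Omega>=UNIV and A="\<lambda>_. UNIV"])
  interpret P: finite_measure P by fact
  interpret Q: finite_measure Q by fact
  show "Int_stable (Collect closed :: 'b set set)" by (auto simp: Int_stable_def)
  show "emeasure P X = emeasure Q X" if "X \<in> Collect closed" for X
    using eq that by (simp add: P.emeasure_eq_measure Q.emeasure_eq_measure)
  show "sets P = sigma_sets UNIV (Collect closed)" "sets Q = sigma_sets UNIV (Collect closed)"
    using assms(3,4) by (simp_all add: borel_eq_closed)
qed (simp_all add: finite_measure.emeasure_finite[OF assms(1)])

text \<open>Closed sets determine the measure, and the indicator of a closed set is a bounded limit
  of continuous functions of the distance to it.\<close>

lemma borel_measure_eqI_continuous:
  fixes P Q :: "'b::metric_space measure"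
  assumes "finite_measure P" "finite_measure Q" "sets P = sets borel" "sets Q = sets borel"
    and eq: "\<And>h. continuous_on UNIV h \<Longrightarrow> (\<And>x. \<bar>h x\<bar> \<le> 1) \<Longrightarrow> (\<integral>x. h x \<partial>P) = (\<integral>x. (h x::real) \<partial>Q)"
  shows "P = Q"
proof (rule borel_measure_eqI_closed[OF assms(1-4)])
  fix F :: "'b set" assume F: "closed F"
  show "measure P F = measure Q F"
  proof (cases "F = {}")
    case False
    define h where "h n x = max 0 (1 - real n * infdist x F)" for n x
    have h: "continuous_on UNIV (h n)" "\<bar>h n x\<bar> \<le> 1" for n x
      unfolding h_def by (auto intro!: continuous_intros simp: infdist_nonneg)
    have lim: "(\<lambda>n. h n x) \<longlonglongrightarrow> indicator F x" for x
    proof (cases "x \<in> F")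
      case True
      then show ?thesis using F False by (simp add: h_def)
    next
      case n: False
      then have pos: "infdist x F > 0"
        using F False in_closed_iff_infdist_zero[of F x] infdist_nonneg[of x F] by auto
      obtain k where k: "1 < real k * infdist x F" using pos reals_Archimedean3 by blast
      have "h m x = 0" if "m \<ge> k" for m
      proof -
        have "real k * infdist x F \<le> real m * infdist x F" using that pos by (intro mult_right_mono) auto
        then show ?thesis using k by (simp add: h_def)
      qed
      then have "eventually (\<lambda>m. h m x = 0) sequentially" by (rule eventually_sequentiallyI)
      then show ?thesis using n by (simp add: tendsto_eventually)
    qed
    have L: "(\<lambda>n. \<integral>x. h n x \<partial>R) \<longlonglongrightarrow> measure R F" if "finite_measure R" "sets R = sets borel" for R :: "'b measure"
    proof -
      interpret R: finite_measure R by fact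
      have m[measurable]: "h n \<in> borel_measurable R" for n
        using h(1) that(2) by (metis borel_measurable_continuous_onI measurable_cong_sets)
      have FR[measurable]: "F \<in> sets R" using F that(2) by simp
      have "(\<lambda>n. \<integral>x. h n x \<partial>R) \<longlonglongrightarrow> (\<integral>x. indicator F x \<partial>R)"
        by (rule integral_dominated_convergence[where w="\<lambda>_. 1"]) (use h(2) lim in \<open>auto\<close>)
      also have "(\<integral>x. indicator F x \<partial>R) = measure R F" using sets.sets_into_space[OF FR] by (simp add: Int_absorb2)
      finally show ?thesis .
    qed
    have "(\<lambda>n. \<integral>x. h n x \<partial>P) = (\<lambda>n. \<integral>x. h n x \<partial>Q)" using eq h by metis
    with L[OF assms(1,3)] L[OF assms(2,4)] show ?thesis by (metis LIMSEQ_unique)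
  qed simp
qed

text \<open>A monomial is given by the list of its variables, repetitions counting as powers; its
  integral is a mixed moment.\<close>

inductive_set polys :: "((nat \<Rightarrow> real) \<Rightarrow> real) set" where
  mono: "(\<lambda>x. c * prod_list (map x ks)) \<in> polys"
| add: "f \<in> polys \<Longrightarrow> g \<in> polys \<Longrightarrow> (\<lambda>x. f x + g x) \<in> polys"

lemma prod_list_measurable: "(\<lambda>x :: nat \<Rightarrow> real. prod_list (map x ks)) \<in> borel_measurable borel"
proof (induction ks)
  case (Cons k ks)
  have [measurable]: "(\<lambda>x :: nat \<Rightarrow> real. x k) \<in> borel_measurable borel"
    by (intro borel_measurable_continuous_onI continuous_on_product_coordinates)
  show ?case using Cons by simp
qed simp

lemma polys_mult: "f \<in> polys \<Longrightarrow> g \<in> polys \<Longrightarrow> (\<lambda>x. f x * g x) \<in> polys"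
proof (induction arbitrary: g rule: polys.induct)
  case (mono c ks)
  then show ?case
  proof (induction rule: polys.induct)
    case (mono d ls)
    show ?case using polys.mono[of "c * d" "ks @ ls"] by (simp add: algebra_simps)
  next
    case (add f g)
    then show ?case using polys.add by (fastforce simp: distrib_left)
  qed
next
  case (add f g)
  then show ?case using polys.add by (fastforce simp: distrib_right)
qed

lemma polys_continuous: "f \<in> polys \<Longrightarrow> continuous_on UNIV f"
proof (induction rule: polys.induct)
  case (mono c ks)
  have "continuous_on UNIV (\<lambda>x :: nat \<Rightarrow> real. prod_list (map x ks))"
    by (induction ks) (auto intro!: continuous_intros continuous_on_product_coordinates)
  then show ?case by (intro continuous_intros)
qed (intro continuous_intros)

lemma compact_unit_cube: "compact {x :: nat \<Rightarrow> real. \<forall>i. 0 \<le> x i \<and> x i \<le> 1}"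
proof -
  have "compactin (product_topology (\<lambda>_::nat. euclidean) UNIV) (PiE UNIV (\<lambda>_. {0..1::real}))"
    unfolding compactin_PiE by simp
  then show ?thesis
    unfolding euclidean_product_topology compactin_euclidean_iff by (simp add: PiE_def Pi_def)
qed

text \<open>The cube is compact by Tychonoff and the coordinates separate its points, so by
  Stone-Weierstrass polynomials approximate every continuous function uniformly.\<close>

lemma moments_determine_measure:
  fixes P Q :: "(nat \<Rightarrow> real) measure"
  assumes "finite_measure P" "finite_measure Q" "sets P = sets borel" "sets Q = sets borel"
    and cube: "AE x in P. \<forall>i. 0 \<le> x i \<and> x i \<le> 1" "AE x in Q. \<forall>i. 0 \<le> x i \<and> x i \<le> 1"
    and mom: "\<And>ks. (\<integral>x. prod_list (map x ks) \<partial>P) = (\<integral>x. prod_list (map x ks) \<partial>Q)"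
  shows "P = Q"
proof (rule borel_measure_eqI_continuous[OF assms(1-4)])
  interpret P: finite_measure P by fact
  interpret Q: finite_measure Q by fact
  let ?K = "{x :: nat \<Rightarrow> real. \<forall>i. 0 \<le> x i \<and> x i \<le> 1}"
  interpret sw: function_ring_on polys ?K
  proof
    show "continuous_on ?K f" if "f \<in> polys" for f using polys_continuous[OF that] continuous_on_subset by blast
    show "(\<lambda>_. c) \<in> polys" for c using polys.mono[of c "[]"] by simp
    fix x y :: "nat \<Rightarrow> real" assume "x \<noteq> y"
    then obtain i where "x i \<noteq> y i" by auto
    then show "\<exists>f\<in>polys. f x \<noteq> f y" using polys.mono[of 1 "[i]"] by (intro bexI[of _ "\<lambda>x. 1 * prod_list (map x [i])"]) auto
  qed (auto intro: compact_unit_cube polys.add polys_mult)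
  have int: "integrable R f" if "finite_measure R" "sets R = sets borel" "AE x in R. x \<in> ?K" "continuous_on UNIV f"
    for f :: "(nat \<Rightarrow> real) \<Rightarrow> real" and R
  proof -
    interpret R: finite_measure R by fact
    have "compact (f ` ?K)" using that(4) compact_unit_cube by (intro compact_continuous_image) (auto intro: continuous_on_subset)
    from compact_imp_bounded[OF this, unfolded bounded_iff] obtain B where "\<forall>y\<in>f ` ?K. norm y \<le> B" ..
    then have B: "\<bar>f x\<bar> \<le> B" if "x \<in> ?K" for x using that by auto
    have [measurable]: "f \<in> borel_measurable R"
      using that(2,4) by (metis borel_measurable_continuous_onI measurable_cong_sets)
    show ?thesis by (rule R.integrable_const_bound[where B=B]) (use that(3) B in \<open>auto elim!: eventually_mono\<close>)
  qed
  note intP = int[OF assms(1,3)] and intQ = int[OF assms(2,4)]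
  have cube': "AE x in P. x \<in> ?K" "AE x in Q. x \<in> ?K" using cube by auto
  have poly: "(\<integral>x. f x \<partial>P) = (\<integral>x. f x \<partial>Q)" if "f \<in> polys" for f
    using that
  proof (induction rule: polys.induct)
    case (add f g)
    then show ?case
      using intP[OF cube'(1) polys_continuous] intQ[OF cube'(2) polys_continuous] by simp
  qed (simp add: mom)
  fix h :: "(nat \<Rightarrow> real) \<Rightarrow> real" assume h: "continuous_on UNIV h"
  define m where "m = measure P (space P) + measure Q (space Q)"
  have m0: "m \<ge> 0" by (simp add: m_def)
  have "\<bar>(\<integral>x. h x \<partial>P) - (\<integral>x. h x \<partial>Q)\<bar> \<le> e" if "e > 0" for e
  proof -
    \<comment> \<open>Both measures together have mass \<open>m\<close>, so this tolerance gives a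
      total error of at most \<open>e * m / (m + 1)\<close>; the \<open>+ 1\<close> guards against
      \<open>m = 0\<close>.\<close>
    have "e / (m + 1) > 0" using that m0 by simp
    then obtain g where g: "g \<in> polys" "\<And>x. x \<in> ?K \<Longrightarrow> \<bar>h x - g x\<bar> < e / (m + 1)"
      using sw.Stone_Weierstrass_basic[of h "e / (m + 1)"] h continuous_on_subset by blast
    have b: "\<bar>(\<integral>x. h x \<partial>R) - (\<integral>x. g x \<partial>R)\<bar> \<le> e / (m + 1) * measure R (space R)"
      if R: "finite_measure R" "sets R = sets borel" "AE x in R. x \<in> ?K" for R
    proof -
      interpret R: finite_measure R by fact
      have i: "integrable R h" "integrable R g" using int[OF R] h polys_continuous[OF g(1)] by auto
      have "\<bar>(\<integral>x. h x \<partial>R) - (\<integral>x. g x \<partial>R)\<bar> = \<bar>\<integral>x. h x - g x \<partial>R\<bar>" using i by simp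
      also have "\<dots> \<le> (\<integral>x. \<bar>h x - g x\<bar> \<partial>R)" by (rule integral_abs_bound)
      also have "\<dots> \<le> (\<integral>x. e / (m + 1) \<partial>R)"
        using i R(3) g(2) by (intro integral_mono_AE) (auto elim!: eventually_mono intro: less_imp_le)
      finally show ?thesis by (simp add: mult.commute)
    qed
    have "\<bar>(\<integral>x. h x \<partial>P) - (\<integral>x. h x \<partial>Q)\<bar> \<le> e / (m + 1) * measure P (space P) + e / (m + 1) * measure Q (space Q)"
      using b[OF assms(1,3) cube'(1)] b[OF assms(2,4) cube'(2)] poly[OF g(1)] by linarith
    also have "\<dots> = e * (m / (m + 1))" by (simp add: m_def distrib_left add_divide_distrib)
    also have "\<dots> \<le> e" using that m0 by (intro mult_left_le) (auto simp: divide_simps)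
    finally show ?thesis .
  qed
  then show "(\<integral>x. h x \<partial>P) = (\<integral>x. h x \<partial>Q)" by (metis abs_le_zero_iff eq_iff_diff_eq_0 field_le_epsilon add_0)
qed

text \<open>Ulam's argument: at each scale finitely many balls around the dense points carry almost
  all mass. The intersection over all scales is closed and totally bounded, hence compact in a
  complete space.\<close>

lemma tight_on_separable:
  fixes P :: "'b::complete_space measure"
  assumes P: "finite_measure P" "sets P = sets borel" and S: "closed S" "AE x in P. x \<in> S"
    and d: "S \<subseteq> closure (range (d :: nat \<Rightarrow> 'b))" and e: "e > 0"
  obtains K where "compact K" "K \<subseteq> S" "measure P (- K) < e"
proof -
  interpret P: finite_measure P by fact
  have sp: "space P = UNIV" using sets_eq_imp_space_eq[OF P(2)] by simp
  define A where "A n k = (\<Union>i\<le>k. cball (d i) (1 / Suc n))" for n k :: nat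
  have cA: "closed (A n k)" for n k unfolding A_def by auto
  then have [measurable]: "A n k \<in> sets P" for n k using P(2) by simp
  have [measurable]: "S \<in> sets P" using P(2) S(1) by simp
  \<comment> \<open>The allowances for all scales sum to \<open>e / 2\<close>, which leaves room for
    the strict inequality at the end.\<close>
  have "\<exists>k. measure P (- A n k) < e / 2 * (1/2) ^ Suc n" for n
  proof -
    have "(\<lambda>k. measure P (- A n k)) \<longlonglongrightarrow> measure P (\<Inter>k. - A n k)"
      using cA P(2) by (intro P.finite_Lim_measure_decseq) (auto simp: decseq_def A_def intro!: borel_open)
    moreover have "measure P (\<Inter>k. - A n k) = 0"
    proof -
      have "S \<subseteq> (\<Union>k. A n k)"
      proof
        fix x assume "x \<in> S"
        with d obtain y where "y \<in> range d" "dist y x < 1 / Suc n"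
          unfolding closure_approachable by (metis closure_approachable d subsetD zero_less_divide_1_iff of_nat_0_less_iff zero_less_Suc)
        then show "x \<in> (\<Union>k. A n k)" unfolding A_def by (auto intro: less_imp_le)
      qed
      then have "AE x in P. x \<notin> (\<Inter>k. - A n k)" using S(2) by (auto elim!: eventually_mono)
      moreover have "(\<Inter>k. - A n k) \<in> sets P" using cA P(2) by auto
      ultimately show ?thesis by (simp only: AE_iff_null_sets[symmetric] measure_def null_setsD1 enn2real_0)
    qed
    ultimately have "(\<lambda>k. measure P (- A n k)) \<longlonglongrightarrow> 0" by simp
    from order_tendstoD(2)[OF this, of "e / 2 * (1/2) ^ Suc n"] e
    show ?thesis by (auto simp: eventually_sequentially)
  qed
  then obtain k where k: "\<And>n. measure P (- A n (k n)) < e / 2 * (1/2) ^ Suc n" by metis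
  define K where "K = S \<inter> (\<Inter>n. A n (k n))"
  have "closed K" unfolding K_def using S(1) cA by auto
  have "compact K"
    unfolding compact_eq_totally_bounded
  proof (intro conjI allI impI, goal_cases)
    case 1
    show ?case using \<open>closed K\<close> by (simp add: complete_eq_closed)
  next
    case (2 r)
    then obtain n where n: "1 / Suc n < r" using nat_approx_posE by blast
    have "K \<subseteq> A n (k n)" by (auto simp: K_def)
    also have "\<dots> \<subseteq> (\<Union>x\<in>d ` {..k n}. ball x r)" unfolding A_def using n by auto
    finally show ?case by blast
  qed
  moreover have "measure P (- K) < e"
  proof -
    have sum: "summable (\<lambda>n. e / 2 * (1/2) ^ Suc n)" "(\<Sum>n. e / 2 * (1/2) ^ Suc n) = e / 2"
    proof -
      have "(\<lambda>n. e / 2 * (1/2) ^ Suc n) sums (e / 2 * 1)" by (intro sums_mult power_half_series)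
      then show "summable (\<lambda>n. e / 2 * (1/2) ^ Suc n)" "(\<Sum>n. e / 2 * (1/2) ^ Suc n) = e / 2"
        by (auto simp: sums_iff)
    qed
    have s: "summable (\<lambda>n. measure P (- A n (k n)))"
      using sum(1) by (rule summable_comparison_test'[where N=0]) (use k in \<open>auto intro: less_imp_le\<close>)
    have m: "- A n (k n) \<in> sets P" for n using cA P(2) by auto
    have "measure P (- K) = measure P (\<Union>n. - A n (k n))"
    proof (rule P.finite_measure_eq_AE)
      show "AE x in P. (x \<in> - K) = (x \<in> (\<Union>n. - A n (k n)))"
        using S(2) by (auto simp: K_def elim!: eventually_mono)
      show "- K \<in> sets P" using \<open>closed K\<close> P(2) by auto
      show "(\<Union>n. - A n (k n)) \<in> sets P" using m by auto
    qed
    also have "\<dots> \<le> (\<Sum>n. measure P (- A n (k n)))"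
      using m s by (intro P.finite_measure_subadditive_countably) auto
    also have "\<dots> \<le> e / 2"
      using suminf_le[OF less_imp_le[OF k] s sum(1)] unfolding sum(2) .
    also have "\<dots> < e" using e by simp
    finally show ?thesis .
  qed
  ultimately show ?thesis using that by (auto simp: K_def)
qed

text \<open>Only compact sets are mapped, because their continuous images are compact and hence
  Borel. Tightness makes the loss small, and the resulting inequality on closed sets is symmetric in
  the two measures.\<close>

lemma inj_law_determines_measure:
  fixes P Q :: "'b::complete_space measure" and \<Psi> :: "'b \<Rightarrow> nat \<Rightarrow> real"
  assumes P: "finite_measure P" "sets P = sets borel" "AE x in P. x \<in> S"
    and Q: "finite_measure Q" "sets Q = sets borel" "AE x in Q. x \<in> S"
    and S: "closed S" "S \<subseteq> closure (range (d :: nat \<Rightarrow> 'b))"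
    and \<Psi>: "\<Psi> \<in> borel_measurable borel" "continuous_on S \<Psi>" "inj_on \<Psi> S"
    and eq: "distr P borel \<Psi> = distr Q borel \<Psi>"
  shows "P = Q"
proof (rule borel_measure_eqI_closed[OF P(1) Q(1) P(2) Q(2)])
  have le: "measure P F \<le> measure Q F" if F: "closed F"
    and P: "finite_measure P" "sets P = sets borel" "AE x in P. x \<in> S"
    and Q: "finite_measure Q" "sets Q = sets borel" "AE x in Q. x \<in> S"
    and eq: "distr P borel \<Psi> = distr Q borel \<Psi>" for F and P Q :: "'b measure"
  proof (rule field_le_epsilon)
    fix e :: real assume "e > 0"
    interpret P: finite_measure P by fact
    interpret Q: finite_measure Q by fact
    have sp: "space P = UNIV" "space Q = UNIV" using sets_eq_imp_space_eq[OF P(2)] sets_eq_imp_space_eq[OF Q(2)] by simp_all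
    have \<Psi>m: "\<Psi> \<in> borel_measurable P" "\<Psi> \<in> borel_measurable Q"
      using \<Psi>(1) measurable_cong_sets P(2) Q(2) by blast+
    obtain K1 where K1: "compact K1" "K1 \<subseteq> S" "measure P (- K1) < e / 2"
      by (rule tight_on_separable[OF P(1,2) S(1) P(3) S(2), of "e / 2"]) (use \<open>e > 0\<close> in auto)
    obtain K2 where K2: "compact K2" "K2 \<subseteq> S" "measure Q (- K2) < e / 2"
      by (rule tight_on_separable[OF Q(1,2) S(1) Q(3) S(2), of "e / 2"]) (use \<open>e > 0\<close> in auto)
    have cl: "closed K1" "closed K2" using K1 K2 compact_imp_closed by auto
    define L where "L = F \<inter> K1"
    have L: "compact L" "L \<subseteq> S" unfolding L_def using F K1 by (auto intro: closed_Int_compact)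
    have "compact (\<Psi> ` L)" using L \<Psi>(2) by (intro compact_continuous_image) (auto intro: continuous_on_subset)
    then have C: "\<Psi> ` L \<in> sets borel" by (intro borel_closed compact_imp_closed)
    have V: "\<Psi> -` (\<Psi> ` L) \<in> sets borel" using measurable_sets[OF \<Psi>(1) C] by simp
    have setsm: "X \<in> sets P \<longleftrightarrow> X \<in> sets borel" "X \<in> sets Q \<longleftrightarrow> X \<in> sets borel" for X using P Q by auto
    have "measure P F \<le> measure P (L \<union> - K1)"
      using F cl L(1) by (intro P.finite_measure_mono) (auto simp: L_def setsm)
    also have "\<dots> \<le> measure P L + measure P (- K1)"
      using cl F by (intro measure_Un_le) (auto simp: L_def setsm)
    also have "measure P L \<le> measure P (\<Psi> -` (\<Psi> ` L))"
      using V by (intro P.finite_measure_mono) (auto simp: setsm)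
    also have "measure P (\<Psi> -` (\<Psi> ` L)) = measure (distr P borel \<Psi>) (\<Psi> ` L)"
      using C \<Psi>m by (simp add: measure_distr sp)
    also have "\<dots> = measure Q (\<Psi> -` (\<Psi> ` L))"
      unfolding eq using C \<Psi>m by (simp add: measure_distr sp)
    \<comment> \<open>By injectivity on \<open>S\<close>, a point of \<open>K2\<close> with the same
      image as a point of \<open>L\<close> is that point; so the preimage exceeds \<open>F\<close>
      only outside \<open>K2\<close>.\<close>
    also have "\<dots> \<le> measure Q (F \<union> - K2)"
      using F cl V \<Psi>(3) L(2) K2(2) by (intro Q.finite_measure_mono) (auto simp: setsm L_def inj_on_def)
    also have "\<dots> \<le> measure Q F + measure Q (- K2)"
      using cl F by (intro measure_Un_le) (auto simp: L_def setsm)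
    finally show "measure P F \<le> measure Q F + e" using K1(3) K2(3) by simp
  qed
  fix F :: "'b set" assume "closed F"
  then show "measure P F = measure Q F"
    using le[OF _ P Q eq] le[OF _ Q P eq[symmetric]] by (intro antisym) auto
qed

text \<open>If the two compact images were disjoint, the first law would give the image of
  \<open>B \<inter> K\<close> more than half the mass of \<open>B\<close>, but the second only mass
  from outside \<open>K\<close>, which is less than half.\<close>

lemma equal_laws_meet:
  fixes N :: "'b::complete_space measure" and \<Phi> \<Phi>' :: "'b \<Rightarrow> nat \<Rightarrow> real"
  assumes N: "finite_measure N" "sets N = sets borel" "AE x in N. x \<in> S"
    and S: "closed S" "S \<subseteq> closure (range (d :: nat \<Rightarrow> 'b))"
    and \<Phi>: "\<Phi> \<in> borel_measurable borel" "continuous_on S \<Phi>"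
    and \<Phi>': "\<Phi>' \<in> borel_measurable borel" "continuous_on S \<Phi>'"
    and eq: "distr N borel \<Phi> = distr N borel \<Phi>'"
    and B: "closed B" "measure N B > 0"
  obtains z z' where "z \<in> B" "z \<in> S" "z' \<in> S" "\<Phi> z = \<Phi>' z'"
proof -
  interpret N: finite_measure N by fact
  have sp: "space N = UNIV" using sets_eq_imp_space_eq[OF N(2)] by simp
  have setsm: "X \<in> sets N \<longleftrightarrow> X \<in> sets borel" for X using N by auto
  have \<Phi>m: "\<Phi> \<in> borel_measurable N" "\<Phi>' \<in> borel_measurable N"
    using \<Phi>(1) \<Phi>'(1) measurable_cong_sets N(2) by blast+
  obtain K where K: "compact K" "K \<subseteq> S" "measure N (- K) < measure N B / 2"
    by (rule tight_on_separable[OF N(1,2) S(1) N(3) S(2), of "measure N B / 2"]) (use B in auto)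
  define L where "L = B \<inter> K"
  have L: "compact L" "L \<subseteq> S" unfolding L_def using B K by (auto intro: closed_Int_compact)
  have "compact (\<Phi> ` L)" using L \<Phi>(2) by (intro compact_continuous_image) (auto intro: continuous_on_subset)
  then have C: "\<Phi> ` L \<in> sets borel" by (intro borel_closed compact_imp_closed)
  have cl: "closed K" using K compact_imp_closed by auto
  have "\<exists>z'\<in>K. \<Phi>' z' \<in> \<Phi> ` L"
  proof (rule ccontr)
    assume *: "\<not> (\<exists>z'\<in>K. \<Phi>' z' \<in> \<Phi> ` L)"
    have "measure N B \<le> measure N (L \<union> - K)"
      using B cl by (intro N.finite_measure_mono) (auto simp: L_def setsm)
    also have "\<dots> \<le> measure N L + measure N (- K)"
      using cl B by (intro measure_Un_le) (auto simp: L_def setsm)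
    also have "measure N L \<le> measure N (\<Phi> -` (\<Phi> ` L))"
      using measurable_sets[OF \<Phi>(1) C] by (intro N.finite_measure_mono) (auto simp: setsm)
    also have "\<dots> = measure (distr N borel \<Phi>) (\<Phi> ` L)"
      using C \<Phi>m by (simp add: measure_distr sp)
    also have "\<dots> = measure N (\<Phi>' -` (\<Phi> ` L))"
      unfolding eq using C \<Phi>m by (simp add: measure_distr sp)
    also have "\<dots> \<le> measure N (- K)"
      using * cl by (intro N.finite_measure_mono) (auto simp: setsm)
    finally show False using K(3) by simp
  qed
  then obtain z z' where "z' \<in> K" "z \<in> L" "\<Phi> z = \<Phi>' z'" by auto
  then show ?thesis using that[of z z'] K L by (auto simp: L_def)
qed

subsection \<open>Graphs without edges between labeled nodes\<close>

text \<open>No edge joins two labeled nodes. Hence gluing such graphs along all labels creates no multiple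
  edges, and their densities depend continuously on each label.\<close>

definition pgraph :: "nat set \<Rightarrow> nat set \<Rightarrow> (nat \<times> nat) set \<Rightarrow> bool" where
  "pgraph L V E \<longleftrightarrow> finite V \<and> oriented E \<and> V \<inter> L = {} \<and> Field E \<subseteq> V \<union> L \<and>
     (\<forall>(i, j)\<in>E. i \<in> V \<or> j \<in> V)"

lemma pgraph_insert: "v \<notin> L \<Longrightarrow> pgraph (insert v L) V E \<Longrightarrow> pgraph L (insert v V) E"
  unfolding pgraph_def by auto

text \<open>Every edge has an unlabeled endpoint, and the unlabeled nodes of the two graphs are
  disjoint; so no edge is shared, in either direction.\<close>

lemma pgraph_Un:
  assumes "pgraph L V E" "pgraph L V' E'" "V \<inter> V' = {}"
  shows "pgraph L (V \<union> V') (E \<union> E')" "E \<inter> E' = {}" "Field E \<inter> V' = {}" "Field E' \<inter> V = {}"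
proof -
  have F: "Field E \<subseteq> V \<union> L" "Field E' \<subseteq> V' \<union> L" and dis: "V \<inter> L = {}" "V' \<inter> L = {}"
    using assms by (auto simp: pgraph_def)
  then show "Field E \<inter> V' = {}" "Field E' \<inter> V = {}" using assms(3) by blast+
  have no: "i \<in> V \<or> j \<in> V" "i \<in> V \<union> L" "j \<in> V \<union> L" if "(i, j) \<in> E" for i j
    using assms(1) that FieldI1[OF that] FieldI2[OF that] by (auto simp: pgraph_def)
  have no': "i \<in> V' \<or> j \<in> V'" "i \<in> V' \<union> L" "j \<in> V' \<union> L" if "(i, j) \<in> E'" for i j
    using assms(2) that FieldI1[OF that] FieldI2[OF that] by (auto simp: pgraph_def)
  have 1: "(i, j) \<notin> E'" "(j, i) \<notin> E'" if "(i, j) \<in> E" for i j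
    using no[OF that] no'[of i j] no'[of j i] dis assms(3) by blast+
  then show "E \<inter> E' = {}" by auto
  have "oriented (E \<union> E')" using assms 1 by (auto simp: pgraph_def oriented_def)
  moreover have "(E \<union> E') \<noteq> {} \<longrightarrow> Field (E \<union> E') \<subseteq> V \<union> V' \<union> L" using F by (auto simp: Field_Un)
  ultimately show "pgraph L (V \<union> V') (E \<union> E')"
    using assms(1,2) by (auto simp: pgraph_def Field_Un)
qed

lemma pgraph_rename:
  assumes "pgraph L V E" "inj \<rho>" "\<And>i. i \<in> L \<Longrightarrow> \<rho> i = i" 
  shows "pgraph L (\<rho> ` V) (map_prod \<rho> \<rho> ` E)"
proof -
  have "\<rho> ` V \<inter> L = {}"
    using assms unfolding pgraph_def by (auto) (metis disjoint_iff injD)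
  moreover have "Field (map_prod \<rho> \<rho> ` E) \<subseteq> \<rho> ` V \<union> L"
    unfolding Field_map_prod using assms by (force simp: pgraph_def)
  ultimately show ?thesis
    using assms(1) oriented_map_prod[OF _ assms(2)] by (fastforce simp: pgraph_def)
qed

text \<open>Countability lets all densities of a tuple be collected in one point of a countable
  power of the unit interval.\<close>

lemma countable_pgraph: "countable {(V, E). pgraph L V E}"
proof -
  have "{(V, E). pgraph L V E} \<subseteq> {V. finite V \<and> V \<subseteq> UNIV} \<times> {E. finite E \<and> E \<subseteq> UNIV}"
    by (auto simp: pgraph_def oriented_def)
  then show ?thesis
    by (rule countable_subset) (intro countable_SIGMA countable_Collect_finite_subset; simp)
qed

section \<open>Products of densities and equivalent tuples\<close>

context kernel begin

lemma dens_no_edges: "dens M W {} {} a = 1"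
  by (simp add: dens_empty edge_weight_def)

text \<open>Gluing along all labels, after moving the unlabeled nodes of the second graph out of the
  way. Mixed moments of densities thereby become densities once a label is integrated.\<close>

lemma pgraph_mult:
  assumes L: "finite L" and V: "pgraph L V E" and V': "pgraph L V' E'"
  obtains V'' E'' where "pgraph L V'' E''"
    "\<And>c. (\<And>i. c i \<in> space M) \<Longrightarrow> dens M W V'' E'' c = dens M W V E c * dens M W V' E' c"
proof -
  have fin: "finite V" "finite V'" using V V' by (auto simp: pgraph_def)
  \<comment> \<open>All nodes of \<open>L\<close> and \<open>V\<close> lie below \<open>m\<close>,
    so a shift by \<open>m\<close> avoids both, and it cannot collide with the fixed labels.\<close>
  define m where "m = Suc (Max (insert 0 (L \<union> V)))"
  have m: "i < m" if "i \<in> L \<union> V" for i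
    unfolding m_def using L fin that by (intro le_imp_less_Suc Max_ge) auto
  define \<rho> where "\<rho> i = (if i \<in> L then i else i + m)" for i
  have \<rho>: "inj \<rho>" "\<And>i. i \<in> L \<Longrightarrow> \<rho> i = i"
    unfolding \<rho>_def inj_def using m by auto
  have disj: "V \<inter> \<rho> ` V' = {}"
    using V' m by (auto simp: \<rho>_def pgraph_def)
  note R = pgraph_rename[OF V' \<rho>]
  note U = pgraph_Un[OF V R disj]
  show ?thesis
  proof (rule that[OF U(1)])
    fix c :: "nat \<Rightarrow> 'a" assume c: "\<And>i. c i \<in> space M"
    have "dens M W (V \<union> \<rho> ` V') (E \<union> map_prod \<rho> \<rho> ` E') c
        = dens M W V E c * dens M W (\<rho> ` V') (map_prod \<rho> \<rho> ` E') c"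
      using V R U disj fin c by (intro dens_mult) (auto simp: pgraph_def oriented_def)
    also have "dens M W (\<rho> ` V') (map_prod \<rho> \<rho> ` E') c = dens M W V' E' (c \<circ> \<rho>)"
      using fin \<rho> c by (intro dens_rename)
    also have "\<dots> = dens M W V' E' c"
      using V' \<rho>(2) by (intro dens_cong) (auto simp: pgraph_def)
    finally show "dens M W (V \<union> \<rho> ` V') (E \<union> map_prod \<rho> \<rho> ` E') c = dens M W V E c * dens M W V' E' c" .
  qed
qed

lemma pgraph_prod_list:
  assumes "finite L" "\<And>G. G \<in> set Gs \<Longrightarrow> pgraph L (fst G) (snd G)"
  shows "\<exists>V E. pgraph L V E \<and> (\<forall>c. (\<forall>i. c i \<in> space M) \<longrightarrow>
    dens M W V E c = prod_list (map (\<lambda>G. dens M W (fst G) (snd G) c) Gs))"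
  using assms(2)
proof (induction Gs)
  case Nil
  have "pgraph L {} {}" by (simp add: pgraph_def oriented_def)
  then show ?case using dens_no_edges by fastforce
next
  case (Cons G Gs)
  then obtain V E where VE: "pgraph L V E" "\<And>c. (\<And>i. c i \<in> space M) \<Longrightarrow>
    dens M W V E c = prod_list (map (\<lambda>G. dens M W (fst G) (snd G) c) Gs)" by force
  have "pgraph L (fst G) (snd G)" using Cons.prems by simp
  from pgraph_mult[OF assms(1) this VE(1)] obtain V'' E'' where "pgraph L V'' E''"
    "\<And>c. (\<And>i. c i \<in> space M) \<Longrightarrow> dens M W V'' E'' c = dens M W (fst G) (snd G) c * dens M W V E c"
    by blast
  then show ?case using VE(2) by (intro exI[of _ V''] exI[of _ E'']) simp
qed

text \<open>In the language of model theory, the two tuples have the same type. Only entries at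
  indices in \<open>L\<close> matter, so full sequences can serve as tuples of any length.\<close>

definition eqv :: "nat set \<Rightarrow> (nat \<Rightarrow> 'a) \<Rightarrow> (nat \<Rightarrow> 'a) \<Rightarrow> bool" where
  "eqv L a b \<longleftrightarrow> (\<forall>V E. pgraph L V E \<longrightarrow> dens M W V E a = dens M W V E b)"

lemma eqv_cong:
  assumes "\<And>i. i \<in> L \<Longrightarrow> a i = a' i" "\<And>i. i \<in> L \<Longrightarrow> b i = b' i" "eqv L a b"
  shows "eqv L a' b'"
  unfolding eqv_def
proof (intro allI impI)
  fix V E assume G: "pgraph L V E"
  have "dens M W V E a' = dens M W V E a" "dens M W V E b' = dens M W V E b"
    using G assms by (auto intro!: dens_cong simp: pgraph_def)
  then show "dens M W V E a' = dens M W V E b'" using assms(3) G by (simp add: eqv_def)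
qed

text \<open>With one label, forbidding edges between labels forbids only loops; so each of these
  densities is one of the functions t_x.\<close>

lemma pgraph_singleton_label:
  assumes "pgraph {0} V E"
  obtains F where "F \<in> labeled_simple_graphs"
    "\<And>z. z \<in> space M \<Longrightarrow> dens M W V E (\<lambda>_. z) = labeled_density M W F z"
proof -
  let ?E = "(\<lambda>(i, j). {i, j}) ` E"
  have G: "finite V" "oriented E" "0 \<notin> V" "Field E \<subseteq> insert 0 V"
    using assms by (auto simp: pgraph_def)
  have ne: "i \<noteq> j \<and> i \<in> insert 0 V \<and> j \<in> insert 0 V" if "(i, j) \<in> E" for i j
    using that G(2,4) FieldI1[OF that] FieldI2[OF that] by (auto simp: oriented_def)
  then have s: "simple_graph (insert 0 V, ?E)"
    using G(1) by (auto simp: simple_graph_def card_2_iff) blast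
  then have F: "(insert 0 V, ?E, 0) \<in> labeled_simple_graphs" by (simp add: labeled_simple_graphs_def)
  have "E \<union> E\<inverse> = orientation ?E \<union> (orientation ?E)\<inverse>"
    unfolding orientation_sym[OF s] by (auto simp: doubleton_eq_iff image_iff)
  then have "dens M W V E (\<lambda>_. z) = labeled_density M W (insert 0 V, ?E, 0) z" if "z \<in> space M" for z
    unfolding labeled_density_eq_dens[OF s] using that G oriented_orientation(1)[OF s]
    by (simp add: dens_orientation[of E "orientation ?E"])
  with F show ?thesis by (rule that)
qed

text \<open>The inner product of two sections in L^2, and for distinct labels the density of a path
  of two edges between them. On the diagonal the path would become a double edge.\<close>

definition codeg :: "'a \<Rightarrow> 'a \<Rightarrow> real" where
  "codeg x y = (\<integral>w. W x w * W y w \<partial>M)"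

lemma codeg_eq_dens:
  assumes "\<And>i. c i \<in> space M" "u \<noteq> i" "u \<noteq> j" "i \<noteq> j"
  shows "dens M W {u} {(i, u), (j, u)} c = codeg (c i) (c j)"
proof -
  have "dens M W {u} {(i, u), (j, u)} c = (\<integral>z. dens M W {} {(i, u), (j, u)} (c(u := z)) \<partial>M)"
    using assms(1) by (intro dens_insert) auto
  also have "\<dots> = codeg (c i) (c j)"
    unfolding codeg_def dens_empty edge_weight_def using assms by simp
  finally show ?thesis .
qed

lemma pgraph_codeg: "u \<notin> L \<Longrightarrow> i \<in> L \<Longrightarrow> j \<in> L \<Longrightarrow> pgraph L {u} {(i, u), (j, u)}"
  by (auto simp: pgraph_def oriented_def Field_def)

lemma eqv_codeg:
  assumes "finite L" "eqv L a b" "i \<in> L" "j \<in> L" "i \<noteq> j" "\<And>i. a i \<in> space M" "\<And>i. b i \<in> space M"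
  shows "codeg (a i) (a j) = codeg (b i) (b j)"
proof -
  obtain u where u: "u \<notin> L" using ex_new_if_finite[OF infinite_UNIV_nat assms(1)] by blast
  then have "u \<noteq> i" "u \<noteq> j" using assms by auto
  then show ?thesis
    using pgraph_codeg[OF u assms(3,4)] assms by (simp add: eqv_def flip: codeg_eq_dens)
qed

text \<open>Each factor gets its own middle node, so repetitions in \<open>ks\<close> become
  powers.\<close>

lemma codeg_prod_dens:
  assumes L: "finite L" "v \<notin> L" "set ks \<subseteq> L"
  obtains V E where "pgraph (insert v L) V E"
    "\<And>c. (\<And>i. c i \<in> space M) \<Longrightarrow> dens M W V E c = prod_list (map (\<lambda>k. codeg (c k) (c v)) ks)"
proof -
  obtain u where u: "u \<notin> insert v L" using ex_new_if_finite[OF infinite_UNIV_nat] L(1) by (metis finite_insert)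
  have G: "pgraph (insert v L) {u} {(k, u), (v, u)}" if "k \<in> set ks" for k
    using pgraph_codeg[OF u] that L by auto
  have "\<exists>V E. pgraph (insert v L) V E \<and> (\<forall>c. (\<forall>i. c i \<in> space M) \<longrightarrow>
    dens M W V E c = prod_list (map (\<lambda>G. dens M W (fst G) (snd G) c) (map (\<lambda>k. ({u}, {(k, u), (v, u)})) ks)))"
    using L G by (intro pgraph_prod_list) auto
  then obtain V E where VE: "pgraph (insert v L) V E" "\<And>c. (\<And>i. c i \<in> space M) \<Longrightarrow>
    dens M W V E c = prod_list (map (\<lambda>k. dens M W {u} {(k, u), (v, u)} c) ks)" by (auto simp: comp_def)
  have "dens M W V E c = prod_list (map (\<lambda>k. codeg (c k) (c v)) ks)" if "\<And>i. c i \<in> space M" for c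
  proof -
    have "dens M W {u} {(k, u), (v, u)} c = codeg (c k) (c v)" if "k \<in> set ks" for k
      using that u L \<open>\<And>i. c i \<in> space M\<close> by (intro codeg_eq_dens) auto
    then have "map (\<lambda>k. dens M W {u} {(k, u), (v, u)} c) ks = map (\<lambda>k. codeg (c k) (c v)) ks" by simp
    then show ?thesis unfolding VE(2)[OF that] by (rule arg_cong)
  qed
  with VE(1) that show ?thesis by blast
qed

text \<open>Integrating the label \<open>v\<close> turns a product of codegrees into a moment. Once
  \<open>v\<close> is integrated, an edge from \<open>i\<close> to \<open>v\<close> no longer joins
  two labels, which admits \<open>W (a i)\<close> as a weight.\<close>

lemma eqv_codeg_moments:
  assumes L: "finite L" "set ks \<subseteq> L" and ab: "eqv L a b" "\<And>i. a i \<in> space M" "\<And>i. b i \<in> space M"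
  shows "(\<integral>z. prod_list (map (\<lambda>k. codeg (a k) z) ks) \<partial>M) = (\<integral>z. prod_list (map (\<lambda>k. codeg (b k) z) ks) \<partial>M)"
    and "i \<in> L \<Longrightarrow> (\<integral>z. W (a i) z * prod_list (map (\<lambda>k. codeg (a k) z) ks) \<partial>M)
        = (\<integral>z. W (b i) z * prod_list (map (\<lambda>k. codeg (b k) z) ks) \<partial>M)"
proof -
  obtain v where v: "v \<notin> L" using ex_new_if_finite[OF infinite_UNIV_nat L(1)] by blast
  obtain V E where VE: "pgraph (insert v L) V E"
    "\<And>c. (\<And>i. c i \<in> space M) \<Longrightarrow> dens M W V E c = prod_list (map (\<lambda>k. codeg (c k) (c v)) ks)"
    using codeg_prod_dens[OF L(1) v L(2)] by blast
  have fin: "finite V" "v \<notin> V" using VE(1) by (auto simp: pgraph_def)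
  have vks: "dens M W V E (c(v := z)) = prod_list (map (\<lambda>k. codeg (c k) z) ks)"
    if "\<And>i. c i \<in> space M" "z \<in> space M" for c z
  proof -
    have "map (\<lambda>k. codeg ((c(v := z)) k) ((c(v := z)) v)) ks = map (\<lambda>k. codeg (c k) z) ks"
      using v L(2) by auto
    moreover have "(c(v := z)) i \<in> space M" for i using that by auto
    ultimately show ?thesis using VE(2)[of "c(v := z)"] by metis
  qed
  have 1: "dens M W (insert v V) E c = (\<integral>z. prod_list (map (\<lambda>k. codeg (c k) z) ks) \<partial>M)"
    if "\<And>i. c i \<in> space M" for c
    using that fin by (subst dens_insert) (auto simp: vks intro!: Bochner_Integration.integral_cong)
  show "(\<integral>z. prod_list (map (\<lambda>k. codeg (a k) z) ks) \<partial>M) = (\<integral>z. prod_list (map (\<lambda>k. codeg (b k) z) ks) \<partial>M)"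
    using 1 ab pgraph_insert[OF v VE(1)] by (simp add: eqv_def flip: 1)
  assume i: "i \<in> L"
  have or: "oriented E" using VE(1) by (simp add: pgraph_def)
  \<comment> \<open>Every edge of \<open>E\<close> has an endpoint in \<open>V\<close>, which
    contains neither \<open>i\<close> nor \<open>v\<close>; so adding the edge below creates no
    double edge.\<close>
  have ni: "(i, v) \<notin> E" "(v, i) \<notin> E" "i \<noteq> v" using VE(1) i v by (auto simp: pgraph_def)
  then have G: "pgraph L (insert v V) (insert (i, v) E)"
    using pgraph_insert[OF v VE(1)] i by (auto simp: pgraph_def oriented_def Field_insert)
  have 2: "dens M W (insert v V) (insert (i, v) E) c = (\<integral>z. W (c i) z * prod_list (map (\<lambda>k. codeg (c k) z) ks) \<partial>M)"
    if c: "\<And>i. c i \<in> space M" for c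
  proof -
    have "dens M W V (insert (i, v) E) (c(v := z)) = W (c i) z * dens M W V E (c(v := z))" for z
    proof -
      have "i \<notin> V" using VE(1) i by (auto simp: pgraph_def)
      then have "edge_weight W (insert (i, v) E) (\<lambda>j. if j \<in> V then x j else (c(v := z)) j)
          = W (c i) z * edge_weight W E (\<lambda>j. if j \<in> V then x j else (c(v := z)) j)" for x
        using ni fin or by (simp add: edge_weight_def oriented_def)
      then show ?thesis by (simp add: dens_def)
    qed
    then show ?thesis
      using c fin by (subst dens_insert) (auto simp: vks intro!: Bochner_Integration.integral_cong)
  qed
  show "(\<integral>z. W (a i) z * prod_list (map (\<lambda>k. codeg (a k) z) ks) \<partial>M)
        = (\<integral>z. W (b i) z * prod_list (map (\<lambda>k. codeg (b k) z) ks) \<partial>M)"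
    using ab G by (simp add: eqv_def flip: 2)
qed

text \<open>A difference of products is at most the sum of the differences of the factors. Only
  edges at \<open>v\<close> contribute, and as their other end is integrated, each costs at most the
  distance of the two sections.\<close>

lemma dens_lipschitz:
  assumes V: "finite V" "finite E" "v \<notin> V" and E: "\<And>i j. (i, j) \<in> E \<Longrightarrow> (i = v \<longrightarrow> j \<in> V) \<and> (j = v \<longrightarrow> i \<in> V)"
    and a: "\<And>i. a i \<in> space M" and z: "z \<in> space M" "z' \<in> space M"
  shows "\<bar>dens M W V E (a(v := z)) - dens M W V E (a(v := z'))\<bar> \<le> card E * graphon_dist M W z z'"
proof -
  interpret P: prob_space "\<Pi>\<^sub>M i\<in>V. M" by (rule prob_space_PiM')
  let ?x = "\<lambda>z x i. if i \<in> V then x i else (a(v := z)) i"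
  have sp: "?x z x i \<in> space M" if "z \<in> space M" "x \<in> space (\<Pi>\<^sub>M i\<in>V. M)" for x z i
    using that a by (auto simp: space_PiM PiE_iff)
  have az: "(a(v := z)) i \<in> space M" if "z \<in> space M" for z i using that a by auto
  let ?f = "\<lambda>e x. \<bar>W (?x z x (fst e)) (?x z x (snd e)) - W (?x z' x (fst e)) (?x z' x (snd e))\<bar>"
  have [measurable]: "(\<lambda>x. ?x z x i) \<in> (\<Pi>\<^sub>M i\<in>V. M) \<rightarrow>\<^sub>M M" if "z \<in> space M" for z i
    using az[OF that] by (cases "i \<in> V") auto
  have fint: "integrable (\<Pi>\<^sub>M i\<in>V. M) (?f e)" for e
  proof (rule P.integrable_const_bound[where B=1])
    show "AE x in (\<Pi>\<^sub>M i\<in>V. M). norm (?f e x) \<le> 1"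
    proof (rule AE_I2)
      fix x assume x: "x \<in> space (\<Pi>\<^sub>M i\<in>V. M)"
      have "0 \<le> W (?x y x (fst e)) (?x y x (snd e))" "W (?x y x (fst e)) (?x y x (snd e)) \<le> 1" if "y \<in> space M" for y
        using W_nonneg[OF sp[OF that x] sp[OF that x]] W_le_1[OF sp[OF that x] sp[OF that x]] by auto
      from this[OF z(1)] this[OF z(2)] show "norm (?f e x) \<le> 1" by (simp add: abs_le_iff)
    qed
  qed (use z in measurable)
  have comp: "(\<integral>x. g (x j) \<partial>(\<Pi>\<^sub>M i\<in>V. M)) = (\<integral>y. g y \<partial>M)" if "j \<in> V" "g \<in> borel_measurable M" for g :: "'a \<Rightarrow> real" and j
    using integral_distr[OF _ that(2), of "\<lambda>x. x j" "\<Pi>\<^sub>M i\<in>V. M"] distr_PiM_component[of V "\<lambda>_. M" j, OF prob_space_axioms that(1)] that(1) by simp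
  have f: "(\<integral>x. ?f e x \<partial>(\<Pi>\<^sub>M i\<in>V. M)) \<le> graphon_dist M W z z'" if e: "e \<in> E" for e
  proof -
    obtain i j where ij: "e = (i, j)" by fastforce
    have nn: "0 \<le> graphon_dist M W z z'" by (simp add: graphon_dist_def)
    consider "i = v" "j \<in> V" "j \<noteq> v" | "j = v" "i \<in> V" "i \<noteq> v" | "i \<noteq> v" "j \<noteq> v"
      using E[of i j] e ij V(3) by blast
    then show ?thesis
    proof cases
      case 1
      then have "(\<integral>x. ?f e x \<partial>(\<Pi>\<^sub>M i\<in>V. M)) = (\<integral>x. \<bar>W z (x j) - W z' (x j)\<bar> \<partial>(\<Pi>\<^sub>M i\<in>V. M))"
        using V(3) by (simp add: ij)
      also have "\<dots> = graphon_dist M W z z'"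
        unfolding graphon_dist_def using z 1 by (intro comp) auto
      finally show ?thesis by simp
    next
      case 2
      then have "(\<integral>x. ?f e x \<partial>(\<Pi>\<^sub>M i\<in>V. M)) = (\<integral>x. \<bar>W z (x i) - W z' (x i)\<bar> \<partial>(\<Pi>\<^sub>M i\<in>V. M))"
        using V(3) z W_sym by (intro Bochner_Integration.integral_cong refl) (auto simp: ij space_PiM PiE_iff)
      also have "\<dots> = graphon_dist M W z z'"
        unfolding graphon_dist_def using z 2 by (intro comp) auto
      finally show ?thesis by simp
    next
      case 3
      then have "?f e x = 0" for x unfolding ij by simp
      then show ?thesis using nn by simp
    qed
  qed
  have "\<bar>dens M W V E (a(v := z)) - dens M W V E (a(v := z'))\<bar>
     = \<bar>\<integral>x. edge_weight W E (?x z x) - edge_weight W E (?x z' x) \<partial>(\<Pi>\<^sub>M i\<in>V. M)\<bar>"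
    unfolding dens_def using dens_integrable[OF az] z by simp
  also have "\<dots> \<le> (\<integral>x. \<bar>edge_weight W E (?x z x) - edge_weight W E (?x z' x)\<bar> \<partial>(\<Pi>\<^sub>M i\<in>V. M))"
    by (rule integral_abs_bound)
  also have "\<dots> \<le> (\<integral>x. (\<Sum>e\<in>E. ?f e x) \<partial>(\<Pi>\<^sub>M i\<in>V. M))"
  proof (rule integral_mono)
    show "integrable (\<Pi>\<^sub>M i\<in>V. M) (\<lambda>x. \<bar>edge_weight W E (?x z x) - edge_weight W E (?x z' x)\<bar>)"
      using dens_integrable[OF az] z by (intro integrable_abs Bochner_Integration.integrable_diff)
    show "integrable (\<Pi>\<^sub>M i\<in>V. M) (\<lambda>x. \<Sum>e\<in>E. ?f e x)" by (intro Bochner_Integration.integrable_sum fint)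
    fix x assume x: "x \<in> space (\<Pi>\<^sub>M i\<in>V. M)"
    have "norm (W (?x y x (fst e)) (?x y x (snd e))) \<le> 1" if "y \<in> space M" for y e
      using W_nonneg[OF sp[OF that x] sp[OF that x]] W_le_1[OF sp[OF that x] sp[OF that x]] by (simp add: abs_le_iff)
    then have "norm ((\<Prod>e\<in>E. W (?x z x (fst e)) (?x z x (snd e))) - (\<Prod>e\<in>E. W (?x z' x (fst e)) (?x z' x (snd e))))
      \<le> (\<Sum>e\<in>E. norm (W (?x z x (fst e)) (?x z x (snd e)) - W (?x z' x (fst e)) (?x z' x (snd e))))"
      using z by (intro norm_prod_diff)
    then show "\<bar>edge_weight W E (?x z x) - edge_weight W E (?x z' x)\<bar> \<le> (\<Sum>e\<in>E. ?f e x)"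
      by (simp add: edge_weight_def case_prod_beta')
  qed
  also have "\<dots> = (\<Sum>e\<in>E. (\<integral>x. ?f e x \<partial>(\<Pi>\<^sub>M i\<in>V. M)))"
    by (intro Bochner_Integration.integral_sum fint)
  also have "\<dots> \<le> (\<Sum>e\<in>E. graphon_dist M W z z')" by (intro sum_mono f)
  finally show ?thesis by simp
qed

end

subsection \<open>Back and forth between two nodes\<close>

text \<open>A pure graphon laid out in a complete metric type: \<open>S\<close> is its node set, the
  rest is a null set, and the metric of the type restricts on \<open>S\<close> to that of the
  graphon.\<close>

locale metric_kernel = kernel N U
  for N :: "'b::complete_space measure" and U :: "'b \<Rightarrow> 'b \<Rightarrow> real" +
  fixes S :: "'b set" and d :: "nat \<Rightarrow> 'b"
  assumes sets_N: "sets N = sets borel"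
    and S_closed: "closed S" and S_full: "AE x in N. x \<in> S"
    and d_range: "range d \<subseteq> S" and d_dense: "S \<subseteq> closure (range d)"
    and dist_eq: "x \<in> S \<Longrightarrow> y \<in> S \<Longrightarrow> graphon_dist N U x y = dist x y"
    and ball_pos: "x \<in> S \<Longrightarrow> 0 < e \<Longrightarrow> 0 < measure N (ball x e)"
begin

lemma space_N [simp]: "space N = UNIV"
  using sets_eq_imp_space_eq[OF sets_N] by simp

lemma borel_measurable_N: "borel_measurable N = borel_measurable borel"
  by (rule measurable_cong_sets[OF sets_N refl])

lemma dens_continuous:
  assumes "finite V" "finite E" "v \<notin> V" "\<And>i j. (i, j) \<in> E \<Longrightarrow> (i = v \<longrightarrow> j \<in> V) \<and> (j = v \<longrightarrow> i \<in> V)"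
  shows "continuous_on S (\<lambda>z. dens N U V E (a(v := z)))"
proof (rule lipschitz_on_continuous_on)
  show "(real (card E))-lipschitz_on S (\<lambda>z. dens N U V E (a(v := z)))"
  proof (rule lipschitz_onI)
    fix x y assume "x \<in> S" "y \<in> S"
    then show "dist (dens N U V E (a(v := x))) (dens N U V E (a(v := y))) \<le> real (card E) * dist x y"
      using dens_lipschitz[OF assms, of a x y] dist_eq by (simp add: dist_real_def)
  qed simp
qed

text \<open>Full support: a point with a different value would have a whole ball of such points, and
  that ball has positive measure.\<close>

lemma continuous_AE_const:
  fixes f :: "'b \<Rightarrow> real"
  assumes "continuous_on S f" "AE x in N. f x = c" "x \<in> S"
  shows "f x = c"
proof (rule ccontr)
  assume "f x \<noteq> c"
  with assms obtain e where e: "e > 0" "\<And>y. y \<in> S \<Longrightarrow> dist y x < e \<Longrightarrow> dist (f y) (f x) < dist (f x) c"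
    unfolding continuous_on_iff by (metis zero_less_dist_iff)
  have "AE y in N. y \<notin> ball x e"
    using assms(2) S_full
  proof eventually_elim
    case (elim y)
    show ?case using e(2)[of y] elim by (auto simp: dist_commute)
  qed
  moreover have "ball x e \<in> sets N" by (simp add: sets_N)
  ultimately have "emeasure N (ball x e) = 0" by (simp add: AE_iff_null_sets null_setsD1)
  then show False using ball_pos[OF assms(3) e(1)] by (simp add: measure_def)
qed

lemma labeled_density_const:
  assumes F: "F \<in> labeled_simple_graphs" and c: "AE x in N. labeled_density N U F x = c" and x: "x \<in> S"
  shows "labeled_density N U F x = c"
proof (rule continuous_AE_const[OF _ c x])
  obtain V E l where VE: "F = (V, E, l)" by (cases F) auto
  have s: "simple_graph (V, E)" using F unfolding VE labeled_simple_graphs_def by auto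
  note O = oriented_orientation[OF s]
  have "labeled_density N U F = (\<lambda>z. dens N U (V - {l}) (orientation E) ((\<lambda>_. x)(l := z)))"
    unfolding VE labeled_density_eq_dens[OF s] using O(2) by (intro ext dens_cong) auto
  moreover have "continuous_on S (\<lambda>z. dens N U (V - {l}) (orientation E) ((\<lambda>_. x)(l := z)))"
    using s O by (intro dens_continuous)
      (auto simp: simple_graph_def oriented_def orientation_def)
  ultimately show "continuous_on S (labeled_density N U F)" by simp
qed

text \<open>A moment of the densities of (\<open>a\<close>, \<open>z\<close>) for random
  \<open>z\<close> is the density of a single graph in which \<open>v\<close> is no longer a label.
  Its labels lie in \<open>L\<close>, so it is the same for \<open>a\<close> and
  \<open>b\<close>.\<close>

lemma eqv_extend:
  assumes L: "finite L" "v \<notin> L" and ab: "eqv L a b" and x: "x \<in> S" and e: "e > 0"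
  obtains z z' where "z \<in> S" "z' \<in> S" "dist x z \<le> e" "eqv (insert v L) (a(v := z)) (b(v := z'))"
proof -
  define G where "G = from_nat_into {(V, E). pgraph (insert v L) V E}"
  have "({}, {}) \<in> {(V, E). pgraph (insert v L) V E}" by (simp add: pgraph_def oriented_def)
  then have "{(V, E). pgraph (insert v L) V E} \<noteq> {}" by blast
  then have G: "pgraph (insert v L) (fst (G k)) (snd (G k))" for k
    using from_nat_into[of "{(V, E). pgraph (insert v L) V E}" k] unfolding G_def case_prod_beta' by auto
  have G_surj: "\<exists>k. G k = (V, E)" if "pgraph (insert v L) V E" for V E
    using from_nat_into_surj[OF countable_pgraph, of "(V, E)" "insert v L"] that unfolding G_def by auto
  have G_fin: "finite (fst (G k))" "finite (snd (G k))" "v \<notin> fst (G k)" for k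
    using G[of k] by (auto simp: pgraph_def oriented_def)
  define \<Phi> where "\<Phi> c z k = dens N U (fst (G k)) (snd (G k)) (c(v := z))" for c :: "nat \<Rightarrow> 'b" and z k
  have cont: "continuous_on S (\<Phi> c)" for c
    unfolding \<Phi>_def
  proof (intro continuous_on_coordinatewise_then_product dens_continuous G_fin)
    fix k i j assume ij: "(i, j) \<in> snd (G k)"
    then show "(i = v \<longrightarrow> j \<in> fst (G k)) \<and> (j = v \<longrightarrow> i \<in> fst (G k))"
      using G[of k] by (auto simp: pgraph_def)
  qed
  have meas: "\<Phi> c \<in> borel_measurable borel" for c
  proof (rule measurable_coordinatewise_then_product)
    fix k
    have [measurable]: "(\<lambda>z. (c(v := z)) i) \<in> N \<rightarrow>\<^sub>M N" for i by (cases "i = v") auto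
    have "(\<lambda>z. \<Phi> c z k) \<in> borel_measurable N" unfolding \<Phi>_def by (intro dens_measurable G_fin) measurable
    then show "(\<lambda>z. \<Phi> c z k) \<in> borel_measurable borel" by (simp add: borel_measurable_N)
  qed
  then have measN[measurable]: "\<Phi> c \<in> borel_measurable N" for c by (simp add: borel_measurable_N)
  have eq: "distr N borel (\<Phi> a) = distr N borel (\<Phi> b)"
  proof (rule moments_determine_measure)
    show "finite_measure (distr N borel (\<Phi> a))" "finite_measure (distr N borel (\<Phi> b))"
      by (intro finite_measure_distr measN)+
    have bd: "\<forall>i. 0 \<le> \<Phi> c z i \<and> \<Phi> c z i \<le> 1" for c z unfolding \<Phi>_def using dens_bounds by simp
    have "{x :: nat \<Rightarrow> real. \<forall>i. 0 \<le> x i \<and> x i \<le> 1} \<in> sets borel"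
      by (intro borel_closed compact_imp_closed compact_unit_cube)
    then show "AE x in distr N borel (\<Phi> a). \<forall>i. 0 \<le> x i \<and> x i \<le> 1" "AE x in distr N borel (\<Phi> b). \<forall>i. 0 \<le> x i \<and> x i \<le> 1"
      using bd by (simp_all add: AE_distr_iff[OF measN])
    fix ks :: "nat list"
    have "\<exists>V E. pgraph (insert v L) V E \<and> (\<forall>c. (\<forall>i. c i \<in> space N) \<longrightarrow>
       dens N U V E c = prod_list (map (\<lambda>G. dens N U (fst G) (snd G) c) (map G ks)))"
      using L G by (intro pgraph_prod_list) auto
    then obtain V E where VE: "pgraph (insert v L) V E"
      "\<And>c. dens N U V E c = prod_list (map (\<lambda>k. dens N U (fst (G k)) (snd (G k)) c) ks)"
      by (auto simp: comp_def)
    have "(\<integral>x. prod_list (map x ks) \<partial>distr N borel (\<Phi> c)) = dens N U (insert v V) E c" for c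
    proof -
      have "(\<integral>x. prod_list (map x ks) \<partial>distr N borel (\<Phi> c)) = (\<integral>z. prod_list (map (\<Phi> c z) ks) \<partial>N)"
        by (rule integral_distr[OF measN prod_list_measurable])
      also have "\<dots> = (\<integral>z. dens N U V E (c(v := z)) \<partial>N)"
        unfolding VE(2) \<Phi>_def ..
      also have "\<dots> = dens N U (insert v V) E c"
        using VE(1) by (subst dens_insert) (auto simp: pgraph_def)
      finally show ?thesis .
    qed
    then show "(\<integral>x. prod_list (map x ks) \<partial>distr N borel (\<Phi> a)) = (\<integral>x. prod_list (map x ks) \<partial>distr N borel (\<Phi> b))"
      using ab pgraph_insert[OF L(2) VE(1)] by (simp add: eqv_def)
  qed simp_all
  \<comment> \<open>The meeting argument takes a closed set of positive measure; hence the closed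
    ball, and the weak inequality in the conclusion.\<close>
  have "measure N (ball x e) \<le> measure N (cball x e)"
    using sets_N by (intro finite_measure_mono) auto
  then have "0 < measure N (cball x e)" using ball_pos[OF x e] by linarith
  then obtain z z' where z: "z \<in> cball x e" "z \<in> S" "z' \<in> S" "\<Phi> a z = \<Phi> b z'"
    by (rule equal_laws_meet[OF finite_measure_axioms sets_N S_full S_closed d_dense meas cont meas cont eq closed_cball])
  have "eqv (insert v L) (a(v := z)) (b(v := z'))"
    unfolding eqv_def
  proof (intro allI impI)
    fix V E assume "pgraph (insert v L) V E"
    then obtain k where "G k = (V, E)" using G_surj by blast
    then show "dens N U V E (a(v := z)) = dens N U V E (b(v := z'))"
      using fun_cong[OF z(4), of k] by (simp add: \<Phi>_def)
  qed
  then show ?thesis using z that by auto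
qed

lemma eqv_sym: "eqv L a b \<Longrightarrow> eqv L b a"
  by (simp add: eqv_def)

lemma eqv_extend_both:
  assumes L: "finite L" "v \<notin> L" and ab: "eqv L a b" and x: "x \<in> S" and e: "e > 0"
  obtains z z' where "z \<in> S" "z' \<in> S" "eqv (insert v L) (a(v := z)) (b(v := z'))"
    "dist x (if left then z else z') \<le> e"
proof (cases left)
  case True
  obtain z z' where "z \<in> S" "z' \<in> S" "dist x z \<le> e" "eqv (insert v L) (a(v := z)) (b(v := z'))"
    by (rule eqv_extend[OF L ab x e])
  then show ?thesis using that True by simp
next
  case False
  obtain z z' where "z \<in> S" "z' \<in> S" "dist x z \<le> e" "eqv (insert v L) (b(v := z)) (a(v := z'))"
    by (rule eqv_extend[OF L eqv_sym[OF ab] x e])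
  then show ?thesis using that[of z' z] eqv_sym False by simp
qed

text \<open>Stage \<open>n\<close> of the back-and-forth construction codes a side, the index of a dense point
  and a radius, so that every neighbourhood is visited infinitely often on both sides.\<close>

lemma back_and_forth:
  assumes "eqv {0} (\<lambda>_. x) (\<lambda>_. y)" "x \<in> S" "y \<in> S"
  obtains a b :: "nat \<Rightarrow> 'b" where "a 0 = x" "b 0 = y" "range a \<subseteq> S" "range b \<subseteq> S" "\<And>n. eqv {..n} a b"
    "\<And>p e. p \<in> S \<Longrightarrow> e > 0 \<Longrightarrow> infinite {j. dist (a j) p < e}"
    "\<And>p e. p \<in> S \<Longrightarrow> e > 0 \<Longrightarrow> infinite {j. dist (b j) p < e}"
proof -
  \<comment> \<open>\<open>n div 2\<close> codes a pair whose first entry codes a dense point and a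
    radius; the second entry is idle, so each task recurs infinitely often. The parity of
    \<open>n\<close> is the side.\<close>
  define idx where "idx n = fst (prod_decode (fst (prod_decode (n div 2))))" for n
  define rad where "rad n = inverse (real (Suc (snd (prod_decode (fst (prod_decode (n div 2)))))))" for n
  define P where "P n p \<longleftrightarrow> (\<forall>i. fst p i \<in> S \<and> snd p i \<in> S) \<and> fst p 0 = x \<and> snd p 0 = y \<and> eqv {..n} (fst p) (snd p)"
    for n and p :: "(nat \<Rightarrow> 'b) \<times> (nat \<Rightarrow> 'b)"
  define Q where "Q n p q \<longleftrightarrow> (\<forall>i\<le>n. fst q i = fst p i \<and> snd q i = snd p i) \<and>
      dist (d (idx n)) (if even n then fst q (Suc n) else snd q (Suc n)) \<le> rad n"
    for n and p q :: "(nat \<Rightarrow> 'b) \<times> (nat \<Rightarrow> 'b)"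
  have "\<exists>f. \<forall>n. P n (f n) \<and> Q n (f n) (f (Suc n))"
  proof (rule dependent_nat_choice)
    show "\<exists>p. P 0 p" using assms by (intro exI[of _ "(\<lambda>_. x, \<lambda>_. y)"]) (auto simp: P_def atMost_0)
    fix p n assume p: "P n p"
    have "d (idx n) \<in> S" using d_range by auto
    moreover have "rad n > 0" by (simp add: rad_def)
    moreover have "eqv {..n} (fst p) (snd p)" using p by (simp add: P_def)
    ultimately obtain z z' where z: "z \<in> S" "z' \<in> S"
      "eqv (insert (Suc n) {..n}) ((fst p)(Suc n := z)) ((snd p)(Suc n := z'))"
      "dist (d (idx n)) (if even n then z else z') \<le> rad n"
      using eqv_extend_both[of "{..n}" "Suc n" "fst p" "snd p" "d (idx n)" "rad n" "even n"] by auto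
    then show "\<exists>q. P (Suc n) q \<and> Q n p q"
      using p by (intro exI[of _ "((fst p)(Suc n := z), (snd p)(Suc n := z'))"])
        (auto simp: P_def Q_def atMost_Suc)
  qed
  then obtain f where f: "\<And>n. P n (f n)" "\<And>n. Q n (f n) (f (Suc n))" by auto
  \<comment> \<open>Later stages keep the values up to their index, so the diagonal sequences agree
    with stage \<open>n\<close> up to \<open>n\<close>.\<close>
  define a where "a i = fst (f i) i" for i
  define b where "b i = snd (f i) i" for i
  have st: "fst (f n) i = a i \<and> snd (f n) i = b i" if "i \<le> n" for i n
    using that
  proof (induction n rule: dec_induct)
    case base
    show ?case by (simp add: a_def b_def)
  next
    case (step n)
    then show ?case using f(2)[of n] by (simp add: Q_def)
  qed
  have inf: "infinite {j. dist ((if left then a else b) j) p < e}" if p: "p \<in> S" "e > 0" for p e and left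
  proof -
    obtain k where k: "dist (d k) p < e / 2"
      using d_dense p closure_approachable[of p "range d"] by (metis half_gt_zero rangeE subsetD)
    obtain j where j: "inverse (real (Suc j)) < e / 2" using reals_Archimedean[of "e / 2"] p(2) by auto
    define n where "n m = 2 * prod_encode (prod_encode (k, j), m) + (if left then 0 else 1)" for m
    have n: "idx (n m) = k" "rad (n m) = inverse (real (Suc j))" "even (n m) = left" for m
      by (auto simp: idx_def rad_def n_def)
    have "dist ((if left then a else b) (Suc (n m))) p < e" for m
    proof -
      have "dist (d k) ((if left then a else b) (Suc (n m))) \<le> inverse (real (Suc j))"
        using f(2)[of "n m"] n[of m] st[of "Suc (n m)" "Suc (n m)"] by (simp add: Q_def split: if_splits)
      then show ?thesis using k j dist_triangle3[of "(if left then a else b) (Suc (n m))" p "d k"] by linarith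
    qed
    then have "range (\<lambda>m. Suc (n m)) \<subseteq> {j. dist ((if left then a else b) j) p < e}" by auto
    moreover have "inj (\<lambda>m. Suc (n m))" by (auto simp: inj_def n_def)
    ultimately show ?thesis using range_inj_infinite infinite_super by blast
  qed
  show ?thesis
  proof (rule that[of a b])
    show "a 0 = x" "b 0 = y" using f(1)[of 0] by (auto simp: P_def a_def b_def)
    show "range a \<subseteq> S" "range b \<subseteq> S" using f(1) by (auto simp: P_def a_def b_def)
    show "eqv {..n} a b" for n
    proof (rule eqv_cong[of _ "fst (f n)" _ "snd (f n)"])
      show "eqv {..n} (fst (f n)) (snd (f n))" using f(1)[of n] by (simp add: P_def)
    qed (use st in auto)
    show "infinite {j. dist (a j) p < e}" if "p \<in> S" "e > 0" for p e
      using inf[OF that, of True] by simp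
    show "infinite {j. dist (b j) p < e}" if "p \<in> S" "e > 0" for p e
      using inf[OF that, of False] by simp
  qed
qed

lemma eqv_singleton:
  assumes "\<forall>F\<in>labeled_simple_graphs. \<exists>c. AE x in N. labeled_density N U F x = c" "x \<in> S" "y \<in> S"
  shows "eqv {0} (\<lambda>_. x) (\<lambda>_. y)"
  unfolding eqv_def
proof (intro allI impI)
  fix V E assume "pgraph {0} V E"
  then obtain F where F: "F \<in> labeled_simple_graphs" "\<And>z. z \<in> space N \<Longrightarrow> dens N U V E (\<lambda>_. z) = labeled_density N U F z"
    using pgraph_singleton_label by blast
  then obtain c where "AE x in N. labeled_density N U F x = c" using assms(1) by blast
  from labeled_density_const[OF F(1) this assms(2)] labeled_density_const[OF F(1) this assms(3)]
  show "dens N U V E (\<lambda>_. x) = dens N U V E (\<lambda>_. y)"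
    using F(2)[of x] F(2)[of y] by simp
qed

end

subsection \<open>The automorphism determined by two coupled sequences\<close>

context kernel begin

lemma W_section_bounds: "x \<in> space M \<Longrightarrow> y \<in> space M \<Longrightarrow> \<bar>W x y\<bar> \<le> 1"
  using W_nonneg[of x y] W_le_1[of x y] by simp

lemma W_diff_bound:
  assumes "x \<in> space M" "y \<in> space M" "z \<in> space M" shows "\<bar>W x z - W y z\<bar> \<le> 1"
  using W_nonneg[OF assms(1,3)] W_le_1[OF assms(1,3)] W_nonneg[OF assms(2,3)] W_le_1[OF assms(2,3)]
  by (simp add: abs_le_iff)

lemma integrable_section:
  assumes "x \<in> space M" shows "integrable M (W x)"
  using assms W_section_bounds by (intro integrable_const_bound[where B=1] AE_I2) auto

lemma integrable_section_mult:
  assumes "x \<in> space M" "y \<in> space M" shows "integrable M (\<lambda>w. W x w * W y w)"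
  using assms W_section_bounds by (intro integrable_const_bound[where B=1] AE_I2) (auto simp: abs_mult mult_le_one)

lemma codeg_sym: "codeg x y = codeg y x"
  by (simp add: codeg_def mult.commute)

lemma codeg_bounds:
  assumes "x \<in> space M" "y \<in> space M"
  shows "0 \<le> codeg x y" "codeg x y \<le> 1"
proof -
  show "0 \<le> codeg x y" unfolding codeg_def using assms W_nonneg by (intro integral_nonneg_AE AE_I2) auto
  show "codeg x y \<le> 1" unfolding codeg_def
    using assms W_nonneg W_le_1 by (intro integral_le_const integrable_section_mult AE_I2) (auto intro: mult_le_one)
qed

lemma codeg_lipschitz:
  assumes "x \<in> space M" "y \<in> space M" "z \<in> space M"
  shows "\<bar>codeg x z - codeg y z\<bar> \<le> graphon_dist M W x y"
proof -
  have "\<bar>codeg x z - codeg y z\<bar> = \<bar>\<integral>w. W x w * W z w - W y w * W z w \<partial>M\<bar>"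
    unfolding codeg_def using assms by (simp add: integrable_section_mult)
  also have "\<dots> \<le> (\<integral>w. \<bar>W x w * W z w - W y w * W z w\<bar> \<partial>M)" by (rule integral_abs_bound)
  also have "\<dots> \<le> graphon_dist M W x y"
    unfolding graphon_dist_def
  proof (rule integral_mono)
    show "integrable M (\<lambda>w. \<bar>W x w * W z w - W y w * W z w\<bar>)" "integrable M (\<lambda>w. \<bar>W x w - W y w\<bar>)"
      using assms by (auto intro!: integrable_section_mult integrable_section)
    fix w assume "w \<in> space M"
    then have "\<bar>W x w - W y w\<bar> * \<bar>W z w\<bar> \<le> \<bar>W x w - W y w\<bar>"
      using assms W_section_bounds by (intro mult_left_le) auto
    then show "\<bar>W x w * W z w - W y w * W z w\<bar> \<le> \<bar>W x w - W y w\<bar>"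
      by (simp add: abs_mult flip: left_diff_distrib)
  qed
  finally show ?thesis .
qed

lemma codeg_measurable [measurable]: "x \<in> space M \<Longrightarrow> codeg x \<in> borel_measurable M"
  unfolding codeg_def[abs_def] by measurable

text \<open>The squared L^2 distance of two sections, written through codegrees so that equality of
  codegrees transfers it.\<close>

definition l2_dist :: "'a \<Rightarrow> 'a \<Rightarrow> real" where
  "l2_dist x y = codeg x x - 2 * codeg x y + codeg y y"

lemma l2_dist_eq:
  assumes "x \<in> space M" "y \<in> space M"
  shows "l2_dist x y = (\<integral>w. (W x w - W y w)\<^sup>2 \<partial>M)"
    and "integrable M (\<lambda>w. (W x w - W y w)\<^sup>2)"
proof -
  note i = integrable_section_mult[OF assms(1,1)] integrable_section_mult[OF assms] integrable_section_mult[OF assms(2,2)]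
  have e: "(W x w - W y w)\<^sup>2 = W x w * W x w - 2 * (W x w * W y w) + W y w * W y w" for w
    by (simp add: power2_eq_square algebra_simps)
  show "integrable M (\<lambda>w. (W x w - W y w)\<^sup>2)" unfolding e using i by auto
  show "l2_dist x y = (\<integral>w. (W x w - W y w)\<^sup>2 \<partial>M)" unfolding e l2_dist_def codeg_def using i by simp
qed

text \<open>The lower bound is the nonnegativity of a variance; the upper one holds because values
  of \<open>W\<close> differ by at most 1. So L^1 and L^2 distances of sections define the same
  uniformity.\<close>

lemma l2_dist_bounds:
  assumes "x \<in> space M" "y \<in> space M"
  shows "(graphon_dist M W x y)\<^sup>2 \<le> l2_dist x y" "l2_dist x y \<le> graphon_dist M W x y"
proof -
  have i: "integrable M (\<lambda>w. \<bar>W x w - W y w\<bar>)" using assms by (auto intro!: integrable_section)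
  have i2: "integrable M (\<lambda>w. \<bar>W x w - W y w\<bar>\<^sup>2)" using l2_dist_eq(2)[OF assms] by simp
  have "0 \<le> variance (\<lambda>w. \<bar>W x w - W y w\<bar>)" by (rule variance_positive)
  also have "\<dots> = l2_dist x y - (graphon_dist M W x y)\<^sup>2"
    unfolding variance_eq[OF i i2] l2_dist_eq(1)[OF assms] graphon_dist_def by simp
  finally show "(graphon_dist M W x y)\<^sup>2 \<le> l2_dist x y" by simp
  show "l2_dist x y \<le> graphon_dist M W x y"
    unfolding l2_dist_eq(1)[OF assms] graphon_dist_def
  proof (rule integral_mono)
    fix w assume "w \<in> space M"
    with assms have "\<bar>W x w - W y w\<bar> \<le> 1" by (rule W_diff_bound)
    then have "\<bar>W x w - W y w\<bar> * \<bar>W x w - W y w\<bar> \<le> \<bar>W x w - W y w\<bar>" by (intro mult_left_le) auto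
    then show "(W x w - W y w)\<^sup>2 \<le> \<bar>W x w - W y w\<bar>" by (simp add: power2_eq_square)
  qed (use l2_dist_eq(2)[OF assms] i in auto)
qed

text \<open>The square norm of a section is recovered from the inner products with \<open>n\<close> nearby
  sections, because the diagonal contributes only \<open>1/n\<close> to the square norm of their average.\<close>

lemma codeg_average:
  assumes J: "finite J" "J \<noteq> {}" and b: "\<And>j. j \<in> J \<Longrightarrow> b j \<in> space M" "y \<in> space M"
    and off: "\<And>j k. j \<in> J \<Longrightarrow> k \<in> J \<Longrightarrow> j \<noteq> k \<Longrightarrow> codeg (b j) (b k) \<le> c + \<epsilon>"
    and y: "\<And>j. j \<in> J \<Longrightarrow> codeg (b j) y \<ge> c - \<epsilon>" and c: "0 \<le> c" "0 \<le> \<epsilon>"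
  shows "c \<le> codeg y y + 3 * \<epsilon> + 1 / card J"
proof -
  define n where "n = real (card J)"
  have n: "n > 0" using J by (simp add: n_def card_gt_0_iff)
  have bi: "integrable M (\<lambda>w. W (b j) w * W (b k) w)" "integrable M (\<lambda>w. W (b j) w * W y w)"
    if "j \<in> J" "k \<in> J" for j k using that b by (auto intro: integrable_section_mult)
  have yi: "integrable M (\<lambda>w. W y w * W y w)" using b(2) by (intro integrable_section_mult)
  \<comment> \<open>The estimate comes from the nonnegativity of the integral of this
    square.\<close>
  have exp: "((\<Sum>j\<in>J. W (b j) w) - n * W y w)\<^sup>2 = (\<Sum>j\<in>J. \<Sum>k\<in>J. W (b j) w * W (b k) w)
      - 2 * n * (\<Sum>j\<in>J. W (b j) w * W y w) + n\<^sup>2 * (W y w * W y w)" for w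
    by (simp add: power2_diff power2_eq_square sum_product sum_distrib_left sum_distrib_right algebra_simps)
  have "0 \<le> (\<integral>w. ((\<Sum>j\<in>J. W (b j) w) - n * W y w)\<^sup>2 \<partial>M)" by simp
  also have "\<dots> = (\<Sum>j\<in>J. \<Sum>k\<in>J. codeg (b j) (b k)) - 2 * n * (\<Sum>j\<in>J. codeg (b j) y) + n\<^sup>2 * codeg y y"
    unfolding exp codeg_def using bi yi by simp
  finally have 1: "0 \<le> (\<Sum>j\<in>J. \<Sum>k\<in>J. codeg (b j) (b k)) - 2 * n * (\<Sum>j\<in>J. codeg (b j) y) + n\<^sup>2 * codeg y y" .
  have "(\<Sum>j\<in>J. \<Sum>k\<in>J. codeg (b j) (b k)) \<le> (\<Sum>j\<in>J. \<Sum>k\<in>J. (if j = k then 1 else 0) + (c + \<epsilon>))"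
  proof (intro sum_mono)
    fix j k assume "j \<in> J" "k \<in> J"
    then show "codeg (b j) (b k) \<le> (if j = k then 1 else 0) + (c + \<epsilon>)"
      using off[of j k] codeg_bounds(2)[OF b(1) b(1), of j k] c by auto
  qed
  also have "\<dots> = n + n\<^sup>2 * (c + \<epsilon>)"
    using J by (simp add: sum.distrib n_def power2_eq_square sum.delta algebra_simps)
  finally have 2: "(\<Sum>j\<in>J. \<Sum>k\<in>J. codeg (b j) (b k)) \<le> n + n\<^sup>2 * (c + \<epsilon>)" .
  have 3: "2 * n * (n * (c - \<epsilon>)) \<le> 2 * n * (\<Sum>j\<in>J. codeg (b j) y)"
  proof -
    have "n * (c - \<epsilon>) \<le> (\<Sum>j\<in>J. codeg (b j) y)" unfolding n_def using y by (intro sum_bounded_below) auto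
    then show ?thesis using n by (simp add: mult_left_mono)
  qed
  \<comment> \<open>One \<open>\<epsilon>\<close> comes from the mutual codegrees and two from the
    mixed term; the diagonal contributes \<open>n\<close>, which becomes \<open>1 / n\<close> on
    division by \<open>n\<^sup>2\<close>.\<close>
  from 1 2 3 have "0 \<le> n + n\<^sup>2 * (c + \<epsilon>) - 2 * n * (n * (c - \<epsilon>)) + n\<^sup>2 * codeg y y" by linarith
  then have "0 \<le> n\<^sup>2 * (1 / n + 3 * \<epsilon> - c + codeg y y)"
  proof -
    have "n\<^sup>2 * (1 / n) = n" using n by (simp add: power2_eq_square)
    then have "n\<^sup>2 * (1 / n + 3 * \<epsilon> - c + codeg y y)
        = n + n\<^sup>2 * (c + \<epsilon>) - 2 * n * (n * (c - \<epsilon>)) + n\<^sup>2 * codeg y y"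
      by (simp add: distrib_left right_diff_distrib power2_eq_square)
    with \<open>0 \<le> n + _ - _ + _\<close> show ?thesis by simp
  qed
  then have "0 \<le> 1 / n + 3 * \<epsilon> - c + codeg y y" using n by (simp add: zero_le_mult_iff)
  then show ?thesis by (simp add: n_def)
qed

end

section \<open>Extending the correspondence of two sequences\<close>

lemma continuous_agree_on_closure:
  fixes f g :: "'x::metric_space \<Rightarrow> 'y::metric_space"
  assumes "continuous_on (closure X) f" "continuous_on (closure X) g" "\<And>x. x \<in> X \<Longrightarrow> f x = g x" "x \<in> closure X"
  shows "f x = g x"
proof -
  have "continuous_on (closure X) (\<lambda>x. dist (f x) (g x))" using assms by (intro continuous_intros)
  from continuous_constant_on_closure[OF this _ assms(4), of 0] assms(3) show ?thesis by simp
qed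

text \<open>The averaging argument takes arbitrarily many distinct indices close to one point; at an
  isolated point, density of the sequence alone would not supply them.\<close>

locale coupled = metric_kernel N U S d
  for N :: "'b::complete_space measure" and U S d +
  fixes a b :: "nat \<Rightarrow> 'b"
  assumes a_range: "range a \<subseteq> S" and b_range: "range b \<subseteq> S" and ab_eqv: "\<And>n. eqv {..n} a b"
    and a_inf: "\<And>p e. p \<in> S \<Longrightarrow> e > 0 \<Longrightarrow> infinite {j. dist (a j) p < e}"
    and b_inf: "\<And>p e. p \<in> S \<Longrightarrow> e > 0 \<Longrightarrow> infinite {j. dist (b j) p < e}"
begin

lemma aS: "a i \<in> S" and bS: "b i \<in> S"
  using a_range b_range by auto

lemma coupled_sym: "coupled N U S d b a"
  using a_range b_range ab_eqv eqv_sym a_inf b_inf by unfold_locales auto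

lemma a_closure: "closure (range a) = S"
proof
  show "closure (range a) \<subseteq> S" by (rule closure_minimal[OF a_range S_closed])
  show "S \<subseteq> closure (range a)"
  proof
    fix p assume "p \<in> S"
    then have "\<exists>j. dist (a j) p < e" if "e > 0" for e
      using not_finite_existsD[OF a_inf[OF _ that]] by blast
    then show "p \<in> closure (range a)" by (auto simp: closure_approachable)
  qed
qed

lemma codeg_off_diag: "i \<noteq> j \<Longrightarrow> codeg (a i) (a j) = codeg (b i) (b j)"
  using ab_eqv[of "max i j"] by (intro eqv_codeg[of "{..max i j}"]) auto

text \<open>For distinct indices near \<open>i\<close>, the codegrees among the \<open>a j\<close>
  are close to the square norm of the section of \<open>a i\<close>. Being off the diagonal they
  carry over to \<open>b\<close>, where averaging bounds the norm.\<close>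

lemma codeg_diag_le: "codeg (a i) (a i) \<le> codeg (b i) (b i)"
proof (rule field_le_epsilon)
  fix e :: real assume "e > 0"
  \<comment> \<open>Moving both arguments of a codegree costs \<open>2 * \<epsilon>\<close>, which
    the average multiplies by 3; this makes \<open>e / 2\<close>. The other half of \<open>e\<close>
    is for \<open>1 / card J\<close>.\<close>
  define \<epsilon> where "\<epsilon> = e / 12"
  have \<epsilon>: "\<epsilon> > 0" using \<open>e > 0\<close> by (simp add: \<epsilon>_def)
  obtain m :: nat where m: "1 / real (Suc m) < e / 2" using nat_approx_posE[of "e / 2"] \<open>e > 0\<close> by auto
  \<comment> \<open>Removing \<open>i\<close> keeps the pairs of \<open>i\<close> with members of
    \<open>J\<close> off the diagonal as well.\<close>
  have "infinite ({j. dist (a j) (a i) < \<epsilon>} - {i})" using a_inf[OF aS \<epsilon>] by simp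
  then obtain J where J: "J \<subseteq> {j. dist (a j) (a i) < \<epsilon>} - {i}" "finite J" "card J = Suc m"
    using infinite_arbitrarily_large by meson
  have near: "\<bar>codeg (a j) z - codeg (a i) z\<bar> \<le> \<epsilon>" if "j \<in> J" for j z
    using codeg_lipschitz[of "a j" "a i" z] dist_eq[OF aS aS, of j i] that J(1) by auto
  have "codeg (a i) (a i) \<le> codeg (b i) (b i) + 3 * (2 * \<epsilon>) + 1 / card J"
  proof (rule codeg_average)
    show "codeg (b j) (b k) \<le> codeg (a i) (a i) + 2 * \<epsilon>" if "j \<in> J" "k \<in> J" "j \<noteq> k" for j k
      using near[OF that(1), of "a k"] near[OF that(2), of "a i"] codeg_off_diag[OF that(3)] codeg_sym[of "a i" "a k"] by linarith
    show "codeg (a i) (a i) - 2 * \<epsilon> \<le> codeg (b j) (b i)" if "j \<in> J" for j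
    proof -
      have "j \<noteq> i" using that J(1) by auto
      from near[OF that, of "a i"] codeg_off_diag[OF this] \<epsilon> show ?thesis by linarith
    qed
  qed (use J \<epsilon> codeg_bounds in auto)
  also have "\<dots> \<le> codeg (b i) (b i) + e" using J(3) m by (simp add: \<epsilon>_def)
  finally show "codeg (a i) (a i) \<le> codeg (b i) (b i) + e" .
qed

lemma codeg_eq: "codeg (a i) (a j) = codeg (b i) (b j)"
proof (cases "i = j")
  case True
  then show ?thesis using codeg_diag_le coupled.codeg_diag_le[OF coupled_sym] by (simp add: antisym)
qed (rule codeg_off_diag)

text \<open>Equal codegrees give equal L^2 distances; comparing these with L^1 distances on both
  sides makes the correspondence Hoelder continuous with exponent 1/2, which suffices for extending
  it to the closure.\<close>

lemma extension_exists:
  obtains g where "continuous_on S g" "g ` S \<subseteq> S" "\<And>i. g (a i) = b i"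
proof -
  have l2: "l2_dist (a i) (a j) = l2_dist (b i) (b j)" for i j by (simp add: l2_dist_def codeg_eq)
  have le: "(dist (b i) (b j))\<^sup>2 \<le> dist (a i) (a j)" for i j
    using l2_dist_bounds(1)[of "b i" "b j"] l2_dist_bounds(2)[of "a i" "a j"] l2[of i j]
    by (simp add: dist_eq aS bS)
  \<comment> \<open>If \<open>a\<close> repeats a value, any of its indices may be chosen: distance
    zero between values of \<open>a\<close> forces distance zero between those of
    \<open>b\<close>.\<close>
  define f where "f x = b (SOME i. a i = x)" for x
  have f: "f (a i) = b i" for i
  proof -
    have "a (SOME j. a j = a i) = a i" by (rule someI) simp
    then show ?thesis using le[of "SOME j. a j = a i" i] unfolding f_def by simp
  qed
  have "uniformly_continuous_on (range a) f"
    unfolding uniformly_continuous_on_def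
  proof (intro allI impI)
    fix e :: real assume "e > 0"
    have "dist (f (a j)) (f (a i)) < e" if "dist (a j) (a i) < e\<^sup>2" for i j
      using le[of j i] that \<open>e > 0\<close> unfolding f by (smt (verit) power2_less_imp_less zero_le_dist)
    then show "\<exists>d>0. \<forall>x\<in>range a. \<forall>x'\<in>range a. dist x' x < d \<longrightarrow> dist (f x') (f x) < e"
      using \<open>e > 0\<close> by (intro exI[of _ "e\<^sup>2"]) auto
  qed
  from uniformly_continuous_on_extension_on_closure[OF this]
  obtain g where g: "uniformly_continuous_on S g" "\<And>x. x \<in> range a \<Longrightarrow> f x = g x"
    unfolding a_closure by metis
  have c: "continuous_on S g" using g(1) by (rule uniformly_continuous_imp_continuous)
  have ga: "g (a i) = b i" for i using g(2)[of "a i"] f by simp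
  have "g ` closure (range a) \<subseteq> S"
    using c ga bS by (intro image_closure_subset S_closed) (auto simp: a_closure)
  then show ?thesis using that c ga by (simp add: a_closure)
qed

lemma coordinates_continuous:
  fixes c :: "nat \<Rightarrow> 'b"
  shows "continuous_on S (\<lambda>w k. codeg (c k) w)"
proof (intro continuous_on_coordinatewise_then_product lipschitz_on_continuous_on[of 1] lipschitz_onI)
  fix k x y assume "x \<in> S" "y \<in> S"
  then show "dist (codeg (c k) x) (codeg (c k) y) \<le> 1 * dist x y"
    using codeg_lipschitz[of x y "c k"] by (simp add: dist_eq codeg_sym[of "c k"] dist_real_def)
qed simp

lemma coordinates_measurable:
  fixes c :: "nat \<Rightarrow> 'b"
  shows "(\<lambda>w k. codeg (c k) w) \<in> borel_measurable borel"
  by (rule measurable_coordinatewise_then_product) (simp flip: borel_measurable_N)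

text \<open>Agreement of the codegrees with a dense sequence passes by continuity to the codegrees
  with \<open>x\<close> and \<open>y\<close> themselves, and then the L^2 distance of their sections
  vanishes.\<close>

lemma coordinates_inj: "inj_on (\<lambda>w k. codeg (a k) w) S"
proof (rule inj_onI)
  fix x y assume xy: "x \<in> S" "y \<in> S" "(\<lambda>k. codeg (a k) x) = (\<lambda>k. codeg (a k) y)"
  have c: "continuous_on S (\<lambda>w. codeg w z)" for z
    using continuous_on_product_then_coordinatewise[OF coordinates_continuous[of "\<lambda>_. z"]] by (simp add: codeg_sym)
  have "codeg w x = codeg w y" if "w \<in> S" for w
    using continuous_agree_on_closure[of "range a" "\<lambda>w. codeg w x" "\<lambda>w. codeg w y" w] c that xy(3)
    by (auto simp: a_closure fun_eq_iff)
  from this[OF xy(1)] this[OF xy(2)] have "l2_dist x y = 0" by (simp add: l2_dist_def codeg_sym)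
  then show "x = y" using l2_dist_bounds(1)[of x y] dist_eq[OF xy(1,2)] by simp
qed

text \<open>The functions \<open>codeg (a k)\<close> separate the points of \<open>S\<close>, hence a measure on \<open>S\<close> is
  determined by their mixed moments.\<close>

lemma codeg_moments_determine_measure:
  assumes P: "finite_measure P" "sets P = sets borel" "AE x in P. x \<in> S"
    and Q: "finite_measure Q" "sets Q = sets borel" "AE x in Q. x \<in> S"
    and mom: "\<And>ks. (\<integral>z. prod_list (map (\<lambda>k. codeg (a k) z) ks) \<partial>P) = (\<integral>z. prod_list (map (\<lambda>k. codeg (a k) z) ks) \<partial>Q)"
  shows "P = Q"
proof (rule inj_law_determines_measure[OF P Q S_closed d_dense coordinates_measurable coordinates_continuous coordinates_inj])
  let ?\<Psi> = "\<lambda>w k. codeg (a k) w"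
  have m[measurable]: "?\<Psi> \<in> borel_measurable R" if "sets R = sets borel" for R
    using coordinates_measurable measurable_cong_sets[OF that refl] by blast
  have cube: "{x :: nat \<Rightarrow> real. \<forall>i. 0 \<le> x i \<and> x i \<le> 1} \<in> sets borel"
    by (intro borel_closed compact_imp_closed compact_unit_cube)
  show "distr P borel ?\<Psi> = distr Q borel ?\<Psi>"
  proof (rule moments_determine_measure)
    show "finite_measure (distr P borel ?\<Psi>)" "finite_measure (distr Q borel ?\<Psi>)"
      using P Q m by (auto intro: finite_measure.finite_measure_distr)
    show "AE x in distr P borel ?\<Psi>. \<forall>i. 0 \<le> x i \<and> x i \<le> 1" "AE x in distr Q borel ?\<Psi>. \<forall>i. 0 \<le> x i \<and> x i \<le> 1"
      using cube codeg_bounds P(2) Q(2) m by (simp_all add: AE_distr_iff)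
    show "(\<integral>x. prod_list (map x ks) \<partial>distr P borel ?\<Psi>) = (\<integral>x. prod_list (map x ks) \<partial>distr Q borel ?\<Psi>)" for ks
      using mom[of ks] by (simp add: integral_distr[OF m prod_list_measurable] P(2) Q(2))
  qed simp_all
qed

text \<open>The extensions in the two directions are inverse to each other on dense sequences, hence
  on \<open>S\<close>. Edges are preserved first at the countably many nodes \<open>a i\<close>,
  then at all nodes by approximation.\<close>

lemma automorphism_exists:
  obtains \<sigma> where "bij_betw \<sigma> S S" "\<And>x. x \<notin> S \<Longrightarrow> \<sigma> x = x" "\<sigma> \<in> N \<rightarrow>\<^sub>M N" "inv \<sigma> \<in> N \<rightarrow>\<^sub>M N" "distr N N \<sigma> = N"
    "\<And>x. x \<in> S \<Longrightarrow> AE y in N. U (\<sigma> x) (\<sigma> y) = U x y" "\<And>i. \<sigma> (a i) = b i"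
proof -
  interpret rev: coupled N U S d b a by (rule coupled_sym)
  obtain g where g: "continuous_on S g" "g ` S \<subseteq> S" "\<And>i. g (a i) = b i" by (rule extension_exists) blast
  obtain h where h: "continuous_on S h" "h ` S \<subseteq> S" "\<And>i. h (b i) = a i" by (rule rev.extension_exists) blast
  have hg: "h (g x) = x" if "x \<in> S" for x
  proof (rule continuous_agree_on_closure[of "range a" "\<lambda>x. h (g x)" "\<lambda>x. x"])
    show "continuous_on (closure (range a)) (\<lambda>x. h (g x))"
      unfolding a_closure by (rule continuous_on_compose2[OF h(1) g(1,2)])
  qed (use that g h in \<open>auto simp: a_closure\<close>)
  have gh: "g (h x) = x" if "x \<in> S" for x
  proof (rule continuous_agree_on_closure[of "range b" "\<lambda>x. g (h x)" "\<lambda>x. x"])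
    show "continuous_on (closure (range b)) (\<lambda>x. g (h x))"
      unfolding rev.a_closure by (rule continuous_on_compose2[OF g(1) h(1,2)])
  qed (use that g h in \<open>auto simp: rev.a_closure\<close>)
  \<comment> \<open>Being the identity outside \<open>S\<close> makes both maps Borel bijections of
    the whole type.\<close>
  define \<sigma> where "\<sigma> x = (if x \<in> S then g x else x)" for x
  define \<tau> where "\<tau> x = (if x \<in> S then h x else x)" for x
  have \<sigma>\<tau>: "\<sigma> (\<tau> x) = x" "\<tau> (\<sigma> x) = x" for x using g h gh hg by (auto simp: \<sigma>_def \<tau>_def)
  have inv: "inv \<sigma> = \<tau>" using \<sigma>\<tau> by (intro inv_equality)
  have \<sigma>S: "\<sigma> x \<in> S" if "x \<in> S" for x using that g by (auto simp: \<sigma>_def)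
  have \<sigma>a: "\<sigma> (a i) = b i" for i using g aS by (simp add: \<sigma>_def)
  have cont: "continuous_on S \<sigma>" using g(1) by (rule continuous_on_eq) (simp add: \<sigma>_def)
  have NN: "N \<rightarrow>\<^sub>M N = borel_measurable borel" by (rule measurable_cong_sets[OF sets_N sets_N])
  have m[measurable]: "\<sigma> \<in> N \<rightarrow>\<^sub>M N" and m': "\<tau> \<in> N \<rightarrow>\<^sub>M N"
    unfolding NN \<sigma>_def[abs_def] \<tau>_def[abs_def] using g h S_closed
    by (auto intro!: borel_measurable_continuous_on_if continuous_on_id)
  \<comment> \<open>Both sides are continuous in \<open>z\<close> and agree at every
    \<open>a j\<close> by \<open>codeg_eq\<close>.\<close>
  have ab: "codeg (b i) (\<sigma> z) = codeg (a i) z" if "z \<in> S" for i z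
  proof -
    have c: "continuous_on S (\<lambda>w. codeg y w)" for y
      using continuous_on_product_then_coordinatewise[OF coordinates_continuous[of "\<lambda>_. y"]] by simp
    show ?thesis
    proof (rule continuous_agree_on_closure[of "range a"])
      show "continuous_on (closure (range a)) (\<lambda>z. codeg (b i) (\<sigma> z))"
        unfolding a_closure using \<sigma>S by (intro continuous_on_compose2[OF c cont]) auto
    qed (use that c in \<open>auto simp: a_closure \<sigma>a codeg_eq\<close>)
  qed
  have pl: "(\<lambda>z. prod_list (map (\<lambda>k. codeg (c k) z) ks)) \<in> borel_measurable N" for c ks
    by (induction ks) auto
  have ks: "set ks \<subseteq> {..Max (insert i (set ks))}" "i \<in> {..Max (insert i (set ks))}" for ks and i :: nat by auto
  have mom: "(\<integral>z. prod_list (map (\<lambda>k. codeg (a k) z) ks) \<partial>N) = (\<integral>z. prod_list (map (\<lambda>k. codeg (b k) z) ks) \<partial>N)"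
    "(\<integral>z. U (a i) z * prod_list (map (\<lambda>k. codeg (a k) z) ks) \<partial>N) = (\<integral>z. U (b i) z * prod_list (map (\<lambda>k. codeg (b k) z) ks) \<partial>N)" for ks i
    using eqv_codeg_moments[OF finite_atMost ks(1)[of ks i] ab_eqv] ks(2)[of i ks] by auto
  have trans: "AE z in N. prod_list (map (\<lambda>k. codeg (b k) (\<sigma> z)) ks) = prod_list (map (\<lambda>k. codeg (a k) z) ks)" for ks
    using S_full by eventually_elim (simp add: ab)
  have D: "distr N N \<sigma> = N"
  proof (rule rev.codeg_moments_determine_measure)
    show "finite_measure (distr N N \<sigma>)" by (rule finite_measure_distr[OF m])
    show "AE x in distr N N \<sigma>. x \<in> S"
      using S_full \<sigma>S S_closed sets_N by (subst AE_distr_iff) (auto elim!: eventually_mono)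
    fix ks
    have "(\<integral>z. prod_list (map (\<lambda>k. codeg (b k) z) ks) \<partial>distr N N \<sigma>) = (\<integral>z. prod_list (map (\<lambda>k. codeg (b k) (\<sigma> z)) ks) \<partial>N)"
      by (rule integral_distr[OF m pl])
    also have "\<dots> = (\<integral>z. prod_list (map (\<lambda>k. codeg (a k) z) ks) \<partial>N)"
      using measurable_compose[OF m pl] by (intro integral_cong_AE trans pl)
    finally show "(\<integral>z. prod_list (map (\<lambda>k. codeg (b k) z) ks) \<partial>distr N N \<sigma>) = (\<integral>z. prod_list (map (\<lambda>k. codeg (b k) z) ks) \<partial>N)"
      by (simp add: mom)
  qed (use sets_N S_full finite_measure_axioms in auto)
  have int\<sigma>: "(\<integral>z. f (\<sigma> z) \<partial>N) = (\<integral>z. f z \<partial>N)" if "f \<in> borel_measurable N" for f :: "'b \<Rightarrow> real"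
    using integral_distr[OF m that] by (simp add: D)
  have edge: "AE z in N. U (b i) (\<sigma> z) = U (a i) z" for i
  proof -
    let ?f = "\<lambda>z. ennreal (U (a i) z)" and ?g = "\<lambda>z. ennreal (U (b i) (\<sigma> z))"
    have fm: "finite_measure (density N (\<lambda>z. ennreal (u z)))"
      if "u \<in> borel_measurable N" "\<And>z. 0 \<le> u z" "\<And>z. u z \<le> 1" for u
    proof (rule finite_measureI)
      have "emeasure (density N (\<lambda>z. ennreal (u z))) (space N) = (\<integral>\<^sup>+z. ennreal (u z) \<partial>N)"
        using that by (subst emeasure_density) (auto simp: sets_N intro!: nn_integral_cong)
      also have "\<dots> \<le> (\<integral>\<^sup>+z. 1 \<partial>N)" using that by (intro nn_integral_mono) auto
      finally show "emeasure (density N (\<lambda>z. ennreal (u z))) (space (density N (\<lambda>z. ennreal (u z)))) \<noteq> \<infinity>"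
        using emeasure_space_1 by (auto simp: top_unique)
    qed
    \<comment> \<open>Read as densities, the two rows define finite measures. Substituting
      \<open>\<sigma>\<close> reduces their moments to the weighted moments of the two sequences,
      which agree; equal measures have almost everywhere equal densities.\<close>
    have "density N ?f = density N ?g"
    proof (rule codeg_moments_determine_measure)
      show "finite_measure (density N ?f)" "finite_measure (density N ?g)"
        using W_nonneg W_le_1 by (intro fm; simp)+
      show "AE x in density N ?f. x \<in> S" "AE x in density N ?g. x \<in> S"
        using S_full by (auto simp: AE_density elim!: eventually_mono)
      fix ks
      have "(\<integral>z. prod_list (map (\<lambda>k. codeg (a k) z) ks) \<partial>density N ?g) = (\<integral>z. U (b i) (\<sigma> z) * prod_list (map (\<lambda>k. codeg (a k) z) ks) \<partial>N)"
        using pl W_nonneg by (subst integral_density) auto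
      also have "\<dots> = (\<integral>z. U (b i) (\<sigma> z) * prod_list (map (\<lambda>k. codeg (b k) (\<sigma> z)) ks) \<partial>N)"
      proof (rule integral_cong_AE)
        show "AE z in N. U (b i) (\<sigma> z) * prod_list (map (\<lambda>k. codeg (a k) z) ks) = U (b i) (\<sigma> z) * prod_list (map (\<lambda>k. codeg (b k) (\<sigma> z)) ks)"
          using trans[of ks] by eventually_elim simp
        show "(\<lambda>z. U (b i) (\<sigma> z) * prod_list (map (\<lambda>k. codeg (a k) z) ks)) \<in> borel_measurable N"
          using pl[of a ks] by measurable
        show "(\<lambda>z. U (b i) (\<sigma> z) * prod_list (map (\<lambda>k. codeg (b k) (\<sigma> z)) ks)) \<in> borel_measurable N"
          using measurable_compose[OF m pl[of b ks]] by measurable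
      qed
      also have "\<dots> = (\<integral>z. U (b i) z * prod_list (map (\<lambda>k. codeg (b k) z) ks) \<partial>N)"
        using pl[of b ks] by (intro int\<sigma>) measurable
      also have "\<dots> = (\<integral>z. U (a i) z * prod_list (map (\<lambda>k. codeg (a k) z) ks) \<partial>N)" by (simp add: mom)
      also have "\<dots> = (\<integral>z. prod_list (map (\<lambda>k. codeg (a k) z) ks) \<partial>density N ?f)"
        using pl W_nonneg by (subst integral_density) auto
      finally show "(\<integral>z. prod_list (map (\<lambda>k. codeg (a k) z) ks) \<partial>density N ?f) = (\<integral>z. prod_list (map (\<lambda>k. codeg (a k) z) ks) \<partial>density N ?g)" ..
    qed (simp_all add: sets_N)
    then have "AE z in N. ?f z = ?g z" by (intro density_unique) auto
    then show ?thesis using W_nonneg by (auto elim!: eventually_mono)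
  qed
  have all: "AE z in N. U (\<sigma> x) (\<sigma> z) = U x z" if x: "x \<in> S" for x
  proof -
    \<comment> \<open>Replace \<open>x\<close> by a nearby \<open>a i\<close>, where the edge
      identity is known. The error is \<open>dist (\<sigma> x) (b i)\<close> plus
      \<open>dist (a i) x\<close>, small by continuity of \<open>\<sigma>\<close>.\<close>
    have "(\<integral>z. \<bar>U (\<sigma> x) (\<sigma> z) - U x z\<bar> \<partial>N) \<le> e" if "e > 0" for e
    proof -
      obtain \<delta> where \<delta>: "\<delta> > 0" "\<And>y. y \<in> S \<Longrightarrow> dist y x < \<delta> \<Longrightarrow> dist (\<sigma> y) (\<sigma> x) < e / 2"
        using cont x \<open>e > 0\<close> unfolding continuous_on_iff by (meson half_gt_zero)
      obtain i where i: "dist (a i) x < min \<delta> (e / 2)"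
        using x \<delta>(1) \<open>e > 0\<close> unfolding a_closure[symmetric] closure_approachable by (metis half_gt_zero min_less_iff_conj rangeE)
      have i1: "integrable N (\<lambda>z. \<bar>U y (\<sigma> z) - U y' (\<sigma> z)\<bar>)" for y y'
        using W_section_bounds by (intro integrable_abs Bochner_Integration.integrable_diff integrable_const_bound[where B=1] AE_I2) auto
      have i2: "integrable N (\<lambda>z. \<bar>U y z - U y' z\<bar>)" for y y'
        by (intro integrable_abs Bochner_Integration.integrable_diff integrable_section) auto
      have i3: "integrable N (\<lambda>z. \<bar>U y (\<sigma> z) - U y' z\<bar>)" for y y'
        using W_section_bounds by (intro integrable_abs Bochner_Integration.integrable_diff integrable_const_bound[where B=1] AE_I2) auto
      have "(\<integral>z. \<bar>U (\<sigma> x) (\<sigma> z) - U x z\<bar> \<partial>N) \<le> (\<integral>z. \<bar>U (\<sigma> x) (\<sigma> z) - U (b i) (\<sigma> z)\<bar> + \<bar>U (a i) z - U x z\<bar> \<partial>N)"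
        by (intro integral_mono_AE Bochner_Integration.integrable_add i1 i2 i3) (use edge[of i] in \<open>eventually_elim, simp\<close>)
      also have "\<dots> = (\<integral>z. \<bar>U (\<sigma> x) (\<sigma> z) - U (b i) (\<sigma> z)\<bar> \<partial>N) + (\<integral>z. \<bar>U (a i) z - U x z\<bar> \<partial>N)"
        by (intro Bochner_Integration.integral_add i1 i2)
      also have "(\<integral>z. \<bar>U (\<sigma> x) (\<sigma> z) - U (b i) (\<sigma> z)\<bar> \<partial>N) = dist (\<sigma> x) (b i)"
        using int\<sigma>[of "\<lambda>z. \<bar>U (\<sigma> x) z - U (b i) z\<bar>"] dist_eq[OF \<sigma>S[OF x] bS[of i]] by (simp add: graphon_dist_def)
      also have "(\<integral>z. \<bar>U (a i) z - U x z\<bar> \<partial>N) = dist (a i) x"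
        using dist_eq[OF aS[of i] x] by (simp add: graphon_dist_def)
      also have "dist (\<sigma> x) (b i) + dist (a i) x \<le> e"
        using \<delta>(2)[OF aS[of i]] i by (simp add: \<sigma>a dist_commute)
      finally show ?thesis .
    qed
    then have "(\<integral>z. \<bar>U (\<sigma> x) (\<sigma> z) - U x z\<bar> \<partial>N) \<le> 0" by (rule field_le_epsilon) (simp only: add_0)
    moreover have "integrable N (\<lambda>z. \<bar>U (\<sigma> x) (\<sigma> z) - U x z\<bar>)"
      using W_section_bounds by (intro integrable_abs Bochner_Integration.integrable_diff integrable_const_bound[where B=1] AE_I2) auto
    ultimately have "AE z in N. \<bar>U (\<sigma> x) (\<sigma> z) - U x z\<bar> = 0"
      using integral_nonneg_eq_0_iff_AE[of N "\<lambda>z. \<bar>U (\<sigma> x) (\<sigma> z) - U x z\<bar>"] by (auto intro: antisym)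
    then show ?thesis by eventually_elim simp
  qed
  have bij: "bij_betw \<sigma> S S"
    using g h gh hg by (intro bij_betw_byWitness[where f'=\<tau>]) (auto simp: \<sigma>_def \<tau>_def)
  show ?thesis
    by (rule that[OF bij _ m m'[folded inv] D all \<sigma>a]) (simp_all add: \<sigma>_def)
qed

end

lemma (in metric_kernel) ess_constant_imp_transitive:
  assumes "\<forall>F\<in>labeled_simple_graphs. \<exists>c. AE x in N. labeled_density N U F x = c" "x \<in> S" "y \<in> S"
  obtains \<sigma> where "bij_betw \<sigma> S S" "\<And>x. x \<notin> S \<Longrightarrow> \<sigma> x = x" "\<sigma> \<in> N \<rightarrow>\<^sub>M N" "inv \<sigma> \<in> N \<rightarrow>\<^sub>M N" "distr N N \<sigma> = N"
    "\<And>x. x \<in> S \<Longrightarrow> AE y in N. U (\<sigma> x) (\<sigma> y) = U x y" "\<sigma> x = y"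
proof -
  obtain a b where ab: "a 0 = x" "b 0 = y" "coupled N U S d a b"
  proof (rule back_and_forth[OF eqv_singleton[OF assms] assms(2,3)])
    fix a b :: "nat \<Rightarrow> 'b"
    assume *: "a 0 = x" "b 0 = y" "range a \<subseteq> S" "range b \<subseteq> S" "\<And>n. eqv {..n} a b"
      "\<And>p e. p \<in> S \<Longrightarrow> 0 < e \<Longrightarrow> infinite {j. dist (a j) p < e}"
      "\<And>p e. p \<in> S \<Longrightarrow> 0 < e \<Longrightarrow> infinite {j. dist (b j) p < e}"
    have "coupled N U S d a b" by unfold_locales (use * in auto)
    then show ?thesis using that * by blast
  qed
  show ?thesis
  proof (rule coupled.automorphism_exists[OF ab(3)])
    fix \<sigma> assume *: "bij_betw \<sigma> S S" "\<And>x. x \<notin> S \<Longrightarrow> \<sigma> x = x" "\<sigma> \<in> N \<rightarrow>\<^sub>M N" "inv \<sigma> \<in> N \<rightarrow>\<^sub>M N" "distr N N \<sigma> = N"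
      "\<And>x. x \<in> S \<Longrightarrow> AE y in N. U (\<sigma> x) (\<sigma> y) = U x y" "\<And>i. \<sigma> (a i) = b i"
    then show ?thesis using that[OF *(1-6)] ab(1,2) *(7)[of 0] by simp
  qed
qed

subsection \<open>Separability of the space of sections\<close>

lemma AE_summable:
  fixes v :: "nat \<Rightarrow> 'a \<Rightarrow> real"
  assumes "\<And>m. integrable M (v m)" "summable (\<lambda>m. \<integral>x. \<bar>v m x\<bar> \<partial>M)"
  shows "AE x in M. summable (\<lambda>m. \<bar>v m x\<bar>)"
proof -
  note [measurable] = borel_measurable_integrable[OF assms(1)]
  have "(\<integral>\<^sup>+x. (\<Sum>m. ennreal \<bar>v m x\<bar>) \<partial>M) = (\<Sum>m. \<integral>\<^sup>+x. ennreal \<bar>v m x\<bar> \<partial>M)"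
    by (rule nn_integral_suminf) measurable
  also have "\<dots> = (\<Sum>m. ennreal (\<integral>x. \<bar>v m x\<bar> \<partial>M))"
    using assms(1) by (intro suminf_cong nn_integral_eq_integral) auto
  also have "\<dots> \<noteq> \<infinity>"
    using assms(2) by (simp add: suminf_ennreal2)
  finally have "AE x in M. (\<Sum>m. ennreal \<bar>v m x\<bar>) \<noteq> \<infinity>"
    by (intro nn_integral_PInf_AE) auto
  then show ?thesis
    by eventually_elim (auto intro: summable_suminf_not_top)
qed

text \<open>Steps with summable L^1 norms give a pointwise limit of the whole sequence, without
  passing to a subsequence.\<close>

lemma AE_convergent:
  fixes u :: "nat \<Rightarrow> 'a \<Rightarrow> real"
  assumes "\<And>m. integrable M (u m)" "summable (\<lambda>m. \<integral>x. \<bar>u (Suc m) x - u m x\<bar> \<partial>M)"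
  shows "AE x in M. convergent (\<lambda>m. u m x)"
proof -
  have "AE x in M. summable (\<lambda>m. \<bar>u (Suc m) x - u m x\<bar>)"
    using assms by (intro AE_summable) auto
  then show ?thesis
  proof eventually_elim
    case (elim x)
    then have "summable (\<lambda>m. u (Suc m) x - u m x)" by (rule summable_rabs_cancel)
    then have "convergent (\<lambda>n. \<Sum>m<n. u (Suc m) x - u m x)" by (simp add: summable_iff_convergent)
    then have "convergent (\<lambda>n. u n x - u 0 x)" unfolding sum_lessThan_telescope[of "\<lambda>m. u m x"] .
    from convergent_add[OF this convergent_const[of "u 0 x"]] show ?case by simp
  qed
qed

section \<open>Sections near countably many functions\<close>

context prob_space begin

text \<open>L^1 of a probability space may be inseparable, but the sections of a bounded
  product-measurable function stay near a countable family. Its members \<open>G n\<close> are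
  arbitrary integrable functions, not necessarily sections.\<close>

definition sections_separable :: "('a \<times> 'a \<Rightarrow> real) \<Rightarrow> bool" where
  "sections_separable f \<longleftrightarrow> (\<exists>G :: nat \<Rightarrow> 'a \<Rightarrow> real. (\<forall>n. integrable M (G n)) \<and>
     (\<forall>x\<in>space M. \<forall>e>0. \<exists>n. (\<integral>z. \<bar>f (x, z) - G n z\<bar> \<partial>M) < e))"

definition section_integrable :: "('a \<times> 'a \<Rightarrow> real) \<Rightarrow> bool" where
  "section_integrable f \<longleftrightarrow> (\<forall>x\<in>space M. integrable M (\<lambda>z. f (x, z)))"

lemma sections_separableI:
  assumes "\<And>n. integrable M (G n)" "\<And>x e. x \<in> space M \<Longrightarrow> e > 0 \<Longrightarrow> \<exists>n::nat. (\<integral>z. \<bar>f (x, z) - G n z\<bar> \<partial>M) < e"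
  shows "sections_separable f"
  unfolding sections_separable_def using assms by (intro exI[of _ G]) simp

lemma sections_separableE:
  assumes "sections_separable f"
  obtains G :: "nat \<Rightarrow> 'a \<Rightarrow> real" where "\<And>n. integrable M (G n)"
    "\<And>x e. x \<in> space M \<Longrightarrow> e > 0 \<Longrightarrow> \<exists>n. (\<integral>z. \<bar>f (x, z) - G n z\<bar> \<partial>M) < e"
proof -
  from assms obtain G where "(\<forall>n. integrable M (G n)) \<and>
     (\<forall>x\<in>space M. \<forall>e>0. \<exists>n::nat. (\<integral>z. \<bar>f (x, z) - G n z\<bar> \<partial>M) < e)"
    unfolding sections_separable_def ..
  then show ?thesis using that[of G] by simp
qed

lemma section_integrable_bounded:
  assumes "f \<in> borel_measurable (M \<Otimes>\<^sub>M M)" "\<And>p. p \<in> space (M \<Otimes>\<^sub>M M) \<Longrightarrow> \<bar>f p\<bar> \<le> B"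
  shows "section_integrable f"
  unfolding section_integrable_def
proof
  fix x assume x: "x \<in> space M"
  have [measurable]: "(\<lambda>z. f (x, z)) \<in> borel_measurable M"
    using assms(1) x by measurable
  show "integrable M (\<lambda>z. f (x, z))"
    using assms(2) x by (intro integrable_const_bound[where B=B] AE_I2) (auto simp: space_pair_measure)
qed

lemma sections_separable_add:
  assumes f: "sections_separable f" "section_integrable f" and g: "sections_separable g" "section_integrable g"
  shows "sections_separable (\<lambda>p. f p + g p)"
proof -
  obtain F :: "nat \<Rightarrow> 'a \<Rightarrow> real" where F: "\<And>n. integrable M (F n)" "\<And>x e. x \<in> space M \<Longrightarrow> e > 0 \<Longrightarrow> \<exists>n. (\<integral>z. \<bar>f (x, z) - F n z\<bar> \<partial>M) < e"
    by (rule sections_separableE[OF f(1)]) (rule that)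
  obtain G :: "nat \<Rightarrow> 'a \<Rightarrow> real" where G: "\<And>n. integrable M (G n)" "\<And>x e. x \<in> space M \<Longrightarrow> e > 0 \<Longrightarrow> \<exists>n. (\<integral>z. \<bar>g (x, z) - G n z\<bar> \<partial>M) < e"
    by (rule sections_separableE[OF g(1)]) (rule that)
  define H where "H k = (\<lambda>z. F (fst (prod_decode k)) z + G (snd (prod_decode k)) z)" for k
  have "\<exists>k. (\<integral>z. \<bar>f (x, z) + g (x, z) - H k z\<bar> \<partial>M) < e" if x: "x \<in> space M" and e: "e > 0" for x e
  proof -
    obtain m where m: "(\<integral>z. \<bar>f (x, z) - F m z\<bar> \<partial>M) < e / 2" using F(2)[OF x, of "e / 2"] e by auto
    obtain n where n: "(\<integral>z. \<bar>g (x, z) - G n z\<bar> \<partial>M) < e / 2" using G(2)[OF x, of "e / 2"] e by auto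
    have i: "integrable M (\<lambda>z. f (x, z))" "integrable M (\<lambda>z. g (x, z))"
      using f(2) g(2) x by (auto simp: section_integrable_def)
    have "(\<integral>z. \<bar>f (x, z) + g (x, z) - H (prod_encode (m, n)) z\<bar> \<partial>M)
        \<le> (\<integral>z. \<bar>f (x, z) - F m z\<bar> + \<bar>g (x, z) - G n z\<bar> \<partial>M)"
      using i F(1) G(1) by (intro integral_mono) (auto simp: H_def)
    also have "\<dots> = (\<integral>z. \<bar>f (x, z) - F m z\<bar> \<partial>M) + (\<integral>z. \<bar>g (x, z) - G n z\<bar> \<partial>M)"
      using i F(1) G(1) by (intro Bochner_Integration.integral_add) auto
    finally show ?thesis using m n by (intro exI[of _ "prod_encode (m, n)"]) linarith
  qed
  moreover have "integrable M (H k)" for k using F(1) G(1) by (simp add: H_def)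
  ultimately show ?thesis by (intro sections_separableI)
qed

lemma sections_separable_cmult:
  assumes f: "sections_separable f"
  shows "sections_separable (\<lambda>p. c * f p)"
proof -
  obtain F :: "nat \<Rightarrow> 'a \<Rightarrow> real" where F: "\<And>n. integrable M (F n)" "\<And>x e. x \<in> space M \<Longrightarrow> e > 0 \<Longrightarrow> \<exists>n. (\<integral>z. \<bar>f (x, z) - F n z\<bar> \<partial>M) < e"
    by (rule sections_separableE[OF f(1)]) (rule that)
  have "\<exists>n. (\<integral>z. \<bar>c * f (x, z) - c * F n z\<bar> \<partial>M) < e" if x: "x \<in> space M" and e: "e > 0" for x e
  proof -
    have "e / (\<bar>c\<bar> + 1) > 0" using e by simp
    from F(2)[OF x this] obtain n where n: "(\<integral>z. \<bar>f (x, z) - F n z\<bar> \<partial>M) < e / (\<bar>c\<bar> + 1)" by blast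
    have "(\<integral>z. \<bar>c * f (x, z) - c * F n z\<bar> \<partial>M) = \<bar>c\<bar> * (\<integral>z. \<bar>f (x, z) - F n z\<bar> \<partial>M)"
      by (simp add: abs_mult flip: right_diff_distrib)
    also have "\<dots> \<le> \<bar>c\<bar> * (e / (\<bar>c\<bar> + 1))" using n by (intro mult_left_mono) auto
    also have "\<dots> < e" using e by (simp add: field_simps)
    finally show ?thesis by blast
  qed
  moreover have "integrable M (\<lambda>z. c * F n z)" for n using F(1) by simp
  ultimately show ?thesis by (intro sections_separableI)
qed

text \<open>Dominated convergence along a fixed section brings some \<open>u i\<close> within
  \<open>e / 2\<close>; the union of the countable families of all \<open>u i\<close> then serves
  for \<open>f\<close>.\<close>

lemma sections_separable_lim:
  fixes u :: "nat \<Rightarrow> 'a \<times> 'a \<Rightarrow> real"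
  assumes u: "\<And>i. sections_separable (u i)" "\<And>i. u i \<in> borel_measurable (M \<Otimes>\<^sub>M M)"
    and bound: "\<And>i p. p \<in> space (M \<Otimes>\<^sub>M M) \<Longrightarrow> \<bar>u i p\<bar> \<le> B"
    and lim: "\<And>p. p \<in> space (M \<Otimes>\<^sub>M M) \<Longrightarrow> (\<lambda>i. u i p) \<longlonglongrightarrow> f p"
    and f: "f \<in> borel_measurable (M \<Otimes>\<^sub>M M)"
  shows "sections_separable f"
proof -
  have "\<forall>i. \<exists>F :: nat \<Rightarrow> 'a \<Rightarrow> real. (\<forall>n. integrable M (F n)) \<and> (\<forall>x\<in>space M. \<forall>e>0. \<exists>n. (\<integral>z. \<bar>u i (x, z) - F n z\<bar> \<partial>M) < e)"
  proof
    fix i show "\<exists>F :: nat \<Rightarrow> 'a \<Rightarrow> real. (\<forall>n. integrable M (F n)) \<and> (\<forall>x\<in>space M. \<forall>e>0. \<exists>n. (\<integral>z. \<bar>u i (x, z) - F n z\<bar> \<partial>M) < e)"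
      using u(1)[of i] unfolding sections_separable_def .
  qed
  then obtain F :: "nat \<Rightarrow> nat \<Rightarrow> 'a \<Rightarrow> real" where "\<forall>i. (\<forall>n. integrable M (F i n)) \<and> (\<forall>x\<in>space M. \<forall>e>0. \<exists>n. (\<integral>z. \<bar>u i (x, z) - F i n z\<bar> \<partial>M) < e)"
    unfolding choice_iff ..
  then have F: "\<And>i n. integrable M (F i n)"
    "\<And>i x e. x \<in> space M \<Longrightarrow> e > 0 \<Longrightarrow> \<exists>n. (\<integral>z. \<bar>u i (x, z) - F i n z\<bar> \<partial>M) < e" by auto
  have bf: "\<bar>f p\<bar> \<le> B" if "p \<in> space (M \<Otimes>\<^sub>M M)" for p
    using tendsto_rabs[OF lim[OF that]] bound[OF that] by (intro LIMSEQ_le_const2) auto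
  have sf: "section_integrable f" "section_integrable (u i)" for i
    using section_integrable_bounded[OF f bf] section_integrable_bounded[OF u(2) bound] by auto
  define H where "H k = F (fst (prod_decode k)) (snd (prod_decode k))" for k
  have "\<exists>k. (\<integral>z. \<bar>f (x, z) - H k z\<bar> \<partial>M) < e" if x: "x \<in> space M" and e: "e > 0" for x e
  proof -
    note [measurable] = f u(2)
    have p: "(x, z) \<in> space (M \<Otimes>\<^sub>M M)" if "z \<in> space M" for z using that x by (simp add: space_pair_measure)
    have "(\<lambda>i. \<integral>z. \<bar>f (x, z) - u i (x, z)\<bar> \<partial>M) \<longlonglongrightarrow> (\<integral>z. 0 \<partial>M)"
    proof (rule integral_dominated_convergence[where w="\<lambda>_. 2 * B"])
      show "AE z in M. (\<lambda>i. \<bar>f (x, z) - u i (x, z)\<bar>) \<longlonglongrightarrow> 0"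
      proof (rule AE_I2)
        fix z assume "z \<in> space M"
        from tendsto_rabs[OF tendsto_diff[OF tendsto_const[of "f (x, z)"] lim[OF p[OF this]]]]
        show "(\<lambda>i. \<bar>f (x, z) - u i (x, z)\<bar>) \<longlonglongrightarrow> 0" by simp
      qed
      show "AE z in M. norm \<bar>f (x, z) - u i (x, z)\<bar> \<le> 2 * B" for i
      proof (rule AE_I2)
        fix z assume "z \<in> space M"
        from bf[OF p[OF this]] bound[OF p[OF this], of i] show "norm \<bar>f (x, z) - u i (x, z)\<bar> \<le> 2 * B" by simp
      qed
      show "(\<lambda>z. \<bar>f (x, z) - u i (x, z)\<bar>) \<in> borel_measurable M" for i using x by measurable
    qed simp_all
    then have "eventually (\<lambda>i. (\<integral>z. \<bar>f (x, z) - u i (x, z)\<bar> \<partial>M) < e / 2) sequentially"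
      using e by (intro order_tendstoD(2)) auto
    then obtain i where i: "(\<integral>z. \<bar>f (x, z) - u i (x, z)\<bar> \<partial>M) < e / 2" by (auto simp: eventually_sequentially)
    obtain n where n: "(\<integral>z. \<bar>u i (x, z) - F i n z\<bar> \<partial>M) < e / 2" using F(2)[OF x, of "e / 2" i] e by auto
    have int: "integrable M (\<lambda>z. f (x, z))" "integrable M (\<lambda>z. u i (x, z))"
      using sf x by (auto simp: section_integrable_def)
    have "(\<integral>z. \<bar>f (x, z) - F i n z\<bar> \<partial>M) \<le> (\<integral>z. \<bar>f (x, z) - u i (x, z)\<bar> + \<bar>u i (x, z) - F i n z\<bar> \<partial>M)"
      using int F(1) by (intro integral_mono) auto
    also have "\<dots> = (\<integral>z. \<bar>f (x, z) - u i (x, z)\<bar> \<partial>M) + (\<integral>z. \<bar>u i (x, z) - F i n z\<bar> \<partial>M)"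
      using int F(1) by (intro Bochner_Integration.integral_add) auto
    finally show ?thesis using i n by (intro exI[of _ "prod_encode (i, n)"]) (simp add: H_def)
  qed
  moreover have "integrable M (H k)" for k using F(1) by (simp add: H_def)
  ultimately show ?thesis by (intro sections_separableI)
qed

text \<open>Rectangles have only two sections, zero and one indicator; complements and disjoint
  unions are reached by sums and limits.\<close>

lemma sections_separable_indicator:
  assumes "A \<in> sets (M \<Otimes>\<^sub>M M)"
  shows "sections_separable (indicator A)"
  using assms[unfolded sets_pair_measure]
proof (induction rule: sigma_sets_induct_disjoint[OF Int_stable_pair_measure_generator pair_measure_closed, consumes 1, case_names basic empty compl union])
  case (basic A)
  then obtain B C where BC: "A = B \<times> C" "B \<in> sets M" "C \<in> sets M" by auto
  define G where "G n = (\<lambda>z. if n = (0::nat) then 0 else indicator C z :: real)" for n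
  have "integrable M (G n)" for n using BC(3)
    by (intro integrable_const_bound[where B=1]) (auto simp: G_def)
  moreover have "\<exists>n. (\<integral>z. \<bar>indicator A (x, z) - G n z\<bar> \<partial>M) < e" if "e > 0" for x e
  proof (cases "x \<in> B")
    case True
    then have "(\<lambda>z. \<bar>indicator A (x, z) - G 1 z\<bar>) = (\<lambda>z. 0)" by (auto simp: BC(1) G_def indicator_def)
    then show ?thesis using that by (intro exI[of _ 1]) simp
  next
    case False
    then have "(\<lambda>z. \<bar>indicator A (x, z) - G 0 z\<bar>) = (\<lambda>z. 0)" by (auto simp: BC(1) G_def indicator_def)
    then show ?thesis using that by (intro exI[of _ 0]) simp
  qed
  ultimately show ?case by (intro sections_separableI)
next
  case empty
  then show ?case unfolding sections_separable_def by (intro exI[of _ "\<lambda>_ _. 0"]) auto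
next
  case (compl A)
  then have A: "A \<in> sets (M \<Otimes>\<^sub>M M)" by (simp add: sets_pair_measure)
  have one: "sections_separable (\<lambda>_. 1)"
    unfolding sections_separable_def by (intro exI[of _ "\<lambda>_ _. 1"]) auto
  have "section_integrable (\<lambda>_. 1)" "section_integrable (\<lambda>p. - 1 * indicator A p)"
    using A by (auto intro!: section_integrable_bounded[where B=1] simp: indicator_def)
  then have "sections_separable (\<lambda>p. 1 + - 1 * indicator A p)"
    by (intro sections_separable_add sections_separable_cmult one compl)
  then obtain G :: "nat \<Rightarrow> 'a \<Rightarrow> real" where G: "\<And>n. integrable M (G n)"
    "\<And>x e. x \<in> space M \<Longrightarrow> e > 0 \<Longrightarrow> \<exists>n. (\<integral>z. \<bar>1 + - 1 * indicator A (x, z) - G n z\<bar> \<partial>M) < e"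
    by (rule sections_separableE) (rule that)
  have "(\<integral>z. \<bar>indicator (space M \<times> space M - A) (x, z) - G n z\<bar> \<partial>M) = (\<integral>z. \<bar>1 + - 1 * indicator A (x, z) - G n z\<bar> \<partial>M)"
    if "x \<in> space M" for x n
    using that by (intro Bochner_Integration.integral_cong refl) (auto simp: indicator_def)
  then show ?case using G by (intro sections_separableI[of G]) simp_all
next
  case (union A)
  then have A: "\<And>i. A i \<in> sets (M \<Otimes>\<^sub>M M)" by (auto simp: sets_pair_measure)
  define u where "u n p = (\<Sum>i<n. indicator (A i) p :: real)" for n p
  have m: "u n \<in> borel_measurable (M \<Otimes>\<^sub>M M)" for n unfolding u_def using A by measurable
  have ui: "u n p = indicator (\<Union>i<n. A i) p" for n p
    unfolding u_def using union(1)
    by (subst indicator_UN_disjoint) (auto simp: disjoint_family_on_def)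
  then have ub: "\<bar>u n p\<bar> \<le> 1" for n p by (simp add: indicator_def)
  have sep: "sections_separable (u n)" for n
  proof (induction n)
    case 0
    then show ?case unfolding sections_separable_def by (intro exI[of _ "\<lambda>_ _. 0"]) (auto simp: u_def)
  next
    case (Suc n)
    have "section_integrable (indicator (A n))"
      using A by (intro section_integrable_bounded[where B=1]) (auto simp: indicator_def)
    moreover have "section_integrable (u n)" using m ub by (intro section_integrable_bounded[where B=1])
    ultimately have "sections_separable (\<lambda>p. u n p + indicator (A n) p)"
      using Suc union(3) by (intro sections_separable_add)
    then show ?case by (simp add: u_def[abs_def])
  qed
  have "(\<lambda>n. u n p) \<longlonglongrightarrow> indicator (\<Union>i. A i) p" for p
    unfolding ui by (rule LIMSEQ_indicator_UN)
  then show ?case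
    using A ub by (intro sections_separable_lim[OF sep m, where B=1]) auto
qed

end

text \<open>Separability follows by building \<open>W\<close> up from indicators. The approximating
  functions are then replaced by nodes: one for each function and radius for which some node is that
  close.\<close>

lemma (in kernel) dense_sequence:
  obtains q :: "nat \<Rightarrow> 'a" where "range q \<subseteq> space M"
    "\<And>x e. x \<in> space M \<Longrightarrow> e > 0 \<Longrightarrow> \<exists>i. graphon_dist M W x (q i) < e"
proof -
  \<comment> \<open>\<open>W\<close> is nonnegative only on the space, whereas the induction over
    nonnegative functions asks for it everywhere.\<close>
  define w where "w = (\<lambda>p. max 0 (case_prod W p))"
  have "w \<in> borel_measurable (M \<Otimes>\<^sub>M M)" "\<And>p. 0 \<le> w p" unfolding w_def using W_measurable by auto
  \<comment> \<open>The bound is a premise inside the induction because limits are handled by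
    dominated convergence; by nonnegativity, summands and approximants inherit it.\<close>
  then have "(\<exists>B. \<forall>p\<in>space (M \<Otimes>\<^sub>M M). w p \<le> B) \<longrightarrow> sections_separable w"
  proof (induction rule: borel_measurable_induct_real)
    case (set A)
    then show ?case by (simp add: sections_separable_indicator)
  next
    case (mult u c)
    show ?case
    proof (cases "c = 0")
      case True
      then show ?thesis unfolding sections_separable_def by (auto intro!: exI[of _ "\<lambda>_ _. 0"])
    next
      case False
      show ?thesis
      proof
        assume "\<exists>B. \<forall>p\<in>space (M \<Otimes>\<^sub>M M). c * u p \<le> B"
        then obtain B where "\<forall>p\<in>space (M \<Otimes>\<^sub>M M). c * u p \<le> B" ..
        then have "\<forall>p\<in>space (M \<Otimes>\<^sub>M M). u p \<le> B / c" using mult(1) False by (simp add: field_simps)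
        then show "sections_separable (\<lambda>p. c * u p)" using mult(4) by (intro sections_separable_cmult) blast
      qed
    qed
  next
    case (add u v)
    show ?case
    proof
      assume "\<exists>B. \<forall>p\<in>space (M \<Otimes>\<^sub>M M). v p + u p \<le> B"
      then obtain B where "\<forall>p\<in>space (M \<Otimes>\<^sub>M M). v p + u p \<le> B" ..
      then have B: "\<And>p. p \<in> space (M \<Otimes>\<^sub>M M) \<Longrightarrow> u p \<le> B" "\<And>p. p \<in> space (M \<Otimes>\<^sub>M M) \<Longrightarrow> v p \<le> B"
      proof -
        fix p assume "p \<in> space (M \<Otimes>\<^sub>M M)"
        then have "v p + u p \<le> B" using \<open>\<forall>p\<in>_. v p + u p \<le> B\<close> by blast
        moreover have "0 \<le> u p" "0 \<le> v p" using add by auto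
        ultimately show "u p \<le> B" "v p \<le> B" by simp_all
      qed
      then have "section_integrable u" "section_integrable v"
        using add by (auto intro!: section_integrable_bounded[where B=B])
      then show "sections_separable (\<lambda>p. v p + u p)"
        using B add by (intro sections_separable_add) blast+
    qed
  next
    case (seq u)
    show ?case
    proof
      assume "\<exists>B. \<forall>p\<in>space (M \<Otimes>\<^sub>M M). w p \<le> B"
      then obtain B where B: "\<forall>p\<in>space (M \<Otimes>\<^sub>M M). w p \<le> B" ..
      have le: "u i p \<le> w p" if "p \<in> space (M \<Otimes>\<^sub>M M)" for i p
        using seq(4)[OF that] by (intro incseq_le[of "\<lambda>i. u i p"]) (use seq(3) in \<open>auto simp: incseq_def le_fun_def simp del: split_paired_All\<close>)
      have b: "\<bar>u i p\<bar> \<le> B" if "p \<in> space (M \<Otimes>\<^sub>M M)" for i p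
        using le[OF that, of i] B that seq(2)[of i p] by fastforce
      have "sections_separable (u i)" for i using seq(5)[of i] abs_le_D1[OF b[of _ i]] by blast
      then show "sections_separable w"
        by (rule sections_separable_lim[where u=u and B=B]) (fact seq(1) seq(4) b \<open>w \<in> borel_measurable (M \<Otimes>\<^sub>M M)\<close>)+
    qed
  qed
  moreover have "w p \<le> 1" if "p \<in> space (M \<Otimes>\<^sub>M M)" for p
    using that W_le_1 by (auto simp: w_def space_pair_measure)
  ultimately have "sections_separable w" by blast
  then obtain G :: "nat \<Rightarrow> 'a \<Rightarrow> real" where G: "\<And>n. integrable M (G n)" "\<And>x e. x \<in> space M \<Longrightarrow> e > 0 \<Longrightarrow> \<exists>n. (\<integral>z. \<bar>w (x, z) - G n z\<bar> \<partial>M) < e"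
    by (rule sections_separableE) (rule that)
  have w: "(\<integral>z. \<bar>w (x, z) - G n z\<bar> \<partial>M) = (\<integral>z. \<bar>W x z - G n z\<bar> \<partial>M)" if "x \<in> space M" for x n
    using that W_nonneg by (intro Bochner_Integration.integral_cong) (auto simp: w_def max_def)
  obtain x0 where x0: "x0 \<in> space M" using not_empty by auto
  define near where "near k x \<longleftrightarrow> x \<in> space M \<and>
     (\<integral>z. \<bar>W x z - G (fst (prod_decode k)) z\<bar> \<partial>M) < inverse (real (Suc (snd (prod_decode k))))" for k x
  define q where "q k = (if \<exists>x. near k x then (SOME x. near k x) else x0)" for k
  have q: "near k (q k)" if "near k x" for k x using that someI_ex[of "near k"] by (auto simp: q_def)
  show ?thesis
  proof (rule that[of q])
    show "range q \<subseteq> space M"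
    proof safe
      fix k show "q k \<in> space M"
      proof (cases "\<exists>x. near k x")
        case True
        then have "near k (q k)" using q by blast
        then show ?thesis by (simp add: near_def)
      qed (use x0 in \<open>simp add: q_def\<close>)
    qed
    fix x and e :: real assume x: "x \<in> space M" and e: "e > 0"
    obtain j where j: "inverse (real (Suc j)) < e / 2" using reals_Archimedean[of "e / 2"] e by auto
    obtain n where n: "(\<integral>z. \<bar>w (x, z) - G n z\<bar> \<partial>M) < inverse (real (Suc j))" using G(2)[OF x, of "inverse (real (Suc j))"] by auto
    define k where "k = prod_encode (n, j)"
    have "near k x" using n x by (simp add: near_def k_def w)
    then have qk: "q k \<in> space M" "(\<integral>z. \<bar>W (q k) z - G n z\<bar> \<partial>M) < inverse (real (Suc j))"
      using q[of k x] by (auto simp: near_def k_def)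
    have i: "integrable M (W x)" "integrable M (W (q k))" using x qk by (auto intro: integrable_section)
    have "graphon_dist M W x (q k) \<le> (\<integral>z. \<bar>W x z - G n z\<bar> + \<bar>W (q k) z - G n z\<bar> \<partial>M)"
      unfolding graphon_dist_def using i G(1) by (intro integral_mono) auto
    also have "\<dots> = (\<integral>z. \<bar>W x z - G n z\<bar> \<partial>M) + (\<integral>z. \<bar>W (q k) z - G n z\<bar> \<partial>M)"
      using i G(1) by (intro Bochner_Integration.integral_add) auto
    also have "\<dots> < e" using n qk(2) j w[OF x] by simp
    finally show "\<exists>i. graphon_dist M W x (q i) < e" by blast
  qed
qed

subsection \<open>A metric representation of a graphon\<close>

context kernel begin

lemma graphon_dist_sym: "graphon_dist M W x y = graphon_dist M W y x"
  by (simp add: graphon_dist_def abs_minus_commute)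

lemma graphon_dist_nonneg: "0 \<le> graphon_dist M W x y"
  by (simp add: graphon_dist_def)

lemma integrable_section_diff:
  "x \<in> space M \<Longrightarrow> y \<in> space M \<Longrightarrow> integrable M (\<lambda>z. \<bar>W x z - W y z\<bar>)"
  by (auto intro!: integrable_section)

lemma graphon_dist_triangle:
  assumes "x \<in> space M" "y \<in> space M" "z \<in> space M"
  shows "graphon_dist M W x z \<le> graphon_dist M W x y + graphon_dist M W y z"
proof -
  have "graphon_dist M W x z \<le> (\<integral>w. \<bar>W x w - W y w\<bar> + \<bar>W y w - W z w\<bar> \<partial>M)"
    unfolding graphon_dist_def using assms
    by (intro integral_mono Bochner_Integration.integrable_add integrable_section_diff) auto
  also have "\<dots> = graphon_dist M W x y + graphon_dist M W y z"
    unfolding graphon_dist_def using assms by (intro Bochner_Integration.integral_add integrable_section_diff)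
  finally show ?thesis .
qed

lemma graphon_dist_le_1:
  assumes "x \<in> space M" "y \<in> space M" shows "graphon_dist M W x y \<le> 1"
  unfolding graphon_dist_def
  by (intro integral_le_const integrable_section_diff AE_I2 W_diff_bound assms)

lemma graphon_dist_measurable [measurable (raw)]:
  assumes [measurable]: "f \<in> N \<rightarrow>\<^sub>M M" "g \<in> N \<rightarrow>\<^sub>M M"
  shows "(\<lambda>x. graphon_dist M W (f x) (g x)) \<in> borel_measurable N"
  unfolding graphon_dist_def by measurable

end

locale dense_kernel = kernel M W for M :: "'a measure" and W +
  fixes q :: "nat \<Rightarrow> 'a"
  assumes q_space [simp]: "q i \<in> space M"
    and q_dense: "x \<in> space M \<Longrightarrow> e > 0 \<Longrightarrow> \<exists>i. graphon_dist M W x (q i) < e"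
begin

text \<open>The Kuratowski embedding of the nodes into the Banach space of bounded sequences; it is an
  isometry for the distance of the graphon, and its target is complete.\<close>

definition emb :: "'a \<Rightarrow> nat discrete \<Rightarrow>\<^sub>C real" where
  "emb x = Bcontfun (\<lambda>i. graphon_dist M W x (q (of_discrete i)))"

lemma emb_apply:
  assumes "x \<in> space M" shows "apply_bcontfun (emb x) i = graphon_dist M W x (q (of_discrete i))"
proof -
  have "(\<lambda>i :: nat discrete. graphon_dist M W x (q (of_discrete i))) \<in> bcontfun"
    unfolding bcontfun_def bounded_iff using assms graphon_dist_le_1 graphon_dist_nonneg
    by (auto intro!: exI[of _ 1] simp: continuous_on_open_vimage open_discrete)
  then show ?thesis unfolding emb_def by (simp add: Bcontfun_inverse)
qed

text \<open>One inequality is the triangle inequality in each coordinate; for the other, the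
  coordinate of some \<open>q i\<close> close to \<open>y\<close> nearly realises the
  distance.\<close>

lemma dist_emb:
  assumes "x \<in> space M" "y \<in> space M" shows "dist (emb x) (emb y) = graphon_dist M W x y"
proof (rule antisym)
  show "dist (emb x) (emb y) \<le> graphon_dist M W x y"
  proof (rule dist_bound)
    fix i
    show "dist (emb x i) (emb y i) \<le> graphon_dist M W x y"
      using graphon_dist_triangle[OF assms q_space, of "of_discrete i"]
        graphon_dist_triangle[OF assms(2,1) q_space, of "of_discrete i"]
        graphon_dist_sym[of x y] by (simp add: emb_apply assms dist_real_def abs_le_iff)
  qed
  show "graphon_dist M W x y \<le> dist (emb x) (emb y)"
  proof (rule field_le_epsilon)
    fix e :: real assume "e > 0"
    then obtain i where i: "graphon_dist M W y (q i) < e / 2" using q_dense[OF assms(2), of "e / 2"] by auto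
    have "graphon_dist M W x y \<le> graphon_dist M W x (q i) + graphon_dist M W (q i) y"
      using assms by (intro graphon_dist_triangle) auto
    also have "\<dots> = (emb x (discrete i) - emb y (discrete i)) + 2 * graphon_dist M W y (q i)"
      using assms by (simp add: emb_apply discrete_inverse graphon_dist_sym[of "q i"])
    also have "emb x (discrete i) - emb y (discrete i) \<le> dist (emb x) (emb y)"
      using dist_bounded[of "emb x" "discrete i" "emb y"] by (simp add: dist_real_def)
    finally show "graphon_dist M W x y \<le> dist (emb x) (emb y) + e" using i by simp
  qed
qed

text \<open>The sequence space is not separable, so an open set need not be a countable union of
  balls. To catch the embedded nodes in it, countably many balls centred at the
  \<open>emb (q i)\<close> suffice.\<close>

lemma emb_measurable [measurable]: "emb \<in> borel_measurable M"
proof (rule borel_measurableI)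
  fix X :: "(nat discrete \<Rightarrow>\<^sub>C real) set" assume X: "open X"
  let ?I = "{(i, k). ball (emb (q i)) (inverse (real (Suc k))) \<subseteq> X}"
  have "emb -` X \<inter> space M = (\<Union>(i, k)\<in>?I. {x \<in> space M. graphon_dist M W x (q i) < inverse (real (Suc k))})"
  proof (intro equalityI subsetI)
    fix x assume x: "x \<in> emb -` X \<inter> space M"
    then obtain e where e: "e > 0" "ball (emb x) e \<subseteq> X" using X by (auto simp: open_contains_ball)
    obtain k where k: "inverse (real (Suc k)) < e / 2" using reals_Archimedean[of "e / 2"] e by auto
    obtain i where i: "graphon_dist M W x (q i) < inverse (real (Suc k))" using q_dense[of x "inverse (real (Suc k))"] x by auto
    have "ball (emb (q i)) (inverse (real (Suc k))) \<subseteq> ball (emb x) e"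
    proof
      fix z assume "z \<in> ball (emb (q i)) (inverse (real (Suc k)))"
      then show "z \<in> ball (emb x) e"
        using i k dist_emb[of x "q i"] x dist_triangle[of "emb x" z "emb (q i)"] by simp
    qed
    with e i x show "x \<in> (\<Union>(i, k)\<in>?I. {x \<in> space M. graphon_dist M W x (q i) < inverse (real (Suc k))})" by blast
  next
    fix x assume "x \<in> (\<Union>(i, k)\<in>?I. {x \<in> space M. graphon_dist M W x (q i) < inverse (real (Suc k))})"
    then obtain i k where "x \<in> space M" "graphon_dist M W x (q i) < inverse (real (Suc k))" "ball (emb (q i)) (inverse (real (Suc k))) \<subseteq> X"
      by auto
    then show "x \<in> emb -` X \<inter> space M" using dist_emb[of "q i" x] by (auto simp: graphon_dist_sym subset_iff)
  qed
  also have "\<dots> \<in> sets M"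
  proof (rule sets.countable_UN')
    have "{x \<in> space M. graphon_dist M W x (q i) < c} \<in> sets M" for i c by measurable
    then show "(\<lambda>(i, k). {x \<in> space M. graphon_dist M W x (q i) < inverse (real (Suc k))}) ` ?I \<subseteq> sets M"
      by auto
  qed simp
  finally show "emb -` X \<inter> space M \<in> sets M" .
qed

section \<open>The law of the embedded nodes and its support\<close>

definition law :: "(nat discrete \<Rightarrow>\<^sub>C real) measure" where "law = distr M borel emb"

lemma sets_law [measurable_cong]: "sets law = sets borel" and space_law: "space law = UNIV"
  by (simp_all add: law_def)

sublocale law: prob_space law
  unfolding law_def by (rule prob_space_distr) measurable

definition supp :: "(nat discrete \<Rightarrow>\<^sub>C real) set" where
  "supp = {f. \<forall>e>0. 0 < measure law (ball f e)}"

lemma measure_law_mono: "A \<subseteq> B \<Longrightarrow> B \<in> sets borel \<Longrightarrow> measure law A \<le> measure law B"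
  by (rule law.finite_measure_mono) (auto simp: sets_law)

lemma supp_closed: "closed supp"
  unfolding closed_sequential_limits
proof (intro allI impI)
  fix u l assume ul: "(\<forall>n. u n \<in> supp) \<and> u \<longlonglongrightarrow> l"
  show "l \<in> supp"
    unfolding supp_def
  proof safe
    fix e :: real assume "e > 0"
    then obtain n where n: "dist (u n) l < e / 2"
      using ul unfolding lim_sequentially by (meson half_gt_zero order_refl)
    have "ball (u n) (e / 2) \<subseteq> ball l e"
    proof
      fix z assume "z \<in> ball (u n) (e / 2)"
      then show "z \<in> ball l e"
        using n dist_triangle3[of l z "u n"] by (simp only: mem_ball)
    qed
    moreover have "0 < measure law (ball (u n) (e / 2))" using ul \<open>e > 0\<close> by (auto simp: supp_def)
    ultimately show "0 < measure law (ball l e)"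
      by (meson borel_open less_le_trans measure_law_mono open_ball)
  qed
qed

text \<open>In an inseparable space the complement of the support may fail to be a countable union
  of null balls. Discarding the null balls centred at the \<open>emb (q i)\<close> suffices, as they
  catch every embedded node outside the support.\<close>

lemma AE_supp: "AE x in M. emb x \<in> supp"
proof -
  define nul where "nul i k \<longleftrightarrow> measure law (ball (emb (q i)) (inverse (real (Suc k)))) = 0" for i k
  have "AE x in M. \<forall>i k. nul i k \<longrightarrow> emb x \<notin> ball (emb (q i)) (inverse (real (Suc k)))"
    unfolding AE_all_countable
  proof (intro allI)
    fix i k
    show "AE x in M. nul i k \<longrightarrow> emb x \<notin> ball (emb (q i)) (inverse (real (Suc k)))"
    proof (cases "nul i k")
      case True
      have b: "ball (emb (q i)) (inverse (real (Suc k))) \<in> sets law" by (simp add: sets_law)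
      have "emeasure law (ball (emb (q i)) (inverse (real (Suc k)))) = 0"
        using True by (simp add: nul_def law.emeasure_eq_measure)
      then have "AE f in law. f \<notin> ball (emb (q i)) (inverse (real (Suc k)))"
        using b by (simp add: AE_iff_null_sets[symmetric] null_setsI del: mem_ball)
      then have "AE x in M. emb x \<notin> ball (emb (q i)) (inverse (real (Suc k)))"
        unfolding law_def by (rule AE_distrD[OF emb_measurable])
      then show ?thesis by eventually_elim simp
    qed simp
  qed
  then show ?thesis
  proof (rule AE_mp, intro AE_I2 impI)
    fix x assume x: "x \<in> space M" and *: "\<forall>i k. nul i k \<longrightarrow> emb x \<notin> ball (emb (q i)) (inverse (real (Suc k)))"
    show "emb x \<in> supp"
      unfolding supp_def
    proof safe
      fix e :: real assume e: "e > 0"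
      obtain k where k: "inverse (real (Suc k)) < e / 2" using reals_Archimedean[of "e / 2"] e by auto
      obtain i where i: "graphon_dist M W x (q i) < inverse (real (Suc k))" using q_dense[of x "inverse (real (Suc k))"] x by auto
      then have "emb x \<in> ball (emb (q i)) (inverse (real (Suc k)))" using x dist_emb[of "q i" x] by (simp add: graphon_dist_sym)
      then have "\<not> nul i k" using * by blast
      then have "0 < measure law (ball (emb (q i)) (inverse (real (Suc k))))"
        by (simp add: nul_def zero_less_measure_iff)
      also have "\<dots> \<le> measure law (ball (emb x) e)"
      proof (rule measure_law_mono)
        show "ball (emb (q i)) (inverse (real (Suc k))) \<subseteq> ball (emb x) e"
        proof
          fix z assume "z \<in> ball (emb (q i)) (inverse (real (Suc k)))"
          then show "z \<in> ball (emb x) e"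
            using i k dist_emb[of x "q i"] x dist_triangle[of "emb x" z "emb (q i)"] by simp
        qed
      qed simp
      finally show "0 < measure law (ball (emb x) e)" .
    qed
  qed
qed

lemma AE_law_supp: "AE f in law. f \<in> supp"
  unfolding law_def using AE_supp supp_closed by (subst AE_distr_iff) auto

text \<open>A ball around a point of the support has positive mass, so it cannot miss the image of a
  set of full measure.\<close>

lemma supp_approx:
  assumes X: "AE x in M. x \<in> X" and f: "f \<in> supp" "e > 0"
  obtains x where "x \<in> space M" "x \<in> X" "dist (emb x) f < e"
proof -
  have "\<not> (AE x in M. emb x \<notin> ball f e)"
  proof
    assume "AE x in M. emb x \<notin> ball f e"
    moreover have "{g \<in> space borel. g \<notin> ball f e} \<in> sets borel"
      using borel_comp[OF borel_open[OF open_ball[of f e]]] by (simp add: Compl_eq del: mem_ball)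
    ultimately have "AE g in law. g \<notin> ball f e" unfolding law_def by (simp add: AE_distr_iff del: mem_ball)
    then have "emeasure law (ball f e) = 0" 
      by (subst (asm) AE_iff_null_sets[symmetric]) (auto simp: sets_law)
    then have "measure law (ball f e) = 0" by (simp only: measure_def enn2real_0)
    moreover have "0 < measure law (ball f e)" using f by (simp add: supp_def)
    ultimately show False by simp
  qed
  then have "\<not> (\<forall>x\<in>space M. x \<in> X \<longrightarrow> emb x \<notin> ball f e)"
    using X by (auto intro: AE_mp)
  then show ?thesis using that by (auto simp: dist_commute)
qed

text \<open>Taking the least index makes the choice of a node near \<open>f\<close> measurable, with
  countably many values. Where no member of \<open>s\<close> is close enough, the value is still a
  member of \<open>s\<close>.\<close>

definition pick :: "(nat \<Rightarrow> 'a) \<Rightarrow> nat \<Rightarrow> (nat discrete \<Rightarrow>\<^sub>C real) \<Rightarrow> 'a" where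
  "pick s n f = s (LEAST i. dist (emb (s i)) f < (1 / 2) ^ n)"

lemma pick_measurable [measurable]:
  assumes "range s \<subseteq> space M" shows "pick s n \<in> borel \<rightarrow>\<^sub>M M"
proof -
  have [measurable]: "Measurable.pred borel (\<lambda>f. dist (emb (s i)) f < (1 / 2) ^ n)" for i
  proof -
    have "{f. dist (emb (s i)) f < (1 / 2) ^ n} = ball (emb (s i)) ((1 / 2) ^ n)" by auto
    then show ?thesis by (simp add: pred_def)
  qed
  have "(\<lambda>f. LEAST i. dist (emb (s i)) f < (1 / 2) ^ n) \<in> borel \<rightarrow>\<^sub>M count_space UNIV" by measurable
  moreover have "s \<in> count_space UNIV \<rightarrow>\<^sub>M M" using assms by auto
  ultimately show ?thesis unfolding pick_def by (rule measurable_compose)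
qed

lemma pick_space: "range s \<subseteq> space M \<Longrightarrow> pick s n f \<in> space M"
  by (auto simp: pick_def)

lemma pick_close:
  assumes "\<exists>i. dist (emb (s i)) f < (1 / 2) ^ n" shows "dist (emb (pick s n f)) f < (1 / 2) ^ n"
  unfolding pick_def using LeastI_ex[OF assms] .

lemma q_range: "range q \<subseteq> space M" by auto

lemma pick_q_close:
  assumes "y \<in> space M" shows "graphon_dist M W (pick q n (emb y)) y < (1 / 2) ^ n"
proof -
  obtain i where "graphon_dist M W y (q i) < (1 / 2) ^ n" using q_dense[OF assms, of "(1/2)^n"] by auto
  then have "dist (emb (pick q n (emb y))) (emb y) < (1 / 2) ^ n"
    using assms by (intro pick_close exI[of _ i]) (simp add: dist_emb graphon_dist_sym)
  then show ?thesis using assms pick_space[OF q_range] by (simp add: dist_emb)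
qed

lemma summable_half: "summable (\<lambda>n. c * (1 / 2) ^ n :: real)"
  by (intro summable_mult summable_geometric) simp

text \<open>The selected node is within \<open>(1 / 2) ^ n\<close> of \<open>y\<close> for every
  \<open>y\<close>, so by Fubini and symmetry the errors have summable integrals over pairs and tend
  to zero for almost every pair.\<close>

lemma AE_pick_q: "AE x in M. AE y in M. (\<lambda>n. W x (pick q n (emb y))) \<longlonglongrightarrow> W x y"
proof -
  interpret P: pair_prob_space M M by standard
  note [measurable] = pick_measurable[OF q_range]
  define v where "v n = (\<lambda>(x, y). W x (pick q n (emb y)) - W x y)" for n
  have vm[measurable]: "v n \<in> borel_measurable (M \<Otimes>\<^sub>M M)" for n unfolding v_def by measurable
  have b: "\<bar>v n (x, y)\<bar> \<le> 1" if "x \<in> space M" "y \<in> space M" for n x y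
    using W_nonneg[OF that(1) pick_space[OF q_range], of n "emb y"] W_le_1[OF that(1) pick_space[OF q_range], of n "emb y"]
      W_nonneg[OF that] W_le_1[OF that] by (simp add: v_def abs_le_iff)
  have int: "integrable (M \<Otimes>\<^sub>M M) (v n)" for n
    using b by (intro P.integrable_const_bound[where B=1] AE_I2) (auto simp: space_pair_measure)
  have le: "(\<integral>p. \<bar>v n p\<bar> \<partial>(M \<Otimes>\<^sub>M M)) \<le> (1 / 2) ^ n" for n
  proof -
    have i2: "integrable (M \<Otimes>\<^sub>M M) (case_prod (\<lambda>x y. \<bar>v n (x, y)\<bar>))"
      using int[of n] by (simp add: case_prod_beta')
    have "(\<integral>p. \<bar>v n p\<bar> \<partial>(M \<Otimes>\<^sub>M M)) = (\<integral>y. (\<integral>x. \<bar>v n (x, y)\<bar> \<partial>M) \<partial>M)"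
      by (subst P.integral_snd[OF i2]) (simp add: case_prod_beta')
    also have "\<dots> = (\<integral>y. graphon_dist M W (pick q n (emb y)) y \<partial>M)"
      unfolding graphon_dist_def v_def using W_sym pick_space[OF q_range]
      by (intro Bochner_Integration.integral_cong refl) simp
    also have "\<dots> \<le> (1 / 2) ^ n"
    proof (rule integral_le_const)
      show "integrable M (\<lambda>y. graphon_dist M W (pick q n (emb y)) y)"
        using graphon_dist_nonneg graphon_dist_le_1 pick_space[OF q_range]
        by (intro integrable_const_bound[where B=1] AE_I2) auto
      show "AE y in M. graphon_dist M W (pick q n (emb y)) y \<le> (1 / 2) ^ n"
        using pick_q_close by (intro AE_I2 less_imp_le)
    qed
    finally show ?thesis .
  qed
  have "AE p in M \<Otimes>\<^sub>M M. summable (\<lambda>n. \<bar>v n p\<bar>)"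
    using int le by (intro AE_summable summable_comparison_test'[OF summable_half[of 1], where N=0]) auto
  then have "AE p in M \<Otimes>\<^sub>M M. (\<lambda>n. W (fst p) (pick q n (emb (snd p)))) \<longlonglongrightarrow> W (fst p) (snd p)"
  proof eventually_elim
    case (elim p)
    then have "(\<lambda>n. \<bar>v n p\<bar>) \<longlonglongrightarrow> 0" by (rule summable_LIMSEQ_zero)
    then have "(\<lambda>n. v n p) \<longlonglongrightarrow> 0" by (simp add: tendsto_rabs_zero_iff)
    from tendsto_add[OF this tendsto_const[of "W (fst p) (snd p)"]] show ?case
      by (simp add: v_def case_prod_beta')
  qed
  from P.AE_pair[OF this] show ?thesis by simp
qed

text \<open>The nodes whose rows can be recovered almost everywhere from the embedding of the second
  argument.\<close>

definition good :: "'a set" where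
  "good = {x. emb x \<in> supp \<and> (AE y in M. (\<lambda>n. W x (pick q n (emb y))) \<longlonglongrightarrow> W x y)}"

lemma AE_good: "AE x in M. x \<in> good"
  using AE_supp AE_pick_q by eventually_elim (simp add: good_def)

lemma good_dense:
  obtains s :: "nat \<Rightarrow> 'a" where "range s \<subseteq> space M \<inter> good"
    "\<And>f e. f \<in> supp \<Longrightarrow> e > 0 \<Longrightarrow> \<exists>i. dist (emb (s i)) f < e"
proof -
  have "\<exists>x\<in>space M. x \<in> good"
  proof (rule ccontr)
    assume "\<not> ?thesis"
    then have "AE x in M. False" using AE_good by (auto elim!: AE_mp)
    then show False by simp
  qed
  then obtain x0 where x0: "x0 \<in> space M" "x0 \<in> good" by blast
  define near where "near k x \<longleftrightarrow> x \<in> space M \<and> x \<in> good \<and>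
     dist (emb x) (emb (q (fst (prod_decode k)))) < inverse (real (Suc (snd (prod_decode k))))" for k x
  define s where "s k = (if \<exists>x. near k x then (SOME x. near k x) else x0)" for k
  have s: "near k (s k)" if "near k x" for k x using that someI_ex[of "near k"] by (auto simp: s_def)
  show ?thesis
  proof (rule that[of s])
    have "s k \<in> space M \<inter> good" for k
    proof (cases "\<exists>x. near k x")
      case True
      then have "near k (s k)" using s by blast
      then show ?thesis by (simp add: near_def)
    qed (use x0 in \<open>simp add: s_def\<close>)
    then show "range s \<subseteq> space M \<inter> good" by blast
    fix f and e :: real assume f: "f \<in> supp" and e: "e > 0"
    obtain x where x: "x \<in> space M" "x \<in> good" "dist (emb x) f < e / 4"
      using supp_approx[OF AE_good f, of "e / 4"] e by auto
    obtain j where j: "inverse (real (Suc j)) < e / 4" using reals_Archimedean[of "e / 4"] e by auto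
    obtain i where i: "graphon_dist M W x (q i) < inverse (real (Suc j))" using q_dense[of x "inverse (real (Suc j))"] x by auto
    define k where "k = prod_encode (i, j)"
    have "near k x" using x i by (simp add: near_def k_def dist_emb)
    then have "near k (s k)" by (rule s)
    then have sk: "dist (emb (s k)) (emb (q i)) < inverse (real (Suc j))" by (simp add: near_def k_def)
    have "dist (emb x) (emb (q i)) < e / 4" using x i j by (simp add: dist_emb)
    then have "dist (emb (s k)) f < e"
      using e sk j x(3) dist_triangle[of "emb (s k)" f "emb x"] dist_triangle[of "emb (s k)" "emb x" "emb (q i)"]
      by (simp add: dist_commute)
    then show "\<exists>i. dist (emb (s i)) f < e" by blast
  qed
qed

end

section \<open>A kernel on the support\<close>

locale good_kernel = dense_kernel M W q for M :: "'a measure" and W q +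
  fixes s :: "nat \<Rightarrow> 'a"
  assumes s_range: "range s \<subseteq> space M \<inter> good"
    and s_dense: "f \<in> supp \<Longrightarrow> e > 0 \<Longrightarrow> \<exists>i. dist (emb (s i)) f < e"
begin

lemma s_space: "range s \<subseteq> space M" using s_range by auto

abbreviation "t \<equiv> pick s"

lemma t_space: "t m f \<in> space M" by (rule pick_space[OF s_space])

lemma t_good: "t m f \<in> good" using s_range by (auto simp: pick_def)

lemma t_close: "f \<in> supp \<Longrightarrow> dist (emb (t m f)) f < (1 / 2) ^ m"
  by (rule pick_close[OF s_dense]) auto

text \<open>Since \<open>W x\<close> is almost everywhere the limit of the step functions
  \<open>y \<mapsto> W x (pick q n (emb y))\<close>, it factors through \<open>emb\<close>; the outer limit extends this
  to the completion.\<close>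

definition V :: "(nat discrete \<Rightarrow>\<^sub>C real) \<Rightarrow> (nat discrete \<Rightarrow>\<^sub>C real) \<Rightarrow> real" where
  "V f g = lim (\<lambda>m. lim (\<lambda>n. W (t m f) (pick q n g)))"

lemma V_measurable: "case_prod V \<in> borel_measurable (borel \<Otimes>\<^sub>M borel)"
proof -
  note [measurable] = pick_measurable[OF q_range] pick_measurable[OF s_space]
  show ?thesis unfolding V_def by measurable
qed

lemma V_measurable_comp [measurable (raw)]:
  "f \<in> N \<rightarrow>\<^sub>M borel \<Longrightarrow> g \<in> N \<rightarrow>\<^sub>M borel \<Longrightarrow> (\<lambda>x. V (f x) (g x)) \<in> borel_measurable N"
  using measurable_compose[OF measurable_Pair V_measurable] by simp

text \<open>The inner limit recovers the rows of the good nodes \<open>t m f\<close>; these rows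
  move by geometrically small L^1 steps, so the outer limit exists almost everywhere.\<close>

lemma AE_V:
  assumes f: "f \<in> supp"
  shows "AE y in M. (\<lambda>m. W (t m f) y) \<longlonglongrightarrow> V f (emb y)"
proof -
  have inner: "AE y in M. \<forall>m. lim (\<lambda>n. W (t m f) (pick q n (emb y))) = W (t m f) y"
    unfolding AE_all_countable
  proof
    fix m
    have "AE y in M. (\<lambda>n. W (t m f) (pick q n (emb y))) \<longlonglongrightarrow> W (t m f) y"
      using t_good[of m f] by (simp add: good_def)
    then show "AE y in M. lim (\<lambda>n. W (t m f) (pick q n (emb y))) = W (t m f) y"
      by eventually_elim (rule limI)
  qed
  have step: "(\<integral>y. \<bar>W (t (Suc m) f) y - W (t m f) y\<bar> \<partial>M) \<le> 2 * (1 / 2) ^ m" for m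
  proof -
    have "(\<integral>y. \<bar>W (t (Suc m) f) y - W (t m f) y\<bar> \<partial>M) = dist (emb (t (Suc m) f)) (emb (t m f))"
      by (simp add: dist_emb t_space graphon_dist_def)
    also have "\<dots> \<le> dist (emb (t (Suc m) f)) f + dist (emb (t m f)) f" by (rule dist_triangle2)
    also have "\<dots> \<le> (1 / 2) ^ Suc m + (1 / 2) ^ m"
      using t_close[OF f] by (intro add_mono less_imp_le)
    also have "\<dots> \<le> 2 * (1 / 2) ^ m" by simp
    finally show ?thesis .
  qed
  have "AE y in M. convergent (\<lambda>m. W (t m f) y)"
    using step t_space
    by (intro AE_convergent integrable_section summable_comparison_test'[OF summable_half[of 2], where N=0]) auto
  with inner show ?thesis
    by eventually_elim (simp add: V_def convergent_LIMSEQ_iff)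
qed

lemma V_bounds:
  assumes "f \<in> supp" shows "AE y in M. 0 \<le> V f (emb y) \<and> V f (emb y) \<le> 1"
  using AE_V[OF assms] AE_space
proof eventually_elim
  case (elim y)
  have "\<forall>m. 0 \<le> W (t m f) y \<and> W (t m f) y \<le> 1" using elim(2) W_nonneg W_le_1 t_space by blast
  then show ?case using LIMSEQ_le_const[OF elim(1), of 0] LIMSEQ_le_const2[OF elim(1), of 1] by blast
qed

text \<open>Both sides are limits of the distances between the approximating nodes
  \<open>t m f\<close> and \<open>t m g\<close>.\<close>

lemma V_dist:
  assumes f: "f \<in> supp" and g: "g \<in> supp"
  shows "(\<integral>y. \<bar>V f (emb y) - V g (emb y)\<bar> \<partial>M) = dist f g"
proof -
  have "(\<lambda>m. \<integral>y. \<bar>W (t m f) y - W (t m g) y\<bar> \<partial>M) \<longlonglongrightarrow> (\<integral>y. \<bar>V f (emb y) - V g (emb y)\<bar> \<partial>M)"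
  proof (rule integral_dominated_convergence[where w="\<lambda>_. 1"])
    show "AE y in M. (\<lambda>m. \<bar>W (t m f) y - W (t m g) y\<bar>) \<longlonglongrightarrow> \<bar>V f (emb y) - V g (emb y)\<bar>"
      using AE_V[OF f] AE_V[OF g] by eventually_elim (intro tendsto_intros)
    show "AE y in M. norm \<bar>W (t m f) y - W (t m g) y\<bar> \<le> 1" for m
      using W_diff_bound t_space by (intro AE_I2) simp
  qed (use t_space in measurable)
  then have "(\<lambda>m. dist (emb (t m f)) (emb (t m g))) \<longlonglongrightarrow> (\<integral>y. \<bar>V f (emb y) - V g (emb y)\<bar> \<partial>M)"
    by (simp add: dist_emb t_space graphon_dist_def)
  moreover have "(\<lambda>m. emb (t m f)) \<longlonglongrightarrow> f" if "f \<in> supp" for f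
  proof (rule metric_tendsto_imp_tendsto)
    show "(\<lambda>m. (1 / 2) ^ m :: real) \<longlonglongrightarrow> 0" by (rule LIMSEQ_realpow_zero) auto
    show "\<forall>\<^sub>F m in sequentially. dist (emb (t m f)) f \<le> dist ((1 / 2) ^ m :: real) 0"
      using t_close[OF that] by (intro always_eventually) (simp add: less_imp_le)
  qed
  then have "(\<lambda>m. dist (emb (t m f)) (emb (t m g))) \<longlonglongrightarrow> dist f g"
    using f g by (intro tendsto_dist)
  ultimately show ?thesis by (rule LIMSEQ_unique)
qed

text \<open>The rows of \<open>t m (emb x)\<close> converge in mean to both sides.\<close>

lemma V_emb:
  assumes "x \<in> space M" "emb x \<in> supp"
  shows "AE y in M. V (emb x) (emb y) = W x y"
proof -
  let ?f = "emb x"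
  have "(\<lambda>m. \<integral>y. \<bar>W (t m ?f) y - W x y\<bar> \<partial>M) \<longlonglongrightarrow> (\<integral>y. \<bar>V ?f (emb y) - W x y\<bar> \<partial>M)"
  proof (rule integral_dominated_convergence[where w="\<lambda>_. 1"])
    show "AE y in M. (\<lambda>m. \<bar>W (t m ?f) y - W x y\<bar>) \<longlonglongrightarrow> \<bar>V ?f (emb y) - W x y\<bar>"
      using AE_V[OF assms(2)] by eventually_elim (intro tendsto_intros)
    show "AE y in M. norm \<bar>W (t m ?f) y - W x y\<bar> \<le> 1" for m
      using W_diff_bound t_space assms(1) by (intro AE_I2) simp
  qed (use t_space assms in measurable)
  moreover have "(\<lambda>m. \<integral>y. \<bar>W (t m ?f) y - W x y\<bar> \<partial>M) \<longlonglongrightarrow> 0"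
  proof (rule tendsto_sandwich)
    show "\<forall>\<^sub>F m in sequentially. 0 \<le> (\<integral>y. \<bar>W (t m ?f) y - W x y\<bar> \<partial>M)" by simp
    have "(\<integral>y. \<bar>W (t m ?f) y - W x y\<bar> \<partial>M) \<le> (1 / 2) ^ m" for m
      using t_close[OF assms(2), of m] dist_emb[OF t_space assms(1), of m ?f] by (simp add: graphon_dist_def)
    then show "\<forall>\<^sub>F m in sequentially. (\<integral>y. \<bar>W (t m ?f) y - W x y\<bar> \<partial>M) \<le> (1 / 2) ^ m" by simp
    show "(\<lambda>m. (1 / 2) ^ m :: real) \<longlonglongrightarrow> 0" by (rule LIMSEQ_realpow_zero) auto
  qed simp
  ultimately have z: "(\<integral>y. \<bar>V ?f (emb y) - W x y\<bar> \<partial>M) = 0" by (rule LIMSEQ_unique)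
  have "AE y in M. norm (\<bar>V ?f (emb y) - W x y\<bar>) \<le> 1"
    using V_bounds[OF assms(2)] AE_space
  proof eventually_elim
    case (elim y)
    then show ?case using W_nonneg[OF assms(1) elim(2)] W_le_1[OF assms(1) elim(2)] by (simp add: abs_le_iff)
  qed
  then have "integrable M (\<lambda>y. \<bar>V ?f (emb y) - W x y\<bar>)"
    by (rule integrable_const_bound) (use assms in measurable)
  then have "AE y in M. \<bar>V ?f (emb y) - W x y\<bar> = 0" using z by (subst (asm) integral_nonneg_eq_0_iff_AE) auto
  then show ?thesis by eventually_elim simp
qed

text \<open>\<open>V\<close> is symmetric only almost everywhere. Off the null set \<open>exc\<close> of nodes whose row
  and column disagree it is symmetrised, while on \<open>exc\<close> the row wins, so that no section
  changes on a set of positive measure.\<close>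

definition exc :: "(nat discrete \<Rightarrow>\<^sub>C real) set" where
  "exc = {f. \<not> (AE g in law. V f g = V g f)}"

definition U :: "(nat discrete \<Rightarrow>\<^sub>C real) \<Rightarrow> (nat discrete \<Rightarrow>\<^sub>C real) \<Rightarrow> real" where
  "U f g = max 0 (min 1
     (if f \<in> exc then (if g \<in> exc then 0 else V f g)
      else (if g \<in> exc then V g f else max (V f g) (V g f))))"

lemma exc_sets [measurable]: "exc \<in> sets borel"
proof -
  have [measurable]: "Measurable.pred (law \<Otimes>\<^sub>M law) (\<lambda>p. V (fst p) (snd p) = V (snd p) (fst p))"
    by measurable
  define D where "D = {p \<in> space (law \<Otimes>\<^sub>M law). V (fst p) (snd p) \<noteq> V (snd p) (fst p)}"
  have D: "D \<in> sets (law \<Otimes>\<^sub>M law)" unfolding D_def by measurable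
  \<comment> \<open>In this form measurability follows from Fubini: the measure of the slice of
    \<open>D\<close> at \<open>f\<close> depends measurably on \<open>f\<close>.\<close>
  have "exc = {f \<in> space law. emeasure law (Pair f -` D) \<noteq> 0}"
  proof -
    have "(AE g in law. V f g = V g f) \<longleftrightarrow> emeasure law (Pair f -` D) = 0" for f
    proof -
      have "Pair f -` D = {g \<in> space law. \<not> V f g = V g f}"
        by (auto simp: D_def space_pair_measure space_law)
      then show ?thesis using sets_Pair1[OF D, of f] by (intro AE_iff_measurable) auto
    qed
    then show ?thesis by (auto simp: exc_def space_law)
  qed
  moreover have "{f \<in> space law. emeasure law (Pair f -` D) \<noteq> 0} \<in> sets law"
    using law.measurable_emeasure_Pair[OF D] by measurable
  ultimately show ?thesis by (simp add: sets_law)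
qed

text \<open>On embedded nodes \<open>V\<close> is \<open>W\<close> for almost all pairs, in either
  order of the arguments, and \<open>W\<close> is symmetric.\<close>

lemma AE_not_exc: "AE f in law. f \<notin> exc"
proof -
  interpret P: pair_prob_space M M by standard
  have 1: "AE x in M. AE y in M. V (emb x) (emb y) = W x y"
    using AE_supp AE_space by eventually_elim (rule V_emb)
  have m: "{p \<in> space (M \<Otimes>\<^sub>M M). V (emb (fst p)) (emb (snd p)) = W (fst p) (snd p)} \<in> sets (M \<Otimes>\<^sub>M M)"
    by measurable
  have 2: "AE x in M. AE y in M. V (emb y) (emb x) = W y x"
    using P.AE_commute[of "\<lambda>x y. V (emb x) (emb y) = W x y"] m 1 by simp
  have "AE x in M. AE y in M. V (emb x) (emb y) = V (emb y) (emb x)"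
    using 1 2 AE_space
  proof eventually_elim
    case (elim x)
    from elim(1,2) AE_space show ?case by eventually_elim (use W_sym elim(3) in simp)
  qed
  then have "AE x in M. AE g in law. V (emb x) g = V g (emb x)"
  proof eventually_elim
    case (elim x)
    then show ?case unfolding law_def by (subst AE_distr_iff) auto
  qed
  then have "AE x in M. emb x \<notin> exc" by (simp add: exc_def)
  then show ?thesis unfolding law_def by (subst AE_distr_iff) auto
qed

text \<open>For \<open>f\<close> in \<open>exc\<close> its own row is used off that null set;
  otherwise \<open>V\<close> is symmetric along the row up to a null set and the maximum changes
  nothing. Clipping is harmless because of \<open>V_bounds\<close>.\<close>

lemma U_eq_V:
  assumes "f \<in> supp" shows "AE y in M. U f (emb y) = V f (emb y)"
proof -
  have ne: "AE y in M. emb y \<notin> exc" using AE_not_exc unfolding law_def by (rule AE_distrD[OF emb_measurable])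
  show ?thesis
  proof (cases "f \<in> exc")
    case True
    from V_bounds[OF assms] ne show ?thesis by eventually_elim (simp add: U_def True)
  next
    case False
    then have "AE g in law. V f g = V g f" by (simp add: exc_def)
    then have "AE y in M. V f (emb y) = V (emb y) f" unfolding law_def by (rule AE_distrD[OF emb_measurable])
    with V_bounds[OF assms] ne show ?thesis by eventually_elim (simp add: U_def False)
  qed
qed

lemma kernel_U: "kernel law U"
proof
  show "case_prod U \<in> borel_measurable (law \<Otimes>\<^sub>M law)"
    unfolding U_def by measurable
qed (auto simp: U_def max.commute)

lemma dist_U:
  assumes "f \<in> supp" "g \<in> supp" shows "graphon_dist law U f g = dist f g"
proof -
  interpret U: kernel law U by (rule kernel_U)
  have "graphon_dist law U f g = (\<integral>y. \<bar>U f (emb y) - U g (emb y)\<bar> \<partial>M)"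
    unfolding graphon_dist_def
    by (subst (1) law_def, rule integral_distr) (auto simp: law_def[symmetric] space_law intro!: U.W_comp_measurable)
  also have "\<dots> = (\<integral>y. \<bar>V f (emb y) - V g (emb y)\<bar> \<partial>M)"
  proof (rule integral_cong_AE)
    show "AE y in M. \<bar>U f (emb y) - U g (emb y)\<bar> = \<bar>V f (emb y) - V g (emb y)\<bar>"
      using U_eq_V[OF assms(1)] U_eq_V[OF assms(2)] by eventually_elim simp
    have "emb \<in> M \<rightarrow>\<^sub>M law" by measurable
    then show "(\<lambda>y. \<bar>U f (emb y) - U g (emb y)\<bar>) \<in> borel_measurable M"
      by (intro borel_measurable_abs borel_measurable_diff U.W_comp_measurable) (auto simp: space_law)
  qed measurable
  also have "\<dots> = dist f g" by (rule V_dist[OF assms])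
  finally show ?thesis .
qed

lemma metric_kernel_U: "metric_kernel law U supp (emb \<circ> s)"
proof -
  interpret U: kernel law U by (rule kernel_U)
  show ?thesis
  proof
    show "range (emb \<circ> s) \<subseteq> supp" using s_range by (auto simp: good_def)
    show "supp \<subseteq> closure (range (emb \<circ> s))"
      using s_dense by (auto simp: closure_approachable)
    show "0 < measure law (ball f e)" if "f \<in> supp" "0 < e" for f e
      using that by (simp add: supp_def)
  qed (auto simp: sets_law supp_closed AE_law_supp dist_U)
qed

lemma weakly_isomorphic_U: "weakly_isomorphic M W law U"
proof (rule hom_density_transfer[OF kernel_axioms kernel_U, of emb])
  interpret P: pair_prob_space M M by standard
  interpret U: kernel law U by (rule kernel_U)
  show e[measurable]: "emb \<in> M \<rightarrow>\<^sub>M law" by measurable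
  show "distr M law emb = law"
    unfolding law_def by (intro distr_cong) auto
  have "AE x in M. AE y in M. U (emb x) (emb y) = W x y"
    using AE_supp AE_space
  proof eventually_elim
    case (elim x)
    from V_emb[OF elim(2,1)] U_eq_V[OF elim(1)] show ?case by eventually_elim simp
  qed
  moreover have "{p \<in> space (M \<Otimes>\<^sub>M M). U (emb (fst p)) (emb (snd p)) = W (fst p) (snd p)} \<in> sets (M \<Otimes>\<^sub>M M)"
    by measurable
  ultimately show "AE p in M \<Otimes>\<^sub>M M. U (emb (fst p)) (emb (snd p)) = W (fst p) (snd p)"
    by (intro P.AE_pair_measure) simp_all
qed

end

text \<open>This supplies the pure representation whose existence node-transitivity demands; it is
  complete because the support is closed in a Banach space.\<close>

lemma (in kernel) metric_kernel_representation:
  obtains N :: "(nat discrete \<Rightarrow>\<^sub>C real) measure" and U S d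
  where "metric_kernel N U S d" "weakly_isomorphic M W N U"
proof -
  obtain q :: "nat \<Rightarrow> 'a" where q: "range q \<subseteq> space M" "\<And>x e. x \<in> space M \<Longrightarrow> e > 0 \<Longrightarrow> \<exists>i. graphon_dist M W x (q i) < e"
    by (rule dense_sequence) (rule that)
  interpret dense_kernel M W q using q by unfold_locales auto
  obtain s :: "nat \<Rightarrow> 'a" where s: "range s \<subseteq> space M \<inter> good"
    "\<And>f e. f \<in> supp \<Longrightarrow> e > 0 \<Longrightarrow> \<exists>i. dist (emb (s i)) f < e"
    by (rule good_dense) (rule that)
  interpret good_kernel M W q s using s by unfold_locales auto
  show ?thesis by (rule that[OF metric_kernel_U weakly_isomorphic_U])
qed

subsection \<open>Transfer to the real numbers\<close>

text \<open>A point of a separable metric space is determined by the basic balls that contain it,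
  and sets of naturals inject into the reals.\<close>

lemma (in metric_kernel) inj_into_reals: "\<exists>c :: 'b \<Rightarrow> real. inj_on c S"
proof -
  define B where "B x = {n. dist (d (fst (prod_decode n))) x < inverse (real (Suc (snd (prod_decode n))))}" for x
  have "inj_on B S"
  proof (rule inj_onI, rule ccontr)
    fix x y assume xy: "x \<in> S" "y \<in> S" "B x = B y" "x \<noteq> y"
    then have "dist x y / 2 > 0" by simp
    then obtain k where k: "inverse (real (Suc k)) < dist x y / 2" using reals_Archimedean by blast
    obtain i where i: "dist (d i) x < inverse (real (Suc k))"
      using d_dense xy(1) closure_approachable[of x "range d"] by (metis inverse_positive_iff_positive of_nat_0_less_iff rangeE subsetD zero_less_Suc)
    then have "prod_encode (i, k) \<in> B x" by (simp add: B_def)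
    then have "prod_encode (i, k) \<in> B y" by (simp add: xy(3))
    then have "dist (d i) y < inverse (real (Suc k))" by (simp add: B_def)
    with i k dist_triangle3[of x y "d i"] show False by linarith
  qed
  moreover obtain h :: "nat set \<Rightarrow> real" where "inj h"
    using eqpoll_imp_lepoll[OF nat_sets_eqpoll_reals] unfolding lepoll_def by blast
  ultimately have "inj_on (h \<circ> B) S" by (intro comp_inj_on) (auto intro: inj_on_subset)
  then show ?thesis by blast
qed

locale real_copy = metric_kernel N U S d
  for N :: "'b::complete_space measure" and U S d +
  fixes c :: "'b \<Rightarrow> real"
  assumes c_inj: "inj_on c S"
begin

definition decode :: "real \<Rightarrow> 'b" where "decode = the_inv_into S c"

text \<open>Points outside \<open>S\<close>, a null set, are sent to one fixed code, so that all
  values lie in the space of the copy.\<close>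

definition encode :: "'b \<Rightarrow> real" where "encode x = (if x \<in> S then c x else c (d 0))"

text \<open>The injection \<open>c\<close> is arbitrary and need not be Borel for the usual topology
  of the reals; the sigma-algebra is therefore pulled back along \<open>decode\<close>.\<close>

definition RM :: "real measure" where
  "RM = distr N (vimage_algebra (c ` S) decode borel) encode"

definition RU :: "real \<Rightarrow> real \<Rightarrow> real" where "RU a b = U (decode a) (decode b)"

lemma d_in_S: "d i \<in> S" using d_range by auto

lemma space_RM [simp]: "space RM = c ` S" and sets_RM: "sets RM = sets (vimage_algebra (c ` S) decode borel)"
  by (simp_all add: RM_def)

lemma decode_c [simp]: "x \<in> S \<Longrightarrow> decode (c x) = x"
  unfolding decode_def by (rule the_inv_into_f_f[OF c_inj])

lemma decode_in_S: "a \<in> c ` S \<Longrightarrow> decode a \<in> S"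
  by auto

lemma decode_encode: "x \<in> S \<Longrightarrow> decode (encode x) = x"
  by (simp add: encode_def)

lemma encode_space: "encode x \<in> c ` S"
  using d_in_S by (simp add: encode_def)

lemma S_measurable [measurable]: "S \<in> sets borel"
  using S_closed by simp

lemma encode_measurable': "encode \<in> N \<rightarrow>\<^sub>M vimage_algebra (c ` S) decode borel"
proof (rule measurable_vimage_algebra2)
  have "(\<lambda>x. if x \<in> S then x else d 0) \<in> borel \<rightarrow>\<^sub>M borel" by measurable
  moreover have "(\<lambda>x. decode (encode x)) = (\<lambda>x. if x \<in> S then x else d 0)"
    using d_in_S by (auto simp: encode_def)
  ultimately show "(\<lambda>x. decode (encode x)) \<in> borel_measurable N" by (simp add: borel_measurable_N)
qed (use encode_space in auto)

lemma encode_measurable [measurable]: "encode \<in> N \<rightarrow>\<^sub>M RM"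
  using encode_measurable' by (simp add: measurable_def sets_RM)

lemma decode_measurable [measurable]: "decode \<in> RM \<rightarrow>\<^sub>M N"
proof -
  have "decode \<in> vimage_algebra (c ` S) decode borel \<rightarrow>\<^sub>M borel" by (rule measurable_vimage_algebra1) simp
  then show ?thesis by (simp add: measurable_def sets_RM sets_N)
qed

lemma measurable_into_RM:
  assumes "g \<in> space K \<rightarrow> c ` S" "(\<lambda>x. decode (g x)) \<in> K \<rightarrow>\<^sub>M N"
  shows "g \<in> K \<rightarrow>\<^sub>M RM"
proof -
  have "(\<lambda>x. decode (g x)) \<in> borel_measurable K"
    using assms(2) by (simp add: measurable_def sets_N)
  from measurable_vimage_algebra2[OF assms(1) this] show ?thesis
    by (simp add: measurable_def sets_RM)
qed

lemma RM_eq: "RM = distr N RM encode"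
  unfolding RM_def by (rule distr_cong) simp_all

lemma prob_space_RM: "prob_space RM"
  unfolding RM_def by (rule prob_space_distr[OF encode_measurable'])

lemma kernel_RU: "kernel RM RU"
proof -
  interpret R: prob_space RM by (rule prob_space_RM)
  show ?thesis
  proof
    have "case_prod RU = (\<lambda>p. U (decode (fst p)) (decode (snd p)))" by (auto simp: RU_def)
    moreover have "(\<lambda>p. U (decode (fst p)) (decode (snd p))) \<in> borel_measurable (RM \<Otimes>\<^sub>M RM)" by measurable
    ultimately show "case_prod RU \<in> borel_measurable (RM \<Otimes>\<^sub>M RM)" by simp
  qed (auto simp: RU_def intro: W_sym W_nonneg W_le_1)
qed

lemma AE_RM_iff:
  assumes "{a \<in> space RM. P a} \<in> sets RM"
  shows "(AE a in RM. P a) \<longleftrightarrow> (AE x in N. P (encode x))"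
  by (subst RM_eq, rule AE_distr_iff[OF encode_measurable assms])

lemma integral_RM:
  fixes f :: "real \<Rightarrow> real"
  assumes "f \<in> borel_measurable RM"
  shows "(\<integral>a. f a \<partial>RM) = (\<integral>x. f (encode x) \<partial>N)"
  by (subst RM_eq, rule integral_distr[OF encode_measurable assms])

lemma graphon_dist_RU:
  assumes "a \<in> c ` S" "b \<in> c ` S"
  shows "graphon_dist RM RU a b = dist (decode a) (decode b)"
proof -
  have "graphon_dist RM RU a b = (\<integral>x. \<bar>RU a (encode x) - RU b (encode x)\<bar> \<partial>N)"
    unfolding graphon_dist_def by (rule integral_RM) (simp add: RU_def)
  also have "\<dots> = (\<integral>x. \<bar>U (decode a) x - U (decode b) x\<bar> \<partial>N)"
  proof (rule integral_cong_AE)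
    show "AE x in N. \<bar>RU a (encode x) - RU b (encode x)\<bar> = \<bar>U (decode a) x - U (decode b) x\<bar>"
      using S_full by eventually_elim (simp add: RU_def decode_encode)
  qed (simp_all add: RU_def)
  also have "\<dots> = dist (decode a) (decode b)"
    using dist_eq[OF decode_in_S decode_in_S] assms by (simp add: graphon_dist_def)
  finally show ?thesis .
qed

section \<open>Topology of the copy\<close>

sublocale R: Metric_space "space RM" "graphon_dist RM RU"
proof
  fix x y z
  show "0 \<le> graphon_dist RM RU x y" by (simp add: graphon_dist_def)
  show "graphon_dist RM RU x y = graphon_dist RM RU y x" by (simp add: graphon_dist_def abs_minus_commute)
  assume x: "x \<in> space RM" "y \<in> space RM"
  then show "graphon_dist RM RU x y = 0 \<longleftrightarrow> x = y"
    by (auto simp: graphon_dist_RU)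
  assume "z \<in> space RM"
  with x show "graphon_dist RM RU x z \<le> graphon_dist RM RU x y + graphon_dist RM RU y z"
    by (auto simp: graphon_dist_RU intro: dist_triangle)
qed

lemma mcomplete_R: "R.mcomplete"
  unfolding R.mcomplete_def
proof (intro allI impI)
  fix \<sigma> assume \<sigma>: "R.MCauchy \<sigma>"
  then have "range \<sigma> \<subseteq> space RM" unfolding R.MCauchy_def by blast
  then have r: "\<sigma> n \<in> c ` S" for n by auto
  have "Cauchy (\<lambda>n. decode (\<sigma> n))"
    unfolding Cauchy_def
  proof (intro allI impI)
    fix e :: real assume "e > 0"
    with \<sigma> obtain K where "\<And>n n'. K \<le> n \<Longrightarrow> K \<le> n' \<Longrightarrow> graphon_dist RM RU (\<sigma> n) (\<sigma> n') < e"
      unfolding R.MCauchy_def by metis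
    then show "\<exists>K. \<forall>m\<ge>K. \<forall>n\<ge>K. dist (decode (\<sigma> m)) (decode (\<sigma> n)) < e"
      using r by (auto simp: graphon_dist_RU)
  qed
  then obtain l where l: "(\<lambda>n. decode (\<sigma> n)) \<longlonglongrightarrow> l" using Cauchy_convergent convergent_def by blast
  have lS: "l \<in> S" using closed_sequentially[OF S_closed _ l] decode_in_S r by blast
  have "limitin R.mtopology \<sigma> (c l) sequentially"
    unfolding R.limit_metric_sequentially
  proof (intro conjI allI impI)
    fix e :: real assume "e > 0"
    then obtain K where "\<And>n. n \<ge> K \<Longrightarrow> dist (decode (\<sigma> n)) l < e" using l unfolding lim_sequentially by blast
    then show "\<exists>K. \<forall>n\<ge>K. \<sigma> n \<in> space RM \<and> graphon_dist RM RU (\<sigma> n) (c l) < e"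
      using r lS by (auto simp: graphon_dist_RU)
  qed (use lS in simp)
  then show "\<exists>x. limitin R.mtopology \<sigma> x sequentially" ..
qed

lemma openin_R_iff: "openin R.mtopology X \<longleftrightarrow> (\<exists>O'. open O' \<and> X = decode -` O' \<inter> c ` S)"
proof
  assume X: "openin R.mtopology X"
  then have sub: "X \<subseteq> c ` S" using R.openin_mtopology by auto
  have "\<forall>x\<in>X. \<exists>r>0. R.mball x r \<subseteq> X" using X R.openin_mtopology by blast
  then obtain r where r: "\<And>x. x \<in> X \<Longrightarrow> r x > 0" "\<And>x. x \<in> X \<Longrightarrow> R.mball x (r x) \<subseteq> X" by metis
  have "X = decode -` (\<Union>x\<in>X. ball (decode x) (r x)) \<inter> c ` S"
  proof (intro equalityI subsetI)
    fix y assume "y \<in> X" then show "y \<in> decode -` (\<Union>x\<in>X. ball (decode x) (r x)) \<inter> c ` S"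
      using sub r(1) by (auto intro!: bexI[of _ y])
  next
    fix y assume "y \<in> decode -` (\<Union>x\<in>X. ball (decode x) (r x)) \<inter> c ` S"
    then obtain x where x: "x \<in> X" "dist (decode x) (decode y) < r x" "y \<in> c ` S" by auto
    then have "y \<in> R.mball x (r x)"
      using sub graphon_dist_RU[of x y] unfolding R.in_mball by auto
    then show "y \<in> X" using r(2) x(1) by blast
  qed
  moreover have "open (\<Union>x\<in>X. ball (decode x) (r x))" by auto
  ultimately show "\<exists>O'. open O' \<and> X = decode -` O' \<inter> c ` S" by blast
next
  assume "\<exists>O'. open O' \<and> X = decode -` O' \<inter> c ` S"
  then obtain O' where O': "open O'" "X = decode -` O' \<inter> c ` S" by blast
  show "openin R.mtopology X"
    unfolding R.openin_mtopology
  proof (intro conjI allI impI)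
    fix x assume x: "x \<in> X"
    then obtain r where r: "r > 0" "ball (decode x) r \<subseteq> O'" using O' by (auto simp: open_contains_ball)
    have "R.mball x r \<subseteq> X"
    proof
      fix y assume "y \<in> R.mball x r"
      then have "y \<in> c ` S" "dist (decode x) (decode y) < r"
        using graphon_dist_RU[of x y] unfolding R.in_mball by auto
      then show "y \<in> X" using r O'(2) by auto
    qed
    then show "\<exists>r>0. R.mball x r \<subseteq> X" using r by blast
  qed (use O' in auto)
qed

text \<open>Pulling back commutes with generating a sigma-algebra, and the pulled back open sets are
  the open sets of the metric. This makes the copy a standard Borel space.\<close>

lemma sets_RM_borel: "sets RM = sigma_sets (space RM) {X. openin R.mtopology X}"
proof -
  have "sets RM = sets (vimage_algebra (c ` S) decode (sigma UNIV {O'. open O'}))"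
    unfolding sets_RM by (simp add: borel_def)
  also have "\<dots> = sets (sigma (c ` S) {decode -` A \<inter> c ` S |A. A \<in> {O'. open O'}})"
    by (subst vimage_algebra_sigma) auto
  also have "{decode -` A \<inter> c ` S |A. A \<in> {O'. open O'}} = {X. openin R.mtopology X}"
    unfolding openin_R_iff by auto
  also have "sets (sigma (c ` S) {X. openin R.mtopology X}) = sigma_sets (space RM) {X. openin R.mtopology X}"
    using R.openin_mtopology by (subst sets_measure_of) auto
  finally show ?thesis .
qed

lemma second_countable_R: "second_countable R.mtopology"
  unfolding second_countable_def
proof (intro exI conjI allI ballI impI)
  let ?b = "\<lambda>(i, k). decode -` ball (d i) (inverse (real (Suc k))) \<inter> c ` S"
  show "countable (range ?b)" by simp
  show "openin R.mtopology X" if "X \<in> range ?b" for X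
    using that unfolding openin_R_iff by auto
  fix X x assume *: "openin R.mtopology X \<and> x \<in> X"
  then obtain O' where O': "open O'" "X = decode -` O' \<inter> c ` S" unfolding openin_R_iff by blast
  then obtain e where e: "e > 0" "ball (decode x) e \<subseteq> O'" using * by (auto simp: open_contains_ball)
  obtain k where k: "inverse (real (Suc k)) < e / 2" using reals_Archimedean[of "e / 2"] e by auto
  have "decode x \<in> closure (range d)" using d_dense decode_in_S * O' by blast
  then obtain i where i: "dist (d i) (decode x) < inverse (real (Suc k))"
    unfolding closure_approachable by (metis inverse_positive_iff_positive of_nat_0_less_iff rangeE zero_less_Suc)
  have "ball (d i) (inverse (real (Suc k))) \<subseteq> ball (decode x) e"
  proof
    fix z assume "z \<in> ball (d i) (inverse (real (Suc k)))"
    then show "z \<in> ball (decode x) e" using i k dist_triangle3[of "decode x" z "d i"] by simp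
  qed
  then have "x \<in> ?b (i, k)" "?b (i, k) \<subseteq> X" using i e O' * by auto
  then show "\<exists>V\<in>range ?b. x \<in> V \<and> V \<subseteq> X" by blast
qed

lemma graphon_R: "graphon RM RU"
proof -
  interpret K: kernel RM RU by (rule kernel_RU)
  have "standard_prob_space RM"
    unfolding standard_prob_space_def
    by (intro conjI exI[of _ R.mtopology] prob_space_RM second_countable_R sets_RM_borel
      R.completely_metrizable_space_mtopology mcomplete_R R.topspace_mtopology)
  then show ?thesis
    unfolding graphon_def using K.W_measurable K.W_sym K.W_nonneg K.W_le_1 by blast
qed

lemma pure_R: "pure_graphon RM RU"
  unfolding pure_graphon_def
proof (intro conjI allI impI graphon_R R.Metric_space_axioms mcomplete_R)
  interpret K: prob_space RM by (rule prob_space_RM)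
  fix X assume X: "openin R.mtopology X \<and> X \<noteq> {}"
  then obtain x O' where O': "open O'" "X = decode -` O' \<inter> c ` S" and x: "x \<in> X" unfolding openin_R_iff by blast
  then obtain e where e: "e > 0" "ball (decode x) e \<subseteq> O'" by (auto simp: open_contains_ball)
  have XR: "X \<in> sets RM" using X unfolding sets_RM_borel by blast
  have "0 < measure N (ball (decode x) e)" using x O' e by (intro ball_pos decode_in_S) auto
  also have "\<dots> = measure N (ball (decode x) e \<inter> S)"
    using S_full by (intro finite_measure_eq_AE) (auto simp: sets_N elim!: eventually_mono)
  also have "\<dots> \<le> measure N (encode -` X \<inter> space N)"
  proof (rule finite_measure_mono)
    show "ball (decode x) e \<inter> S \<subseteq> encode -` X \<inter> space N"
      using e O' by (auto simp: encode_def)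
    show "encode -` X \<inter> space N \<in> sets N" by (rule measurable_sets[OF encode_measurable XR])
  qed
  also have "\<dots> = measure RM X"
    using measure_distr[OF encode_measurable XR] RM_eq by simp
  finally show "0 < measure RM X" .
qed

lemma weakly_isomorphic_R: "weakly_isomorphic N U RM RU"
proof (rule hom_density_transfer[OF kernel_axioms kernel_RU encode_measurable RM_eq[symmetric]])
  interpret P: pair_prob_space N N by standard
  interpret K: kernel RM RU by (rule kernel_RU)
  show "AE p in N \<Otimes>\<^sub>M N. RU (encode (fst p)) (encode (snd p)) = U (fst p) (snd p)"
  proof (rule P.AE_pair_measure)
    show "{p \<in> space (N \<Otimes>\<^sub>M N). RU (encode (fst p)) (encode (snd p)) = U (fst p) (snd p)} \<in> sets (N \<Otimes>\<^sub>M N)"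
      by measurable
    show "AE x in N. AE y in N. RU (encode (fst (x, y))) (encode (snd (x, y))) = U (fst (x, y)) (snd (x, y))"
      using S_full
    proof eventually_elim
      case (elim x)
      from S_full show ?case by eventually_elim (simp add: RU_def decode_encode elim)
    qed
  qed
qed

text \<open>Conjugation with the coding. As \<open>\<sigma>\<close> is the identity outside
  \<open>S\<close>, it is a bijection of the whole type and \<open>inv \<sigma>\<close> maps
  \<open>S\<close> to itself.\<close>

lemma automorphism_R:
  assumes \<sigma>: "bij_betw \<sigma> S S" "\<And>x. x \<notin> S \<Longrightarrow> \<sigma> x = x" "\<sigma> \<in> N \<rightarrow>\<^sub>M N" "inv \<sigma> \<in> N \<rightarrow>\<^sub>M N" "distr N N \<sigma> = N"
    "\<And>x. x \<in> S \<Longrightarrow> AE y in N. U (\<sigma> x) (\<sigma> y) = U x y"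
  shows "graphon_automorphism RM RU (\<lambda>a. c (\<sigma> (decode a)))"
proof -
  let ?\<rho> = "\<lambda>a. c (\<sigma> (decode a))"
  interpret K: kernel RM RU by (rule kernel_RU)
  have \<sigma>S: "\<sigma> x \<in> S" if "x \<in> S" for x using \<sigma>(1) that by (auto simp: bij_betw_def)
  have bij: "bij \<sigma>"
  proof -
    have "bij_betw \<sigma> (- S) (- S)" using \<sigma>(2) by (intro bij_betw_byWitness[where f'="\<lambda>x. x"]) auto
    from bij_betw_combine[OF \<sigma>(1) this] show ?thesis by simp
  qed
  have inv: "inv \<sigma> x \<in> S" if "x \<in> S" for x
    using that \<sigma>(1) bij by (metis bij_betw_def imageE inv_f_f)
  note [measurable] = \<sigma>(3,4)
  have decR: "decode (?\<rho> a) = \<sigma> (decode a)" if "a \<in> c ` S" for a using that \<sigma>S by auto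
  have bijR: "bij_betw ?\<rho> (space RM) (space RM)"
  proof (rule bij_betw_byWitness[where f'="\<lambda>a. c (inv \<sigma> (decode a))"])
    show "\<forall>a\<in>space RM. c (inv \<sigma> (decode (c (\<sigma> (decode a))))) = a"
      using \<sigma>S bij by (auto simp: bij_is_inj inv_f_f)
    show "\<forall>a\<in>space RM. c (\<sigma> (decode (c (inv \<sigma> (decode a))))) = a"
      using inv bij by (auto simp: bij_is_surj surj_f_inv_f)
  qed (use \<sigma>S inv in auto)
  have m: "?\<rho> \<in> RM \<rightarrow>\<^sub>M RM"
  proof (rule measurable_into_RM)
    have "(\<lambda>a. \<sigma> (decode a)) \<in> RM \<rightarrow>\<^sub>M N" by measurable
    then show "(\<lambda>a. decode (?\<rho> a)) \<in> RM \<rightarrow>\<^sub>M N" by (rule measurable_cong[THEN iffD1, rotated]) (simp add: decR)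
  qed (use \<sigma>S in auto)
  have m': "the_inv_into (space RM) ?\<rho> \<in> RM \<rightarrow>\<^sub>M RM"
  proof -
    have eq: "the_inv_into (space RM) ?\<rho> a = c (inv \<sigma> (decode a))" if "a \<in> space RM" for a
      using that inv bij bijR
      by (intro the_inv_into_f_eq) (auto simp: bij_betw_def bij_is_surj surj_f_inv_f)
    have "(\<lambda>a. c (inv \<sigma> (decode a))) \<in> RM \<rightarrow>\<^sub>M RM"
    proof (rule measurable_into_RM)
      have "(\<lambda>a. inv \<sigma> (decode a)) \<in> RM \<rightarrow>\<^sub>M N" by measurable
      then show "(\<lambda>a. decode (c (inv \<sigma> (decode a)))) \<in> RM \<rightarrow>\<^sub>M N"
        by (rule measurable_cong[THEN iffD1, rotated]) (use inv in auto)
    qed (use inv in auto)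
    then show ?thesis by (rule measurable_cong[THEN iffD1, rotated]) (simp only: eq)
  qed
  have D: "distr RM RM ?\<rho> = RM"
  proof -
    have "distr RM RM ?\<rho> = distr (distr N RM encode) RM ?\<rho>" by (simp flip: RM_eq)
    also have "\<dots> = distr N RM (?\<rho> \<circ> encode)" by (rule distr_distr[OF m encode_measurable])
    \<comment> \<open>The two maps agree on \<open>S\<close>, hence almost everywhere.\<close>
    also have "\<dots> = distr N RM (encode \<circ> \<sigma>)"
    proof (rule distr_cong_AE[OF refl refl])
      show "AE x in N. (?\<rho> \<circ> encode) x = (encode \<circ> \<sigma>) x"
        using S_full by eventually_elim (simp add: decode_encode, simp add: encode_def \<sigma>S)
    qed (use measurable_comp[OF encode_measurable m] measurable_comp[OF \<sigma>(3) encode_measurable] in auto)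
    also have "\<dots> = distr (distr N N \<sigma>) RM encode" by (rule distr_distr[OF encode_measurable \<sigma>(3), symmetric])
    also have "\<dots> = RM" unfolding \<sigma>(5) by (rule RM_eq[symmetric])
    finally show ?thesis .
  qed
  have edges: "AE b in RM. RU (?\<rho> a) (?\<rho> b) = RU a b" if a: "a \<in> space RM" for a
  proof (subst AE_RM_iff)
    have [measurable]: "?\<rho> \<in> RM \<rightarrow>\<^sub>M RM" by (rule m)
    have "?\<rho> a \<in> space RM" by (rule measurable_space[OF m a])
    then show "{b \<in> space RM. RU (?\<rho> a) (?\<rho> b) = RU a b} \<in> sets RM" using a by measurable
    have "decode a \<in> S" using a decode_in_S by simp
    from \<sigma>(6)[OF this] S_full show "AE x in N. RU (?\<rho> a) (?\<rho> (encode x)) = RU a (encode x)"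
    proof eventually_elim
      case (elim x)
      then show ?case using \<open>decode a \<in> S\<close> \<sigma>S by (simp add: RU_def decode_encode)
    qed
  qed
  show ?thesis unfolding graphon_automorphism_def using bijR m m' D edges by blast
qed

lemma transitive_R:
  assumes "\<forall>F\<in>labeled_simple_graphs. \<exists>c. AE x in N. labeled_density N U F x = c"
    and "a \<in> space RM" "b \<in> space RM"
  shows "\<exists>\<rho>. graphon_automorphism RM RU \<rho> \<and> \<rho> a = b"
proof -
  have S: "decode a \<in> S" "decode b \<in> S" using assms decode_in_S by auto
  show ?thesis
  proof (rule ess_constant_imp_transitive[OF assms(1) S])
    fix \<sigma> assume \<sigma>: "bij_betw \<sigma> S S" "\<And>x. x \<notin> S \<Longrightarrow> \<sigma> x = x" "\<sigma> \<in> N \<rightarrow>\<^sub>M N" "inv \<sigma> \<in> N \<rightarrow>\<^sub>M N" "distr N N \<sigma> = N"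
      "\<And>x. x \<in> S \<Longrightarrow> AE y in N. U (\<sigma> x) (\<sigma> y) = U x y" "\<sigma> (decode a) = decode b"
    have "c (\<sigma> (decode a)) = b" unfolding \<sigma>(7) using assms(3) by auto
    with automorphism_R[OF \<sigma>(1-6)] show ?thesis by blast
  qed
qed

end

text \<open>Weak isomorphism carries constancy of the t_x to the constructed representation, where
  back and forth joins any two nodes; the copy on the reals is the required witness.\<close>

lemma (in kernel) ess_constant_imp_node_transitive:
  assumes "\<forall>F\<in>labeled_simple_graphs. \<exists>c. AE x in M. labeled_density M W F x = c"
  shows "node_transitive M W"
proof -
  obtain N :: "(nat discrete \<Rightarrow>\<^sub>C real) measure" and U S d
    where N: "metric_kernel N U S d" and iso: "weakly_isomorphic M W N U"
    by (rule metric_kernel_representation) (rule that)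
  interpret N: metric_kernel N U S d by (rule N)
  obtain c where "inj_on (c :: _ \<Rightarrow> real) S" using N.inj_into_reals by blast
  then interpret R: real_copy N U S d c by unfold_locales
  have const: "\<forall>F\<in>labeled_simple_graphs. \<exists>c. AE x in N. labeled_density N U F x = c"
    using assms weakly_isomorphic_ess_constant[OF kernel_axioms N.kernel_axioms iso] by blast
  have "weakly_isomorphic M W R.RM R.RU"
    using iso R.weakly_isomorphic_R by (simp add: weakly_isomorphic_def)
  then show ?thesis
    unfolding node_transitive_def pure_representation_def
    using R.pure_R R.transitive_R[OF const] by blast
qed

theorem theorem5p8:
  fixes M :: "'a measure" and W :: "'a \<Rightarrow> 'a \<Rightarrow> real"
  assumes "graphon M W"
  shows "(node_transitive M W \<longleftrightarrow>
            (\<forall>F\<in>labeled_simple_graphs. \<exists>c. AE x in M. labeled_density M W F x = c)) \<and>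
         ((\<forall>F\<in>labeled_simple_graphs. \<exists>c. AE x in M. labeled_density M W F x = c) \<longleftrightarrow>
            has_Linf_dim M (algebra_A1 M W) 1) \<and>
         (has_Linf_dim M (algebra_A1 M W) 1 \<longleftrightarrow>
            matrix_rank labeled_simple_graphs (connection_matrix M W) = 1) \<and>
         (matrix_rank labeled_simple_graphs (connection_matrix M W) = 1 \<longleftrightarrow>
            (\<forall>F\<in>labeled_simple_graphs. \<forall>H\<in>labeled_simple_graphs.
               hom_density M W (unlabel (glue F F)) * hom_density M W (unlabel (glue H H)) =
               (hom_density M W (unlabel (glue F H)))\<^sup>2))"
proof -
  interpret kernel M W by (rule graphon_kernel[OF assms])
  have "node_transitive M W \<longleftrightarrow> (\<forall>F\<in>labeled_simple_graphs. \<exists>c. AE x in M. labeled_density M W F x = c)"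
    using node_transitive_imp_ess_constant[OF assms] ess_constant_imp_node_transitive by blast
  then show ?thesis
    using ess_constant_iff_Linf_dim matrix_rank_iff_ess_constant ess_constant_iff_determinants
    unfolding connection_matrix_def by argo
qed

end
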